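(* Let $\mathcal{M}$ be a complete Riemannian manifold, let $f\colon\mathcal{M}\to\mathbb{R}$ be twice continuously differentiable, let $x_0\in\mathcal{M}$ be arbitrary, and let $x_0,x_1,x_2,\ldots$ be the iterates (with trial steps $s_0,s_1,\ldots$) produced by the ARC algorithm (described in the context) with the exponential retraction $\mathrm{R}=\mathrm{Exp}$. Assume: (A1) there is a finite $f_{\mathrm{low}}$ with $f(x)\ge f_{\mathrm{low}}$ for all $x\in\mathcal{M}$; (A2) there is a constant $L$ such that at each iteration $k$, with $\hat f_k=f\circ\mathrm{Exp}_{x_k}$, $\hat f_k(s_k)-\big[\hat f_k(0)+\langle s_k,\nabla\hat f_k(0)\rangle+\frac12\langle s_k,\nabla^2\hat f_k(0)[s_k]\rangle\big]\le\frac L6\|s_k\|^3$; (A3) there is a constant $L'$ such that at each successful iteration $k$, $\|P_{s_k}^{-1}\mathrm{grad} f(\mathrm{Exp}_{x_k}(s_k))-\mathrm{grad} f(x_k)-\mathrm{Hess} f(x_k)[s_k]\|\le\frac{L'}2\|s_k\|^2$. Let $\varsigma_{\max}=\max\!\left(\varsigma_0,\frac{L\gamma_3}{2(1-\eta_2)}\right)$ and, for $\varepsilon>0$, $$K_1(\varepsilon)=\frac{3(f(x_0)-f_{\mathrm{low}})}{\eta_1\varsigma_{\min}}\left(\frac{L'}2+\theta+\varsigma_{\max}\right)^{1.5}\frac1{\varepsilon^{1.5}}.$$ Then for any $\varepsilon>0$ the algorithm produces a point $x_k\in\mathcal{M}$ such that $f(x_k)\le f(x_0)$ and $\|\mathrm{grad}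 f(x_k)\|\le\varepsilon$ in at most $$\left(1+\frac{|\log(\gamma_1)|}{\log(\gamma_2)}\right)K_1(\varepsilon)+\frac1{\log(\gamma_2)}\log\left(\frac{\varsigma_{\max}}{\varsigma_0}\right)+1$$ iterations.
   Context: Notation. $\mathrm{T}_x\mathcal{M}$ is the tangent space at $x$ with Riemannian inner product $\langle\cdot,\cdot\rangle$ and norm $\|\cdot\|$; $\mathrm{grad} f$ and $\mathrm{Hess} f$ are the Riemannian gradient and Hessian; $\nabla,\nabla^2$ are the usual gradient and Hessian of functions on the Euclidean space $\mathrm{T}_x\mathcal{M}$; $\lambda_{\min}$ is the smallest eigenvalue. $\mathrm{Exp}$ is the Riemannian exponential map. For $s\in \mathrm{T}_x\mathcal{M}$, $P_s\colon\mathrm{T}_x\mathcal{M}\to\mathrm{T}_{\mathrm{Exp}_x(s)}\mathcal{M}$ is parallel transport along $t\mapsto\mathrm{Exp}_x(ts)$ from $t=0$ to $t=1$. ARC algorithm with retraction $\mathrm{R}$. Parameters: $\theta>0$, $\varsigma_{\min}>0$, $0<\eta_1\le\eta_2<1$, $0<\gamma_1<1<\gamma_2<\gamma_3$. Input: $x_0\in\mathcal{M}$, $\varsigma_0\ge\varsigma_{\min}$. For $k=0,1,2,\ldots$: let $\hat f_k=f\circ\mathrm{R}_{x_k}\colon\mathrm{T}_{x_k}\mathcal{M}\to\mathbb{R}$ and define $m_k(s)=\hat f_k(0)+\langle s,\nabla\hat f_k(0)\rangle+\frac12\langle s,\nabla^2\hat f_k(0)[s]\rangle+\frac{\varsigma_k}{3}\|s\|^3$.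 A subproblem solver returns any $s_k\in\mathrm{T}_{x_k}\mathcal{M}$ satisfying $m_k(s_k)\le m_k(0)$ and $\|\nabla m_k(s_k)\|\le\theta\|s_k\|^2$ (optionally also $\lambda_{\min}(\nabla^2m_k(s_k))\ge-\theta\|s_k\|$). If $s_k=0$, terminate. Otherwise compute $\rho_k=\dfrac{f(x_k)-f(\mathrm{R}_{x_k}(s_k))}{m_k(0)-m_k(s_k)+\frac{\varsigma_k}{3}\|s_k\|^3}$. If $\rho_k\ge\eta_1$ (iteration $k$ is successful), set $x_{k+1}=\mathrm{R}_{x_k}(s_k)$; otherwise (unsuccessful) set $x_{k+1}=x_k$. Choose $\varsigma_{k+1}\in[\max(\varsigma_{\min},\gamma_1\varsigma_k),\varsigma_k]$ if $\rho_k\ge\eta_2$; $\varsigma_{k+1}\in[\varsigma_k,\gamma_2\varsigma_k]$ if $\rho_k\in[\eta_1,\eta_2)$; $\varsigma_{k+1}\in[\gamma_2\varsigma_k,\gamma_3\varsigma_k]$ if $\rho_k<\eta_1$. *)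

theory Defs
  imports "HOL-Analysis.Analysis"
begin

section \<open>Functions of class $C^n$ on open subsets of a Euclidean space\<close>

text \<open>Only meaningful for open \<^term>\<open>S\<close>.  In finite dimension, continuity of all iterated
  directional derivatives is continuity of the iterated Frechet derivatives.\<close>

primrec Cn_on :: "nat \<Rightarrow> 'a::euclidean_space set \<Rightarrow> ('a \<Rightarrow> 'b::real_normed_vector) \<Rightarrow> bool" where
  "Cn_on 0 S f \<longleftrightarrow> continuous_on S f"
| "Cn_on (Suc n) S f \<longleftrightarrow> (\<forall>x\<in>S. f differentiable (at x)) \<and>
     (\<forall>v. Cn_on n S (\<lambda>x. frechet_derivative f (at x) v))"

definition smooth_on :: "'a::euclidean_space set \<Rightarrow> ('a \<Rightarrow> 'b::real_normed_vector) \<Rightarrow> bool" where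
  "smooth_on S f \<longleftrightarrow> (\<forall>n. Cn_on n S f)"


section \<open>Smooth manifolds\<close>

text \<open>The manifold is the whole type \<^typ>\<open>'m\<close>, modelled on the Euclidean space \<^typ>\<open>'e\<close>.
  A chart is a pair of its domain and its coordinate map; the map is irrelevant
  outside the domain.\<close>

type_synonym ('m, 'e) chart = "'m set \<times> ('m \<Rightarrow> 'e)"

definition chart_inv :: "('m, 'e) chart \<Rightarrow> 'e \<Rightarrow> 'm" where
  "chart_inv c = inv_into (fst c) (snd c)"

definition transition :: "('m, 'e) chart \<Rightarrow> ('m, 'e) chart \<Rightarrow> 'e \<Rightarrow> 'e" where
  "transition c d = snd d \<circ> chart_inv c"

definition smooth_atlas ::
  "('m::{t2_space,second_countable_topology}, 'e::euclidean_space) chart set \<Rightarrow> bool" where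
  "smooth_atlas A \<longleftrightarrow>
     (\<Union>c\<in>A. fst c) = UNIV \<and>
     (\<forall>c\<in>A. open (fst c) \<and> open (snd c ` fst c) \<and>
        homeomorphism (fst c) (snd c ` fst c) (snd c) (chart_inv c)) \<and>
     (\<forall>c\<in>A. \<forall>d\<in>A. smooth_on (snd c ` (fst c \<inter> fst d)) (transition c d))"

text \<open>A tangent vector at \<^term>\<open>x\<close> is represented by its coordinates in one fixed preferred
  chart around \<^term>\<open>x\<close>, so every tangent space is the vector space \<^typ>\<open>'e\<close>.  The inner product
  of the tangent space is the Riemannian metric, not the one of the type class.\<close>

record ('m, 'e) riem =
  atlas :: "('m, 'e) chart set"
  metric :: "'m \<Rightarrow> 'e \<Rightarrow> 'e \<Rightarrow> real"

definition chart_at :: "('m, 'e) riem \<Rightarrow> 'm \<Rightarrow> ('m, 'e) chart" where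
  "chart_at M x = (SOME c. c \<in> atlas M \<and> x \<in> fst c)"

text \<open>Change of coordinates of tangent vectors: \<open>to_chart M c x v\<close> are the coordinates in
  the chart \<^term>\<open>c\<close> of the tangent vector \<^term>\<open>v\<close> at \<^term>\<open>x\<close>, and \<open>of_chart M c x\<close> is the inverse.\<close>

definition to_chart ::
  "('m, 'e::euclidean_space) riem \<Rightarrow> ('m, 'e) chart \<Rightarrow> 'm \<Rightarrow> 'e \<Rightarrow> 'e" where
  "to_chart M c x v =
     frechet_derivative (transition (chart_at M x) c) (at (snd (chart_at M x) x)) v"

definition of_chart ::
  "('m, 'e::euclidean_space) riem \<Rightarrow> ('m, 'e) chart \<Rightarrow> 'm \<Rightarrow> 'e \<Rightarrow> 'e" where
  "of_chart M c x u = frechet_derivative (transition c (chart_at M x)) (at (snd c x)) u"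

definition Cn_function ::
  "nat \<Rightarrow> ('m, 'e::euclidean_space) riem \<Rightarrow> ('m \<Rightarrow> real) \<Rightarrow> bool" where
  "Cn_function n M f \<longleftrightarrow> (\<forall>c\<in>atlas M. Cn_on n (snd c ` fst c) (f \<circ> chart_inv c))"


section \<open>Riemannian manifolds\<close>

definition metric_in_chart ::
  "('m, 'e::euclidean_space) riem \<Rightarrow> ('m, 'e) chart \<Rightarrow> 'e \<Rightarrow> 'e \<Rightarrow> 'e \<Rightarrow> real" where
  "metric_in_chart M c p u v =
     metric M (chart_inv c p) (of_chart M c (chart_inv c p) u) (of_chart M c (chart_inv c p) v)"

definition riemannian_manifold ::
  "('m::{t2_space,second_countable_topology}, 'e::euclidean_space) riem \<Rightarrow> bool" where
  "riemannian_manifold M \<longleftrightarrow>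
     smooth_atlas (atlas M) \<and>
     (\<forall>x. bilinear (metric M x) \<and>
          (\<forall>u v. metric M x u v = metric M x v u) \<and>
          (\<forall>u. u \<noteq> 0 \<longrightarrow> metric M x u u > 0)) \<and>
     (\<forall>c\<in>atlas M. \<forall>u v. smooth_on (snd c ` fst c) (\<lambda>p. metric_in_chart M c p u v))"

definition rnorm :: "('m, 'e) riem \<Rightarrow> 'm \<Rightarrow> 'e \<Rightarrow> real" where
  "rnorm M x v = sqrt (metric M x v v)"

text \<open>The Levi-Civita connection: \<open>christoffel M x u v\<close> is the vector
  $\sum_{i,j,k} \Gamma^k_{ij} u^i v^j e_k$ for the Christoffel symbols at \<^term>\<open>x\<close> in the preferred
  chart at \<^term>\<open>x\<close>.\<close>

definition metric_deriv ::
  "('m, 'e::euclidean_space) riem \<Rightarrow> 'm \<Rightarrow> 'e \<Rightarrow> 'e \<Rightarrow> 'e \<Rightarrow> real" where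
  "metric_deriv M x w u v =
     frechet_derivative (\<lambda>p. metric_in_chart M (chart_at M x) p u v)
       (at (snd (chart_at M x) x)) w"

definition christoffel ::
  "('m, 'e::euclidean_space) riem \<Rightarrow> 'm \<Rightarrow> 'e \<Rightarrow> 'e \<Rightarrow> 'e" where
  "christoffel M x u v = (THE w. \<forall>z. metric M x w z =
     (metric_deriv M x u v z + metric_deriv M x v u z - metric_deriv M x z u v) / 2)"

definition grad ::
  "('m, 'e::euclidean_space) riem \<Rightarrow> ('m \<Rightarrow> real) \<Rightarrow> 'm \<Rightarrow> 'e" where
  "grad M f x = (THE w. \<forall>v. metric M x w v =
     frechet_derivative (f \<circ> chart_inv (chart_at M x)) (at (snd (chart_at M x) x)) v)"

text \<open>The Hessian is the covariant derivative of the gradient field, written in the preferred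
  chart at \<^term>\<open>x\<close>.\<close>

definition Hess ::
  "('m, 'e::euclidean_space) riem \<Rightarrow> ('m \<Rightarrow> real) \<Rightarrow> 'm \<Rightarrow> 'e \<Rightarrow> 'e" where
  "Hess M f x s =
     frechet_derivative
       (\<lambda>p. to_chart M (chart_at M x) (chart_inv (chart_at M x) p)
              (grad M f (chart_inv (chart_at M x) p)))
       (at (snd (chart_at M x) x)) s
     + christoffel M x s (grad M f x)"


section \<open>Geodesics, exponential map, parallel transport\<close>

definition velocity ::
  "('m, 'e::euclidean_space) riem \<Rightarrow> (real \<Rightarrow> 'm) \<Rightarrow> real \<Rightarrow> 'e" where
  "velocity M \<gamma> t = vector_derivative (\<lambda>\<tau>. snd (chart_at M (\<gamma> t)) (\<gamma> \<tau>)) (at t)"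

definition differentiable_curve ::
  "('m::topological_space, 'e::euclidean_space) riem \<Rightarrow> (real \<Rightarrow> 'm) \<Rightarrow> bool" where
  "differentiable_curve M \<gamma> \<longleftrightarrow> continuous_on UNIV \<gamma> \<and>
     (\<forall>t. (\<lambda>\<tau>. snd (chart_at M (\<gamma> t)) (\<gamma> \<tau>)) differentiable (at t))"

text \<open>\<open>has_cov_deriv M \<gamma> V D t T\<close>: the vector field \<^term>\<open>V\<close> along \<^term>\<open>\<gamma>\<close>, defined for parameters
  in \<^term>\<open>T\<close>, has covariant derivative \<^term>\<open>D\<close> at \<^term>\<open>t\<close>.  The computation takes place in the
  preferred chart at the point \<open>\<gamma> t\<close>.\<close>

definition has_cov_deriv ::
  "('m, 'e::euclidean_space) riem \<Rightarrow> (real \<Rightarrow> 'm) \<Rightarrow> (real \<Rightarrow> 'e) \<Rightarrow> 'e \<Rightarrow> real \<Rightarrow> real set \<Rightarrow> bool" where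
  "has_cov_deriv M \<gamma> V D t T \<longleftrightarrow>
     ((\<lambda>\<tau>. to_chart M (chart_at M (\<gamma> t)) (\<gamma> \<tau>) (V \<tau>)) has_vector_derivative
        (D - christoffel M (\<gamma> t) (velocity M \<gamma> t) (V t))) (at t within T)"

definition geodesic ::
  "('m::topological_space, 'e::euclidean_space) riem \<Rightarrow> (real \<Rightarrow> 'm) \<Rightarrow> bool" where
  "geodesic M \<gamma> \<longleftrightarrow> differentiable_curve M \<gamma> \<and>
     (\<forall>t. has_cov_deriv M \<gamma> (velocity M \<gamma>) 0 t UNIV)"

text \<open>Completeness is geodesic completeness: the exponential map is defined on the
  whole tangent bundle.\<close>

definition complete_riemannian_manifold ::
  "('m::{t2_space,second_countable_topology}, 'e::euclidean_space) riem \<Rightarrow> bool" where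
  "complete_riemannian_manifold M \<longleftrightarrow> riemannian_manifold M \<and>
     (\<forall>x v. \<exists>\<gamma>. geodesic M \<gamma> \<and> \<gamma> 0 = x \<and> velocity M \<gamma> 0 = v)"

definition Exp ::
  "('m::topological_space, 'e::euclidean_space) riem \<Rightarrow> 'm \<Rightarrow> 'e \<Rightarrow> 'm" where
  "Exp M x v = (THE y. \<exists>\<gamma>. geodesic M \<gamma> \<and> \<gamma> 0 = x \<and> velocity M \<gamma> 0 = v \<and> \<gamma> 1 = y)"

definition parallel_field ::
  "('m, 'e::euclidean_space) riem \<Rightarrow> (real \<Rightarrow> 'm) \<Rightarrow> (real \<Rightarrow> 'e) \<Rightarrow> bool" where
  "parallel_field M \<gamma> V \<longleftrightarrow> (\<forall>t\<in>{0..1}. has_cov_deriv M \<gamma> V 0 t {0..1})"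

definition transport ::
  "('m::topological_space, 'e::euclidean_space) riem \<Rightarrow> 'm \<Rightarrow> 'e \<Rightarrow> 'e \<Rightarrow> 'e" where
  "transport M x s v =
     (THE w. \<exists>V. parallel_field M (\<lambda>t. Exp M x (t *\<^sub>R s)) V \<and> V 0 = v \<and> V 1 = w)"


section \<open>Calculus on a tangent space\<close>

text \<open>Gradient and Hessian of a function on the Euclidean space formed by the tangent space at
  \<^term>\<open>x\<close> with the inner product \<open>metric M x\<close>.\<close>

definition tgrad ::
  "('m, 'e::euclidean_space) riem \<Rightarrow> 'm \<Rightarrow> ('e \<Rightarrow> real) \<Rightarrow> 'e \<Rightarrow> 'e" where
  "tgrad M x h u = (THE w. (h has_derivative (\<lambda>v. metric M x w v)) (at u))"

definition tHess ::
  "('m, 'e::euclidean_space) riem \<Rightarrow> 'm \<Rightarrow> ('e \<Rightarrow> real) \<Rightarrow> 'e \<Rightarrow> 'e \<Rightarrow> 'e" where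
  "tHess M x h u = frechet_derivative (tgrad M x h) (at u)"


section \<open>The ARC algorithm\<close>

definition pullback :: "('m \<Rightarrow> real) \<Rightarrow> ('m \<Rightarrow> 'e \<Rightarrow> 'm) \<Rightarrow> 'm \<Rightarrow> 'e \<Rightarrow> real" where
  "pullback f R x = f \<circ> R x"

definition taylor2 ::
  "('m, 'e::euclidean_space) riem \<Rightarrow> ('m \<Rightarrow> real) \<Rightarrow> ('m \<Rightarrow> 'e \<Rightarrow> 'm) \<Rightarrow> 'm \<Rightarrow> 'e \<Rightarrow> real" where
  "taylor2 M f R x s = pullback f R x 0 + metric M x s (tgrad M x (pullback f R x) 0)
     + 1/2 * metric M x s (tHess M x (pullback f R x) 0 s)"

definition arc_model ::
  "('m, 'e::euclidean_space) riem \<Rightarrow> ('m \<Rightarrow> real) \<Rightarrow> ('m \<Rightarrow> 'e \<Rightarrow> 'm) \<Rightarrow> 'm \<Rightarrow> real \<Rightarrow> 'e \<Rightarrow> real" where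
  "arc_model M f R x \<sigma> s = taylor2 M f R x s + \<sigma>/3 * rnorm M x s ^ 3"

definition arc_ratio ::
  "('m, 'e::euclidean_space) riem \<Rightarrow> ('m \<Rightarrow> real) \<Rightarrow> ('m \<Rightarrow> 'e \<Rightarrow> 'm) \<Rightarrow> 'm \<Rightarrow> real \<Rightarrow> 'e \<Rightarrow> real" where
  "arc_ratio M f R x \<sigma> s = (f x - f (R x s)) /
     (arc_model M f R x \<sigma> 0 - arc_model M f R x \<sigma> s + \<sigma>/3 * rnorm M x s ^ 3)"

text \<open>Iteration \<^term>\<open>k\<close> is executed iff no earlier trial step vanishes.  Terms of the sequences
  beyond termination are meaningless and unconstrained.\<close>

definition executed :: "(nat \<Rightarrow> 'e::zero) \<Rightarrow> nat \<Rightarrow> bool" where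
  "executed s k \<longleftrightarrow> (\<forall>j<k. s j \<noteq> 0)"

definition successful ::
  "('m, 'e::euclidean_space) riem \<Rightarrow> ('m \<Rightarrow> real) \<Rightarrow> ('m \<Rightarrow> 'e \<Rightarrow> 'm) \<Rightarrow> real \<Rightarrow>
   (nat \<Rightarrow> 'm) \<Rightarrow> (nat \<Rightarrow> 'e) \<Rightarrow> (nat \<Rightarrow> real) \<Rightarrow> nat \<Rightarrow> bool" where
  "successful M f R \<eta>1 x s \<sigma> k \<longleftrightarrow>
     executed s k \<and> s k \<noteq> 0 \<and> arc_ratio M f R (x k) (\<sigma> k) (s k) \<ge> \<eta>1"

definition arc_run ::
  "('m, 'e::euclidean_space) riem \<Rightarrow> ('m \<Rightarrow> real) \<Rightarrow> ('m \<Rightarrow> 'e \<Rightarrow> 'm) \<Rightarrow>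
   real \<Rightarrow> real \<Rightarrow> real \<Rightarrow> real \<Rightarrow> real \<Rightarrow> real \<Rightarrow> real \<Rightarrow>
   (nat \<Rightarrow> 'm) \<Rightarrow> (nat \<Rightarrow> 'e) \<Rightarrow> (nat \<Rightarrow> real) \<Rightarrow> bool" where
  "arc_run M f R \<theta> \<sigma>min \<eta>1 \<eta>2 \<gamma>1 \<gamma>2 \<gamma>3 x s \<sigma> \<longleftrightarrow>
     \<sigma> 0 \<ge> \<sigma>min \<and>
     (\<forall>k. executed s k \<longrightarrow>
        (let m = arc_model M f R (x k) (\<sigma> k);
             \<rho> = arc_ratio M f R (x k) (\<sigma> k) (s k)
         in m (s k) \<le> m 0 \<and>
            rnorm M (x k) (tgrad M (x k) m (s k)) \<le> \<theta> * (rnorm M (x k) (s k))\<^sup>2 \<and>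
            (s k \<noteq> 0 \<longrightarrow>
               x (Suc k) = (if \<rho> \<ge> \<eta>1 then R (x k) (s k) else x k) \<and>
               \<sigma> (Suc k) \<in> (if \<rho> \<ge> \<eta>2 then {max \<sigma>min (\<gamma>1 * \<sigma> k) .. \<sigma> k}
                            else if \<rho> \<ge> \<eta>1 then {\<sigma> k .. \<gamma>2 * \<sigma> k}
                            else {\<gamma>2 * \<sigma> k .. \<gamma>3 * \<sigma> k}))))"

end

(* Parallel transport is an isometry, so at a successful step the subproblem condition and (A3)
   bound the norm of the new gradient by (L'/2 + theta + sigma_max) |s|^2; hence |s| is bounded
   below as long as gradients exceed epsilon, and each success decreases f by a fixed amount.
   Failures multiply sigma by at least gamma_2 while sigma stays below sigma_max, so their number
   is controlled by that of the successes.

   The geometric input is that Exp is a second-order retraction: the gradient and Hessian of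
   f o Exp_x at 0 are grad f and Hess f.  The derivative of Exp_x near 0 solves the (linear)
   equation of variations along geodesics with small initial velocity.  In a chart with
   Christoffel form Gamma it is z - Gamma(v, z) + O(|v|^2 |z|), and differentiating f o Exp_x
   once more at 0 gives the coordinate expression of Hess f. *)

theory Submission
  imports Defs
begin

section \<open>Functions of class $C^n$ and families of bilinear forms\<close>

text \<open>Tangent vectors are stored in preferred charts that may jump from point to point, so
  continuity and differentiability along a curve make sense only after passing to one fixed chart;
  the covariance lemmas serve this purpose. Gradient, Christoffel form and Hessian are given only
  through inner products, and their regularity comes from one principle: implicit differentiation
  for a positive definite family of forms. Two derivatives of \<open>Exp\<close> are needed only in
  a weak sense: a derivative at every small vector, and a derivative of that derivative at
  \<open>0\<close>. Since geodesics rescale, small initial velocity replaces short time, and all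
  estimates can be made on \<open>{0..1}\<close>. The constants: a ratio below
  \<open>\<eta>2\<close> forces \<open>\<sigma> k\<close> to be at most
  \<open>L / (2 * (1 - \<eta>2))\<close>, and one update multiplies it by at most
  \<open>\<gamma>3\<close>, whence \<open>\<sigma>max\<close>. The decrease of \<open>f\<close> is
  cubic in the step length while the gradient bound is quadratic, whence the exponent 3/2. The
  gradient bound concerns the next iterate, whence the final \<open>+ 1\<close>.\<close>

lemma Cn_on_Suc_has_derivative:
  assumes "Cn_on (Suc n) S f" "x \<in> S"
  shows "(f has_derivative frechet_derivative f (at x)) (at x)"
  using assms frechet_derivative_works unfolding Cn_on.simps by blast

lemma Cn_on_imp_continuous_on:
  assumes "Cn_on n S f"
  shows "continuous_on S f"
proof (cases n)
  case (Suc m)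
  then have "\<forall>x\<in>S. f differentiable (at x)" using assms by simp
  then show ?thesis
    using continuous_at_imp_continuous_on differentiable_imp_continuous_within by blast
qed (use assms in simp)

lemma Cn_on_SucD: "Cn_on (Suc n) S f \<Longrightarrow> Cn_on n S f"
proof (induction n arbitrary: f)
  case 0
  then show ?case using Cn_on_imp_continuous_on by fastforce
next
  case (Suc n)
  have "Cn_on (Suc n) S (\<lambda>x. frechet_derivative f (at x) v)" for v
    using Suc.prems unfolding Cn_on.simps(2)[of "Suc n"] by blast
  then have "Cn_on n S (\<lambda>x. frechet_derivative f (at x) v)" for v
    by (rule Suc.IH)
  then show ?case using Suc.prems by simp
qed

text \<open>Openness of \<open>S\<close> lets a derivative at a point of \<open>S\<close> see only
  values on \<open>S\<close>, so equality on \<open>S\<close> passes to all iterated directional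
  derivatives.\<close>

lemma Cn_on_cong:
  assumes "open S" "\<And>x. x \<in> S \<Longrightarrow> f x = g x" "Cn_on n S f"
  shows "Cn_on n S g"
  using assms(2,3)
proof (induction n arbitrary: f g)
  case 0
  then show ?case using continuous_on_cong by force
next
  case (Suc n)
  have d: "(g has_derivative frechet_derivative f (at x)) (at x)" if "x \<in> S" for x
    by (rule has_derivative_transform_within_open[OF Cn_on_Suc_has_derivative[OF Suc.prems(2) that]
        assms(1) that Suc.prems(1)])
  then have e: "frechet_derivative g (at x) = frechet_derivative f (at x)" if "x \<in> S" for x
    using frechet_derivative_at that by metis
  have "Cn_on n S (\<lambda>x. frechet_derivative g (at x) v)" for v
  proof (rule Suc.IH)
    show "Cn_on n S (\<lambda>x. frechet_derivative f (at x) v)" using Suc.prems(2) by (simp only: Cn_on.simps)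
  qed (simp add: e)
  then show ?case using d unfolding Cn_on.simps differentiable_def by blast
qed

text \<open>Replaces \<open>frechet_derivative\<close> by any known derivative, so that the closure
  properties below follow from the usual rules by induction on \<open>n\<close>.\<close>

lemma Cn_on_SucI:
  assumes "open S" "\<And>x. x \<in> S \<Longrightarrow> (f has_derivative f' x) (at x)"
    and "\<And>v. Cn_on n S (\<lambda>x. f' x v)"
  shows "Cn_on (Suc n) S f"
proof -
  have "Cn_on n S (\<lambda>x. frechet_derivative f (at x) v)" for v
    using frechet_derivative_at[OF assms(2)] assms(3)[of v]
    by (intro Cn_on_cong[OF assms(1) _ assms(3)[of v]]) (simp add: assms(2))
  then show ?thesis using assms(2) unfolding Cn_on.simps differentiable_def by blast
qed

lemma Cn_on_const: "open S \<Longrightarrow> Cn_on n S (\<lambda>x. c)"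
proof (induction n arbitrary: c)
  case (Suc n)
  show ?case by (rule Cn_on_SucI[where f'="\<lambda>x v. 0"]) (use Suc in \<open>auto intro!: derivative_eq_intros\<close>)
qed simp

lemma Cn_on_add:
  assumes "open S" "Cn_on n S f" "Cn_on n S g"
  shows "Cn_on n S (\<lambda>x. f x + g x)"
  using assms(2,3)
proof (induction n arbitrary: f g)
  case 0
  then show ?case by (auto intro!: continuous_intros)
next
  case (Suc n)
  note d = Suc.prems[THEN Cn_on_Suc_has_derivative]
  show ?case
    by (rule Cn_on_SucI[OF assms(1) has_derivative_add[OF d]]) (use Suc in auto)
qed

lemma Cn_on_scaleR:
  fixes g :: "'a::euclidean_space \<Rightarrow> 'b::real_normed_vector"
  assumes "open S" "Cn_on n S f" "Cn_on n S g"
  shows "Cn_on n S (\<lambda>x. f x *\<^sub>R g x)"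
  using assms(2,3)
proof (induction n arbitrary: f g)
  case 0
  then show ?case by (auto intro!: continuous_intros)
next
  case (Suc n)
  note d = Suc.prems[THEN Cn_on_Suc_has_derivative]
  show ?case
    by (rule Cn_on_SucI[OF assms(1) has_derivative_scaleR[OF d]])
       (use Suc Suc.prems[THEN Cn_on_SucD] in \<open>auto intro!: Cn_on_add[OF assms(1)]\<close>)
qed

lemma Cn_on_bounded_linear:
  assumes "open S" "bounded_linear L" "Cn_on n S f"
  shows "Cn_on n S (\<lambda>x. L (f x))"
  using assms(3)
proof (induction n arbitrary: f)
  case 0
  then show ?case by (auto intro!: linear_continuous_on_compose bounded_linear.continuous_on[OF assms(2)])
next
  case (Suc n)
  note d = Suc.prems[THEN Cn_on_Suc_has_derivative]
  show ?case
    by (rule Cn_on_SucI[OF assms(1) bounded_linear.has_derivative[OF assms(2) d]])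
       (use Suc in auto)
qed

lemma Cn_on_sum:
  assumes "open S" "\<And>i. i \<in> I \<Longrightarrow> Cn_on n S (f i)"
  shows "Cn_on n S (\<lambda>x. \<Sum>i\<in>I. f i x)"
  using assms(2)
proof (induction I rule: infinite_finite_induct)
  case (insert i I)
  then show ?case by (auto intro!: Cn_on_add[OF assms(1)])
qed (auto intro!: Cn_on_const[OF assms(1)])

lemmas Cn_on_mult = Cn_on_scaleR[where 'b=real, unfolded real_scaleR_def]

lemma Cn_on_diff:
  assumes "open S" "Cn_on n S f" "Cn_on n S g"
  shows "Cn_on n S (\<lambda>x. f x - g x)"
  using Cn_on_add[OF assms(1,2) Cn_on_scaleR[OF assms(1) Cn_on_const[OF assms(1), of _ "-1"] assms(3)]]
  by simp

text \<open>Coordinates reduce a family of bilinear maps to its finitely many entries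
  \<open>B i j\<close>. Continuity, derivatives and bounds are established for entries and carried
  to all arguments through this formula.\<close>

lemma bilinear_expand:
  fixes B :: "'a::euclidean_space \<Rightarrow> 'b::euclidean_space \<Rightarrow> 'c::real_vector"
  assumes "bilinear B"
  shows "B u v = (\<Sum>i\<in>Basis. \<Sum>j\<in>Basis. ((u \<bullet> i) * (v \<bullet> j)) *\<^sub>R B i j)"
proof -
  have "B u v = B (\<Sum>i\<in>Basis. (u \<bullet> i) *\<^sub>R i) (\<Sum>j\<in>Basis. (v \<bullet> j) *\<^sub>R j)"
    by (simp add: euclidean_representation)
  also have "\<dots> = (\<Sum>(i,j)\<in>Basis\<times>Basis. B ((u \<bullet> i) *\<^sub>R i) ((v \<bullet> j) *\<^sub>R j))"
    by (rule bilinear_sum[OF assms])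
  also have "\<dots> = (\<Sum>i\<in>Basis. \<Sum>j\<in>Basis. ((u \<bullet> i) * (v \<bullet> j)) *\<^sub>R B i j)"
    by (simp add: sum.cartesian_product bilinear_lmul[OF assms] bilinear_rmul[OF assms]
      mult.commute split_def)
  finally show ?thesis .
qed

lemma bilinear_norm_le_sum:
  fixes B :: "'a::euclidean_space \<Rightarrow> 'b::euclidean_space \<Rightarrow> 'c::real_normed_vector"
  assumes "bilinear B"
  shows "norm (B u v) \<le> (\<Sum>i\<in>Basis. \<Sum>j\<in>Basis. norm (B i j)) * norm u * norm v"
proof -
  have "norm (B u v) \<le> (\<Sum>i\<in>Basis. \<Sum>j\<in>Basis. norm (((u \<bullet> i) * (v \<bullet> j)) *\<^sub>R B i j))"
    by (subst bilinear_expand[OF assms])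
       (intro order_trans[OF norm_sum] sum_mono order_refl norm_sum)
  also have "\<dots> \<le> (\<Sum>i\<in>Basis. \<Sum>j\<in>Basis. (norm u * norm v) * norm (B i j))"
    by (intro sum_mono) (auto simp: abs_mult intro!: mult_right_mono mult_mono Basis_le_norm)
  also have "\<dots> = (\<Sum>i\<in>Basis. \<Sum>j\<in>Basis. norm (B i j)) * norm u * norm v"
    by (simp add: sum_distrib_left sum_distrib_right mult_ac)
  finally show ?thesis .
qed

lemma linear_expand:
  fixes L :: "'a::euclidean_space \<Rightarrow> 'b::real_vector"
  assumes "linear L"
  shows "L v = (\<Sum>i\<in>Basis. (v \<bullet> i) *\<^sub>R L i)"
proof -
  have "L v = L (\<Sum>i\<in>Basis. (v \<bullet> i) *\<^sub>R i)" by (simp add: euclidean_representation)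
  also have "\<dots> = (\<Sum>i\<in>Basis. (v \<bullet> i) *\<^sub>R L i)"
    by (simp only: linear_sum[OF assms] linear_scale[OF assms])
  finally show ?thesis .
qed

lemma bilinear_left_expand:
  fixes B :: "'a::euclidean_space \<Rightarrow> 'b::real_vector \<Rightarrow> 'c::real_vector"
  assumes "bilinear B"
  shows "B u v = (\<Sum>i\<in>Basis. (u \<bullet> i) *\<^sub>R B i v)"
  by (rule linear_expand[of "\<lambda>u. B u v"]) (use assms in \<open>simp add: bilinear_def\<close>)

text \<open>Meant for the derivative of a Christoffel form and for the increments of that
  derivative, of which only bounds on the entries are available.\<close>

lemma trilinear_norm_le:
  fixes T :: "'a::euclidean_space \<Rightarrow> 'a \<Rightarrow> 'a \<Rightarrow> 'b::real_normed_vector"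
  assumes lin: "\<And>u v. linear (\<lambda>h. T h u v)" and bil: "\<And>h. bilinear (T h)"
    and B: "\<And>k i j. \<lbrakk>k \<in> Basis; i \<in> Basis; j \<in> Basis\<rbrakk> \<Longrightarrow> norm (T k i j) \<le> B k i j"
  shows "norm (T h u v) \<le> (\<Sum>k\<in>Basis. \<Sum>i\<in>Basis. \<Sum>j\<in>Basis. B k i j) * norm h * norm u * norm v"
proof -
  have "T h u v = (\<Sum>k\<in>Basis. (h \<bullet> k) *\<^sub>R T k u v)" by (rule linear_expand[OF lin])
  also have "norm \<dots> \<le> (\<Sum>k\<in>Basis. \<bar>h \<bullet> k\<bar> * norm (T k u v))"
    by (rule order_trans[OF norm_sum]) simp
  also have "\<dots> \<le> (\<Sum>k\<in>Basis. norm h * ((\<Sum>i\<in>Basis. \<Sum>j\<in>Basis. B k i j) * norm u * norm v))"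
  proof (intro sum_mono mult_mono Basis_le_norm)
    fix k :: 'a assume k: "k \<in> Basis"
    have "norm (T k u v) \<le> (\<Sum>i\<in>Basis. \<Sum>j\<in>Basis. norm (T k i j)) * norm u * norm v"
      by (rule bilinear_norm_le_sum[OF bil])
    also have "\<dots> \<le> (\<Sum>i\<in>Basis. \<Sum>j\<in>Basis. B k i j) * norm u * norm v"
      by (intro mult_right_mono sum_mono B k) auto
    finally show "norm (T k u v) \<le> (\<Sum>i\<in>Basis. \<Sum>j\<in>Basis. B k i j) * norm u * norm v" .
  qed auto
  also have "\<dots> = (\<Sum>k\<in>Basis. \<Sum>i\<in>Basis. \<Sum>j\<in>Basis. B k i j) * norm h * norm u * norm v"
    by (simp add: sum_distrib_left sum_distrib_right mult_ac)
  finally show ?thesis .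
qed

lemma compact_bound:
  assumes "compact S" "continuous_on S f"
  shows "\<exists>B. \<forall>p\<in>S. norm (f p) \<le> (B::real)"
  using compact_imp_bounded[OF compact_continuous_image[OF assms(2,1)]] unfolding bounded_iff by auto

text \<open>Compactness bounds the derivatives along basis vectors, their sum bounds the operator
  norm, and convexity allows the mean value inequality.\<close>

lemma Cn_on_1_lipschitz:
  fixes f :: "'a::euclidean_space \<Rightarrow> 'b::real_normed_vector"
  assumes f: "Cn_on (Suc 0) U f" and S: "compact S" "convex S" "S \<subseteq> U"
  shows "\<exists>L. \<forall>p\<in>S. \<forall>q\<in>S. norm (f p - f q) \<le> L * norm (p - q)"
proof -
  have "\<exists>B. \<forall>p\<in>S. norm (frechet_derivative f (at p) i) \<le> B" for i
    using f S by (intro compact_bound) (auto intro: continuous_on_subset)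
  then obtain B where B: "\<And>i p. p \<in> S \<Longrightarrow> norm (frechet_derivative f (at p) i) \<le> B i" by metis
  have "norm (f p - f q) \<le> (\<Sum>i\<in>Basis. B i) * norm (p - q)" if pq: "p \<in> S" "q \<in> S" for p q
  proof (rule differentiable_bound[OF S(2)])
    fix x assume x: "x \<in> S"
    have d: "(f has_derivative frechet_derivative f (at x)) (at x)"
      using Cn_on_Suc_has_derivative[OF f] x S(3) by blast
    then show "(f has_derivative frechet_derivative f (at x)) (at x within S)"
      by (rule has_derivative_at_withinI)
    show "onorm (frechet_derivative f (at x)) \<le> (\<Sum>i\<in>Basis. B i)"
    proof (rule onorm_le)
      fix h
      have "norm (frechet_derivative f (at x) h) = norm (\<Sum>i\<in>Basis. (h \<bullet> i) *\<^sub>R frechet_derivative f (at x) i)"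
        by (rule arg_cong[OF linear_expand[OF has_derivative_linear[OF d]]])
      also have "\<dots> \<le> (\<Sum>i\<in>Basis. \<bar>h \<bullet> i\<bar> * norm (frechet_derivative f (at x) i))"
        by (rule order_trans[OF norm_sum]) simp
      also have "\<dots> \<le> (\<Sum>i\<in>Basis. norm h * B i)"
        by (intro sum_mono mult_mono Basis_le_norm B x) auto
      finally show "norm (frechet_derivative f (at x) h) \<le> (\<Sum>i\<in>Basis. B i) * norm h"
        unfolding sum_distrib_left[symmetric] by (simp add: mult.commute)
    qed
  qed (use pq in auto)
  then show ?thesis by blast
qed

section \<open>Positive definite forms: coercivity, representation, implicit differentiation\<close>

lemma bilinear_diff_fun:
  assumes "bilinear B" "bilinear C"
  shows "bilinear (\<lambda>u v. B u v - C u v)"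
  using assms by (simp add: bilinear_def linear_iff algebra_simps)

text \<open>\<open>B\<close> attains a positive minimum on the unit sphere; homogeneity of degree
  two spreads it to all vectors.\<close>

lemma bilinear_pos_def_coercive:
  fixes B :: "'a::euclidean_space \<Rightarrow> 'a \<Rightarrow> real"
  assumes "bilinear B" "\<And>u. u \<noteq> 0 \<Longrightarrow> B u u > 0"
  shows "\<exists>a>0. \<forall>u. B u u \<ge> a * (norm u)\<^sup>2"
proof -
  have "continuous_on (sphere 0 1) (\<lambda>u. B u u)"
    by (rule bilinear_continuous_on_compose[OF continuous_on_id continuous_on_id assms(1)])
  moreover have "(sphere 0 1 :: 'a set) \<noteq> {}" by simp
  ultimately obtain w where w: "w \<in> sphere 0 1" "\<And>u. u \<in> sphere 0 1 \<Longrightarrow> B w w \<le> B u u"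
    using continuous_attains_inf[OF compact_sphere] by blast
  have "B u u \<ge> B w w * (norm u)\<^sup>2" for u
  proof (cases "u = 0")
    case False
    have "B w w \<le> B (u /\<^sub>R norm u) (u /\<^sub>R norm u)"
      using False by (intro w) auto
    also have "\<dots> = B u u / (norm u)\<^sup>2"
      by (simp add: bilinear_lmul[OF assms(1)] bilinear_rmul[OF assms(1)] power2_eq_square divide_inverse)
    finally show ?thesis using False by (simp add: field_simps)
  qed (simp add: bilinear_lzero[OF assms(1)])
  moreover have "B w w > 0" using w(1) by (intro assms) auto
  ultimately show ?thesis by blast
qed

text \<open>A perturbation whose entries sum to less than half the coercivity constant leaves the
  other half, uniformly in \<open>u\<close>. The filter is arbitrary because both punctured and full
  neighbourhoods occur.\<close>

lemma bilinear_family_coercive: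
  fixes B :: "'p::topological_space \<Rightarrow> 'a::euclidean_space \<Rightarrow> 'a \<Rightarrow> real"
  assumes "\<forall>\<^sub>F q in F. bilinear (B q)" "bilinear B0" "\<And>u. u \<noteq> 0 \<Longrightarrow> B0 u u > 0"
    and lim: "\<And>i j. i \<in> Basis \<Longrightarrow> j \<in> Basis \<Longrightarrow> ((\<lambda>q. B q i j) \<longlongrightarrow> B0 i j) F"
  shows "\<exists>a>0. \<forall>\<^sub>F q in F. \<forall>u. B q u u \<ge> a * (norm u)\<^sup>2"
proof -
  obtain a where a: "a > 0" "\<And>u. B0 u u \<ge> a * (norm u)\<^sup>2"
    using bilinear_pos_def_coercive[OF assms(2,3)] by blast
  have "((\<lambda>q. \<Sum>i\<in>Basis. \<Sum>j\<in>Basis. norm (B q i j - B0 i j)) \<longlongrightarrow>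
          (\<Sum>i\<in>Basis. \<Sum>j\<in>Basis. norm (B0 i j - B0 i j))) F"
    by (intro tendsto_intros lim) auto
  then have "\<forall>\<^sub>F q in F. (\<Sum>i\<in>Basis. \<Sum>j\<in>Basis. norm (B q i j - B0 i j)) < a / 2"
    by (rule order_tendstoD(2)) (use a in auto)
  with assms(1) have "\<forall>\<^sub>F q in F. \<forall>u. B q u u \<ge> a/2 * (norm u)\<^sup>2"
  proof eventually_elim
    case (elim q)
    show ?case
    proof
      fix u
      have "norm (B q u u - B0 u u) \<le> (\<Sum>i\<in>Basis. \<Sum>j\<in>Basis. norm (B q i j - B0 i j)) * norm u * norm u"
        by (rule bilinear_norm_le_sum[OF bilinear_diff_fun[OF elim(1) assms(2)]])
      also have "\<dots> \<le> a / 2 * norm u * norm u"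
        using elim(2) by (intro mult_right_mono) auto
      finally show "B q u u \<ge> a/2 * (norm u)\<^sup>2"
        using a(2)[of u] by (simp only: power2_eq_square mult.assoc real_norm_def)
    qed
  qed
  then show ?thesis using a(1) by (intro exI[of _ "a/2"]) auto
qed

text \<open>\<open>r\<close> is tested against itself and one argument is expanded in the basis:
  coercivity then turns control of the covector \<open>B r\<close> into control of
  \<open>r\<close>.\<close>

lemma norm_le_covector:
  fixes B :: "'a::euclidean_space \<Rightarrow> 'a \<Rightarrow> real"
  assumes "bilinear B" "a > 0" "\<And>u. B u u \<ge> a * (norm u)\<^sup>2"
  shows "norm r \<le> (\<Sum>j\<in>Basis. \<bar>B r j\<bar>) / a"
proof (cases "r = 0")
  case False
  have "a * (norm r)\<^sup>2 \<le> B r r" by fact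
  also have "B r r = B r (\<Sum>j\<in>Basis. (r \<bullet> j) *\<^sub>R j)" by (simp add: euclidean_representation)
  also have "\<dots> = (\<Sum>j\<in>Basis. (r \<bullet> j) * B r j)"
    using assms(1) by (auto simp: bilinear_def linear_sum linear_scale)
  also have "\<dots> \<le> (\<Sum>j\<in>Basis. norm r * \<bar>B r j\<bar>)"
  proof (intro sum_mono)
    fix j :: 'a assume j: "j \<in> Basis"
    have "(r \<bullet> j) * B r j \<le> \<bar>r \<bullet> j\<bar> * \<bar>B r j\<bar>" by (simp add: abs_mult[symmetric])
    also have "\<dots> \<le> norm r * \<bar>B r j\<bar>" by (intro mult_right_mono Basis_le_norm j) auto
    finally show "(r \<bullet> j) * B r j \<le> norm r * \<bar>B r j\<bar>" .
  qed
  finally have "norm r * (a * norm r) \<le> norm r * (\<Sum>j\<in>Basis. \<bar>B r j\<bar>)"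
    by (simp add: sum_distrib_left power2_eq_square mult_ac)
  then have "a * norm r \<le> (\<Sum>j\<in>Basis. \<bar>B r j\<bar>)" using False by simp
  then show ?thesis using assms(2) by (simp add: field_simps)
qed (use assms(2) in \<open>auto intro!: sum_nonneg divide_nonneg_pos\<close>)

text \<open>The majorants vanish to first order at \<open>p\<close>, hence so does \<open>r\<close>.
  In the applications they are the components of a covector or a single squared norm.\<close>

lemma has_derivative_zero_of_bound:
  fixes r :: "'p::real_normed_vector \<Rightarrow> 'a::real_normed_vector" and k :: "'i \<Rightarrow> 'p \<Rightarrow> real"
  assumes "finite I" "\<And>i. i \<in> I \<Longrightarrow> (k i has_derivative (\<lambda>h. 0)) (at p)"
    and "\<And>i. i \<in> I \<Longrightarrow> k i p = 0" "r p = 0"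
    and ev: "\<forall>\<^sub>F q in at p. norm (r q) \<le> C * (\<Sum>i\<in>I. \<bar>k i q\<bar>)"
  shows "(r has_derivative (\<lambda>h. 0)) (at p)"
proof -
  have "((\<lambda>q. C * (\<Sum>i\<in>I. \<bar>k i q / norm (q - p)\<bar>)) \<longlongrightarrow> C * (\<Sum>i\<in>I. \<bar>0\<bar>)) (at p)"
  proof (intro tendsto_intros)
    fix i assume "i \<in> I"
    then show "((\<lambda>q. k i q / norm (q - p)) \<longlongrightarrow> 0) (at p)"
      using assms(2,3) unfolding has_derivative_at_within
      by (auto simp: divide_inverse mult.commute)
  qed
  moreover have "\<forall>\<^sub>F q in at p. norm (r q /\<^sub>R norm (q - p)) \<le> C * (\<Sum>i\<in>I. \<bar>k i q / norm (q - p)\<bar>)"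
    using ev
  proof eventually_elim
    case (elim q)
    have "norm (r q /\<^sub>R norm (q - p)) = norm (r q) / norm (q - p)" by (simp add: divide_inverse mult.commute)
    also have "\<dots> \<le> C * (\<Sum>i\<in>I. \<bar>k i q\<bar>) / norm (q - p)" by (intro divide_right_mono elim) auto
    also have "\<dots> = C * (\<Sum>i\<in>I. \<bar>k i q / norm (q - p)\<bar>)"
      by (simp add: sum_divide_distrib[symmetric])
    finally show ?case .
  qed
  ultimately have "((\<lambda>q. r q /\<^sub>R norm (q - p)) \<longlongrightarrow> 0) (at p)"
    using Lim_null_comparison[of "\<lambda>q. r q /\<^sub>R norm (q - p)" "\<lambda>q. C * (\<Sum>i\<in>I. \<bar>k i q / norm (q - p)\<bar>)"] by simp
  then show ?thesis using assms(4) unfolding has_derivative_at_within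
    by (auto intro!: bounded_linear_zero)
qed

text \<open>Riesz representation: the Gram map \<open>G\<close> is injective by positivity and hence
  surjective in finite dimension. It gives meaning to the \<open>THE\<close> in the definitions of
  gradients and Christoffel symbols.\<close>

lemma pos_def_represent:
  fixes B :: "'a::euclidean_space \<Rightarrow> 'a \<Rightarrow> real"
  assumes "bilinear B" "\<And>u. u \<noteq> 0 \<Longrightarrow> B u u > 0" "linear l"
  shows "\<exists>!w. \<forall>z. B w z = l z"
proof -
  define G where "G w = (\<Sum>j\<in>Basis. B w j *\<^sub>R j)" for w
  have linG: "linear G"
    unfolding G_def using assms(1)
    by (intro linear_compose_sum ballI) (auto simp: bilinear_def linear_iff algebra_simps)
  have G_inner: "G w \<bullet> z = B w z" for w z
  proof -
    have "B w z = B w (\<Sum>j\<in>Basis. (z \<bullet> j) *\<^sub>R j)" by (simp add: euclidean_representation)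
    also have "\<dots> = (\<Sum>j\<in>Basis. (z \<bullet> j) * B w j)"
      using assms(1) by (auto simp: bilinear_def linear_sum linear_scale)
    also have "\<dots> = G w \<bullet> z" unfolding G_def by (simp add: inner_sum_left inner_commute[of z] mult.commute)
    finally show ?thesis by simp
  qed
  have "inj G"
    unfolding linear_injective_0[OF linG]
    by (metis G_inner assms(2) inner_zero_left less_irrefl)
  then have "surj G" using linG linear_injective_imp_surjective by blast
  then obtain w where w: "G w = (\<Sum>j\<in>Basis. l j *\<^sub>R j)" by (metis surjD)
  have "B w z = l z" for z
  proof -
    have "B w z = (\<Sum>j\<in>Basis. l j *\<^sub>R j) \<bullet> z" using G_inner[of w z] w by simp
    also have "\<dots> = (\<Sum>j\<in>Basis. l ((z \<bullet> j) *\<^sub>R j))"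
      by (simp add: inner_sum_left inner_commute[of z] linear_scale[OF assms(3)] mult.commute)
    also have "\<dots> = l z" by (simp add: linear_sum[OF assms(3), symmetric] euclidean_representation)
    finally show ?thesis .
  qed
  moreover have "w' = w" if "\<forall>z. B w' z = l z" for w'
  proof -
    have "G w' \<bullet> z = G w \<bullet> z" for z using that calculation by (simp add: G_inner)
    then have "G w' = G w" using vector_eq_rdot by blast
    then show ?thesis using \<open>inj G\<close> by (simp add: inj_eq)
  qed
  ultimately show ?thesis by blast
qed

text \<open>Vector identities are proved below by testing both sides with the inner product, because
  Christoffel symbols and Hessians are known only through their inner products.\<close>

lemma pos_def_cancel:
  fixes B :: "'a::euclidean_space \<Rightarrow> 'a \<Rightarrow> real"
  assumes "bilinear B" "\<And>u. u \<noteq> 0 \<Longrightarrow> B u u > 0" "\<And>z. B w z = B w' z"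
  shows "w = w'"
proof (rule ccontr)
  assume "w \<noteq> w'"
  then have "B (w - w') (w - w') > 0" by (intro assms(2)) auto
  then show False using assms(3) by (simp add: bilinear_lsub[OF assms(1)])
qed

text \<open>The linearity equations in \<open>z\<close> are differentiated in \<open>q\<close>;
  uniqueness of derivatives transfers them to \<open>l\<close>.\<close>

lemma linear_derivative_of_linear_family:
  fixes L :: "'p::real_normed_vector \<Rightarrow> 'a::real_vector \<Rightarrow> 'b::real_normed_vector"
  assumes lin: "\<forall>\<^sub>F q in at p. linear (L q)" "linear (L p)"
    and dL: "\<And>z. ((\<lambda>q. L q z) has_derivative l z) (at p)"
  shows "linear (\<lambda>z. l z h)"
proof (rule linearI)
  fix z z'
  have "((\<lambda>q. L q (z + z')) has_derivative (\<lambda>h. l z h + l z' h)) (at p)"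
  proof (rule has_derivative_transform_eventually[OF has_derivative_add[OF dL[of z] dL[of z']]])
    show "\<forall>\<^sub>F q in at p. L q z + L q z' = L q (z + z')"
      using lin(1) by eventually_elim (simp add: linear_add)
  qed (auto simp: linear_add[OF lin(2)])
  from fun_cong[OF has_derivative_unique[OF dL this]] show "l (z + z') h = l z h + l z' h" .
next
  fix c z
  have "((\<lambda>q. L q (c *\<^sub>R z)) has_derivative (\<lambda>h. c *\<^sub>R l z h)) (at p)"
  proof (rule has_derivative_transform_eventually[OF has_derivative_scaleR_right[OF dL[of z], of c]])
    show "\<forall>\<^sub>F q in at p. c *\<^sub>R L q z = L q (c *\<^sub>R z)"
      using lin(1) by eventually_elim (simp add: linear_scale)
  qed (auto simp: linear_scale[OF lin(2)])
  from fun_cong[OF has_derivative_unique[OF dL this]] show "l (c *\<^sub>R z) h = c *\<^sub>R l z h" .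
qed

text \<open>Implicit differentiation. The product rule predicts the value of
  \<open>B p (W h) z\<close>, and representation defines \<open>W\<close> by it. Differentiability
  of \<open>w\<close> is not presupposed: the remainder \<open>r\<close> is estimated through the
  covector \<open>B q (r q)\<close>, which involves only functions known to be
  differentiable.\<close>

lemma pos_def_has_derivative:
  fixes B :: "'p::real_normed_vector \<Rightarrow> 'a::euclidean_space \<Rightarrow> 'a \<Rightarrow> real"
  assumes bil: "\<forall>\<^sub>F q in nhds p. bilinear (B q)" and pos: "\<And>u. u \<noteq> 0 \<Longrightarrow> B p u u > 0"
    and dB: "\<And>i j. ((\<lambda>q. B q i j) has_derivative B' i j) (at p)"
    and dl: "\<And>z. ((\<lambda>q. B q (w q) z) has_derivative l z) (at p)"
  shows "\<exists>W. (w has_derivative W) (at p) \<and> (\<forall>h z. B p (W h) z = l z h - B' (w p) z h)"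
proof -
  have bilp: "bilinear (B p)" using bil by (rule eventually_nhds_x_imp_x)
  have bila: "\<forall>\<^sub>F q in at p. bilinear (B q)" using bil by (simp add: eventually_nhds_conv_at)
  have Blin: "linear (\<lambda>z. B' u z h)" for u h
    by (rule linear_derivative_of_linear_family[OF _ _ dB])
       (use bila bilp in \<open>auto simp: bilinear_def elim: eventually_mono\<close>)
  have llin: "linear (\<lambda>z. l z h)" for h
    by (rule linear_derivative_of_linear_family[OF _ _ dl])
       (use bila bilp in \<open>auto simp: bilinear_def elim: eventually_mono\<close>)
  have "\<exists>!w'. \<forall>z. B p w' z = l z h - B' (w p) z h" for h
    by (rule pos_def_represent[OF bilp pos linear_compose_sub[OF llin Blin]])
  then obtain W where W: "\<And>h z. B p (W h) z = l z h - B' (w p) z h" by metis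
  have linW: "linear W"
  proof (rule linearI)
    note lin = has_derivative_linear[OF dl] has_derivative_linear[OF dB]
    show "W (h + h') = W h + W h'" for h h'
      by (rule pos_def_cancel[OF bilp pos]) (auto simp: W bilinear_ladd[OF bilp] lin linear_add)
    show "W (c *\<^sub>R h) = c *\<^sub>R W h" for c h
      by (rule pos_def_cancel[OF bilp pos])
         (auto simp: W bilinear_lmul[OF bilp] lin linear_scale algebra_simps)
  qed
  obtain a where a: "a > 0" and ca: "\<forall>\<^sub>F q in at p. \<forall>u. B q u u \<ge> a * (norm u)\<^sup>2"
    using bilinear_family_coercive[OF bila bilp pos] has_derivative_continuous[OF dB]
    unfolding isCont_def by blast
  have "\<exists>C. \<forall>h. norm (W h) \<le> norm h * C"
  proof -
    obtain a0 where a0: "a0 > 0" "\<And>u. B p u u \<ge> a0 * (norm u)\<^sup>2"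
      using bilinear_pos_def_coercive[OF bilp pos] by blast
    have "bounded_linear (\<lambda>h. l j h - B' (w p) j h)" for j
      by (intro bounded_linear_sub has_derivative_bounded_linear[OF dl] has_derivative_bounded_linear[OF dB])
    then have "\<exists>K. \<forall>h. norm (l j h - B' (w p) j h) \<le> norm h * K" for j
      using bounded_linear.bounded by blast
    then obtain K where K: "\<And>j h. norm (l j h - B' (w p) j h) \<le> norm h * K j" by metis
    have "norm (W h) \<le> norm h * ((\<Sum>j\<in>Basis. K j) / a0)" for h
    proof -
      have "norm (W h) \<le> (\<Sum>j\<in>Basis. \<bar>B p (W h) j\<bar>) / a0" by (rule norm_le_covector[OF bilp a0])
      also have "\<dots> \<le> (\<Sum>j\<in>Basis. norm h * K j) / a0"
        using a0 K by (intro divide_right_mono sum_mono) (auto simp: W)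
      finally show ?thesis by (simp add: sum_distrib_left)
    qed
    then show ?thesis by blast
  qed
  then obtain C where C: "\<And>h. norm (W h) \<le> norm h * C" by blast
  have blW: "bounded_linear W"
    using linW C by (auto simp: linear_iff intro!: bounded_linear_intro)
  define r where "r q = w q - w p - W (q - p)" for q
  \<comment> \<open>\<open>k z q\<close> equals \<open>B q (r q) z\<close>; the last term is
    expanded in the basis so that it can be differentiated through \<open>W\<close> and the entries
    of \<open>B\<close> separately.\<close>
  define k where "k z q = B q (w q) z - B q (w p) z - (\<Sum>i\<in>Basis. (W (q - p) \<bullet> i) * B q i z)" for z q
  have kr: "\<forall>\<^sub>F q in at p. \<forall>z. B q (r q) z = k z q"
    using bila
  proof eventually_elim
    case (elim q)
    show ?case
      by (auto simp: r_def k_def bilinear_lsub[OF elim] bilinear_left_expand[OF elim, of "W (q - p)"])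
  qed
  have dk: "(k z has_derivative (\<lambda>h. 0)) (at p)" for z
  proof -
    have "((\<lambda>q. W (q - p)) has_derivative W) (at p)"
      by (rule bounded_linear.has_derivative[OF blW, of "\<lambda>q. q - p" "\<lambda>h. h" "at p"])
         (auto intro!: derivative_eq_intros)
    note dW = has_derivative_inner_left[OF this]
    have "(k z has_derivative (\<lambda>h. l z h - B' (w p) z h -
        (\<Sum>i\<in>Basis. (W (p - p) \<bullet> i) * B' i z h + (W h \<bullet> i) * B p i z))) (at p)"
      unfolding k_def by (intro has_derivative_diff has_derivative_sum has_derivative_mult dl dB dW)
    also have "(\<lambda>h. l z h - B' (w p) z h -
        (\<Sum>i\<in>Basis. (W (p - p) \<bullet> i) * B' i z h + (W h \<bullet> i) * B p i z)) = (\<lambda>h. 0)"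
      using bilinear_left_expand[OF bilp, of "W _" z] W by (auto simp: linear_0[OF linW])
    finally show ?thesis .
  qed
  have k0: "k z p = 0" for z by (simp add: k_def linear_0[OF linW])
  have "(r has_derivative (\<lambda>h. 0)) (at p)"
  proof (rule has_derivative_zero_of_bound[of Basis k])
    show "\<forall>\<^sub>F q in at p. norm (r q) \<le> (1 / a) * (\<Sum>j\<in>Basis. \<bar>k j q\<bar>)"
      using kr ca bila
    proof eventually_elim
      case (elim q)
      then show ?case using norm_le_covector[of "B q" a "r q"] a by simp
    qed
  qed (auto simp: dk k0 r_def linear_0[OF linW])
  from has_derivative_add[OF has_derivative_add[OF this has_derivative_const[of "w p"]]
      bounded_linear.has_derivative[OF blW has_derivative_diff[OF has_derivative_ident has_derivative_const[of p]]]]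
  have "(w has_derivative W) (at p)" by (simp add: r_def)
  then show ?thesis using W by blast
qed

text \<open>The same remainder argument at order zero; the base case for the regularity of
  implicitly defined fields.\<close>

lemma pos_def_isCont:
  fixes B :: "'p::real_normed_vector \<Rightarrow> 'a::euclidean_space \<Rightarrow> 'a \<Rightarrow> real"
  assumes bil: "\<forall>\<^sub>F q in nhds p. bilinear (B q)" and pos: "\<And>u. u \<noteq> 0 \<Longrightarrow> B p u u > 0"
    and cB: "\<And>i j. isCont (\<lambda>q. B q i j) p"
    and cl: "\<And>z. isCont (\<lambda>q. B q (w q) z) p"
  shows "isCont w p"
proof -
  have bilp: "bilinear (B p)" using bil by (rule eventually_nhds_x_imp_x)
  have bila: "\<forall>\<^sub>F q in at p. bilinear (B q)" using bil by (simp add: eventually_nhds_conv_at)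
  obtain a where a: "a > 0" and ca: "\<forall>\<^sub>F q in at p. \<forall>u. B q u u \<ge> a * (norm u)\<^sup>2"
    using bilinear_family_coercive[OF bila bilp pos] cB
    unfolding isCont_def by blast
  have "\<forall>\<^sub>F q in at p. norm (w q - w p) \<le> (\<Sum>j\<in>Basis. \<bar>B q (w q) j - B q (w p) j\<bar>) / a"
    using ca bila
  proof eventually_elim
    case (elim q)
    then show ?case using norm_le_covector[of "B q" a "w q - w p"] a by (simp add: bilinear_lsub)
  qed
  moreover have "((\<lambda>q. (\<Sum>j\<in>Basis. \<bar>B q (w q) j - B q (w p) j\<bar>) / a) \<longlongrightarrow>
      (\<Sum>j\<in>Basis. \<bar>B p (w p) j - B p (w p) j\<bar>) / a) (at p)"
    using cB cl a unfolding isCont_def by (intro tendsto_intros) auto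
  ultimately have "((\<lambda>q. w q - w p) \<longlongrightarrow> 0) (at p)"
    using Lim_null_comparison[of _ "\<lambda>q. (\<Sum>j\<in>Basis. \<bar>B q (w q) j - B q (w p) j\<bar>) / a"] by simp
  then show ?thesis by (simp add: isCont_def LIM_zero_cancel)
qed

text \<open>Bootstrapping: the derivative \<open>W\<close> of \<open>w\<close> is again defined
  implicitly by the same \<open>B\<close>, with a right-hand side one class lower, so the induction
  runs over all \<open>w\<close>. For the Christoffel form this takes the place of inverting the
  metric matrix.\<close>

lemma pos_def_Cn_on:
  fixes B :: "'p::euclidean_space \<Rightarrow> 'a::euclidean_space \<Rightarrow> 'a \<Rightarrow> real"
  assumes S: "open S" and bil: "\<And>q. q \<in> S \<Longrightarrow> bilinear (B q)"
    and pos: "\<And>q u. q \<in> S \<Longrightarrow> u \<noteq> 0 \<Longrightarrow> B q u u > 0"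
    and "\<And>i j. Cn_on n S (\<lambda>q. B q i j)" "\<And>z. Cn_on n S (\<lambda>q. B q (w q) z)"
  shows "Cn_on n S w"
  using assms(4,5)
proof (induction n arbitrary: w)
  case 0
  have "isCont w p" if p: "p \<in> S" for p
  proof (rule pos_def_isCont)
    show "\<forall>\<^sub>F q in nhds p. bilinear (B q)" using S p bil eventually_nhds by blast
  qed (use 0 p S pos in \<open>auto simp: continuous_on_eq_continuous_at\<close>)
  then show ?case by (simp add: continuous_at_imp_continuous_on)
next
  case (Suc n)
  \<comment> \<open>\<open>w\<close> itself occurs in the equation for its derivative, so its lower
    regularity has to be settled first.\<close>
  have wn: "Cn_on n S w"
    by (rule Suc.IH[OF Suc.prems[THEN Cn_on_SucD]])
  have "\<exists>W. (w has_derivative W) (at p) \<and> (\<forall>h z. B p (W h) z =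
      frechet_derivative (\<lambda>q. B q (w q) z) (at p) h - frechet_derivative (\<lambda>q. B q (w p) z) (at p) h)"
    if p: "p \<in> S" for p
  proof (rule pos_def_has_derivative)
    show "\<forall>\<^sub>F q in nhds p. bilinear (B q)" using S p bil eventually_nhds by blast
    show "\<And>i j. ((\<lambda>q. B q i j) has_derivative frechet_derivative (\<lambda>q. B q i j) (at p)) (at p)"
      using Suc.prems(1) p by (rule Cn_on_Suc_has_derivative)
    show "\<And>z. ((\<lambda>q. B q (w q) z) has_derivative frechet_derivative (\<lambda>q. B q (w q) z) (at p)) (at p)"
      using Suc.prems(2) p by (rule Cn_on_Suc_has_derivative)
  qed (use p pos in auto)
  then obtain W where W: "\<And>p. p \<in> S \<Longrightarrow> (w has_derivative W p) (at p)"
     "\<And>p h z. p \<in> S \<Longrightarrow> B p (W p h) z =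
      frechet_derivative (\<lambda>q. B q (w q) z) (at p) h - frechet_derivative (\<lambda>q. B q (w p) z) (at p) h"
    by metis
  \<comment> \<open>For fixed \<open>u\<close> the derivative is expanded in the coordinates of
    \<open>u\<close>, because \<open>u\<close> is replaced below by \<open>w q\<close>, which
    varies.\<close>
  have e: "frechet_derivative (\<lambda>q. B q u z) (at p) h =
     (\<Sum>i\<in>Basis. (u \<bullet> i) * frechet_derivative (\<lambda>q. B q i z) (at p) h)" if p: "p \<in> S" for u z p h
  proof -
    have "((\<lambda>q. \<Sum>i\<in>Basis. (u \<bullet> i) * B q i z) has_derivative
      (\<lambda>h. \<Sum>i\<in>Basis. (u \<bullet> i) * frechet_derivative (\<lambda>q. B q i z) (at p) h)) (at p)"
      by (intro has_derivative_sum has_derivative_mult_right Cn_on_Suc_has_derivative[OF Suc.prems(1) p])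
    then have "((\<lambda>q. B q u z) has_derivative
      (\<lambda>h. \<Sum>i\<in>Basis. (u \<bullet> i) * frechet_derivative (\<lambda>q. B q i z) (at p) h)) (at p)"
      by (rule has_derivative_transform_within_open[OF _ S p]) (simp add: bilinear_left_expand[OF bil, of _ u])
    from fun_cong[OF frechet_derivative_at[OF this], of h] show ?thesis by (rule sym)
  qed
  show ?case
  proof (rule Cn_on_SucI[OF S W(1)])
    fix v
    show "Cn_on n S (\<lambda>x. W x v)"
    proof (rule Suc.IH)
      show "Cn_on n S (\<lambda>q. B q i j)" for i j by (rule Cn_on_SucD[OF Suc.prems(1)])
      fix z
      have "Cn_on n S (\<lambda>q. frechet_derivative (\<lambda>q. B q (w q) z) (at q) v -
          (\<Sum>i\<in>Basis. (w q \<bullet> i) * frechet_derivative (\<lambda>q. B q i z) (at q) v))"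
        using Suc.prems unfolding Cn_on.simps
        by (intro Cn_on_diff Cn_on_sum Cn_on_mult S
          Cn_on_bounded_linear[OF S bounded_linear_inner_left wn]) blast+
      then show "Cn_on n S (\<lambda>q. B q (W q v) z)"
        by (rule Cn_on_cong[OF S, rotated]) (simp add: W e)
    qed
  qed
qed

section \<open>Symmetry of the second derivative\<close>

text \<open>With \<open>\<psi>\<close> as below, \<open>\<psi> h - \<psi> 0\<close> is the second
  difference minus its main term, and the mean value inequality in direction \<open>u\<close> is
  applied to it. The derivative of \<open>f' y u\<close> enters at the one point \<open>x\<close>
  only.\<close>

lemma second_difference_bound:
  fixes f :: "'a::real_normed_vector \<Rightarrow> 'b::real_normed_vector"
  assumes ev: "\<forall>\<^sub>F y in nhds x. (f has_derivative f' y) (at y)"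
    and du: "((\<lambda>y. f' y u) has_derivative fu) (at x)" and "e > 0"
  shows "\<exists>d>0. \<forall>h. 0 < h \<and> h < d \<longrightarrow>
    norm (f (x + h *\<^sub>R u + h *\<^sub>R v) - f (x + h *\<^sub>R u) - f (x + h *\<^sub>R v) + f x - h\<^sup>2 *\<^sub>R fu v)
      \<le> e * (2 * norm u + norm v) * h\<^sup>2"
proof -
  obtain d1 where d1: "d1 > 0" "\<And>y. dist y x < d1 \<Longrightarrow> (f has_derivative f' y) (at y)"
    using ev unfolding eventually_nhds_metric by blast
  obtain d2 where d2: "d2 > 0" "\<And>y. norm (y - x) < d2 \<Longrightarrow>
      norm (f' y u - f' x u - fu (y - x)) \<le> e * norm (y - x)"
    using du \<open>e > 0\<close> unfolding has_derivative_at_alt by blast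
  define N where "N = norm u + norm v + 1"
  have N: "N > 0" unfolding N_def by (simp add: add_nonneg_pos)
  have lin: "linear fu" by (rule has_derivative_linear[OF du])
  show ?thesis
  proof (intro exI conjI allI impI)
    \<comment> \<open>With this choice all points \<open>x + t u + c v\<close> with
      \<open>0 \<le> t \<le> h\<close> and \<open>c\<close> equal to \<open>0\<close> or
      \<open>h\<close> lie in both balls; the summand \<open>1\<close> in \<open>N\<close> makes it
      positive.\<close>
    show "min d1 d2 / N > 0" using d1 d2 N by simp
    fix h :: real assume h: "0 < h \<and> h < min d1 d2 / N"
    have hN: "h * N < d1" "h * N < d2" using h N by (auto simp: field_simps)
    define \<psi> where "\<psi> t = f (x + t *\<^sub>R u + h *\<^sub>R v) - f (x + t *\<^sub>R u) - (t * h) *\<^sub>R fu v" for t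
    have near: "norm (t *\<^sub>R u + c *\<^sub>R v) \<le> h * norm u + c * norm v"
        "norm (t *\<^sub>R u + c *\<^sub>R v) < d1" "norm (t *\<^sub>R u + c *\<^sub>R v) < d2"
      if "t \<in> {0..h}" "c \<in> {0, h}" for t c
    proof -
      have "norm (t *\<^sub>R u + c *\<^sub>R v) \<le> norm (t *\<^sub>R u) + norm (c *\<^sub>R v)" by (rule norm_triangle_ineq)
      also have "\<dots> \<le> h * norm u + c * norm v" using that h by (intro add_mono) (auto intro: mult_right_mono)
      finally show *: "norm (t *\<^sub>R u + c *\<^sub>R v) \<le> h * norm u + c * norm v" .
      also have "\<dots> \<le> h * norm u + h * norm v" using that h by (intro add_left_mono mult_right_mono) auto
      also have "\<dots> \<le> h * N" using h unfolding N_def by (simp add: algebra_simps)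
      finally show "norm (t *\<^sub>R u + c *\<^sub>R v) < d1" "norm (t *\<^sub>R u + c *\<^sub>R v) < d2" using hN by auto
    qed
    have d\<psi>: "(\<psi> has_derivative (\<lambda>s. s *\<^sub>R (f' (x + t *\<^sub>R u + h *\<^sub>R v) u - f' (x + t *\<^sub>R u + 0 *\<^sub>R v) u - h *\<^sub>R fu v)))
        (at t within {0..h})" if t: "t \<in> {0..h}" for t
    proof -
      have a: "(f has_derivative f' (x + t *\<^sub>R u + c *\<^sub>R v)) (at (x + t *\<^sub>R u + c *\<^sub>R v))" if "c \<in> {0,h}" for c
        using near(2)[OF t that] by (intro d1) (auto simp: dist_norm add.assoc)
      have b: "((\<lambda>t. f (x + t *\<^sub>R u + c *\<^sub>R v)) has_derivative (\<lambda>s. f' (x + t *\<^sub>R u + c *\<^sub>R v) (s *\<^sub>R u))) (at t within {0..h})"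
        if "c \<in> {0,h}" for c
        by (rule has_derivative_compose[where f="\<lambda>t. x + t *\<^sub>R u + c *\<^sub>R v", OF _ a[OF that]])
           (auto intro!: derivative_eq_intros)
      have sc: "f' (x + t *\<^sub>R u + c *\<^sub>R v) (s *\<^sub>R u) = s *\<^sub>R f' (x + t *\<^sub>R u + c *\<^sub>R v) u" if "c \<in> {0,h}" for c s
        using has_derivative_linear[OF a[OF that]] by (simp add: linear_scale)
      have "(\<psi> has_derivative
         (\<lambda>s. f' (x + t *\<^sub>R u + h *\<^sub>R v) (s *\<^sub>R u) - f' (x + t *\<^sub>R u) (s *\<^sub>R u) - (s * h) *\<^sub>R fu v)) (at t within {0..h})"
        unfolding \<psi>_def using b[of h] b[of 0, simplified]
        by (intro has_derivative_diff) (auto intro!: derivative_eq_intros)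
      then show ?thesis
        by (rule has_derivative_eq_rhs) (simp add: sc[of 0, simplified] sc[of h] scaleR_diff_right)
    qed
    have "norm (\<psi> h - \<psi> 0) \<le> (e * (2 * norm u + norm v) * h) * norm (h - 0)"
    proof (rule differentiable_bound[OF _ d\<psi>])
      fix t assume t: "t \<in> {0..h}"
      define y where "y c = x + t *\<^sub>R u + c *\<^sub>R v" for c
      have y: "norm (f' (y c) u - f' x u - fu (t *\<^sub>R u + c *\<^sub>R v)) \<le> e * (h * norm u + c * norm v)" if c: "c \<in> {0,h}" for c
      proof -
        have "norm (f' (y c) u - f' x u - fu (y c - x)) \<le> e * norm (y c - x)"
          using near(3)[OF t c] by (intro d2) (auto simp: y_def add.assoc)
        also have "y c - x = t *\<^sub>R u + c *\<^sub>R v" by (simp add: y_def)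
        also have "e * norm (t *\<^sub>R u + c *\<^sub>R v) \<le> e * (h * norm u + c * norm v)"
          using near(1)[OF t c] \<open>e > 0\<close> by simp
        finally show ?thesis .
      qed
      have "norm (f' (y h) u - f' (y 0) u - h *\<^sub>R fu v)
          = norm ((f' (y h) u - f' x u - fu (t *\<^sub>R u + h *\<^sub>R v)) - (f' (y 0) u - f' x u - fu (t *\<^sub>R u + 0 *\<^sub>R v)))"
        by (simp add: linear_add[OF lin] linear_scale[OF lin] algebra_simps)
      also have "\<dots> \<le> e * (h * norm u + h * norm v) + e * (h * norm u + 0 * norm v)"
        by (intro order_trans[OF norm_triangle_ineq4 add_mono] y) auto
      also have "\<dots> = e * (2 * norm u + norm v) * h" by (simp add: algebra_simps)
      finally show "onorm (\<lambda>s. s *\<^sub>R (f' (x + t *\<^sub>R u + h *\<^sub>R v) u - f' (x + t *\<^sub>R u + 0 *\<^sub>R v) u - h *\<^sub>R fu v)) \<le> e * (2 * norm u + norm v) * h"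
        unfolding y_def by (intro onorm_le) (auto simp: mult.commute[of _ "\<bar>_\<bar>"] intro!: mult_left_mono)
    qed (use h in auto)
    then show "norm (f (x + h *\<^sub>R u + h *\<^sub>R v) - f (x + h *\<^sub>R u) - f (x + h *\<^sub>R v) + f x - h\<^sup>2 *\<^sub>R fu v)
      \<le> e * (2 * norm u + norm v) * h\<^sup>2"
      using h by (simp add: \<psi>_def power2_eq_square algebra_simps)
  qed
qed

text \<open>The second difference is symmetric in \<open>u\<close> and \<open>v\<close>, and up to
  \<open>o(h^2)\<close> it equals both \<open>h^2 fu v\<close> and \<open>h^2 fv u\<close>.\<close>

lemma second_derivative_symmetric:
  fixes f :: "'a::real_normed_vector \<Rightarrow> 'b::real_normed_vector"
  assumes ev: "\<forall>\<^sub>F y in nhds x. (f has_derivative f' y) (at y)"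
    and du: "((\<lambda>y. f' y u) has_derivative fu) (at x)"
    and dv: "((\<lambda>y. f' y v) has_derivative fv) (at x)"
  shows "fu v = fv u"
proof -
  define K where "K = 3 * norm u + 3 * norm v"
  have "norm (fu v - fv u) \<le> e * K" if "e > 0" for e
  proof -
    obtain d1 d2 where d: "d1 > 0" "d2 > 0" and
      b1: "\<And>h. 0 < h \<Longrightarrow> h < d1 \<Longrightarrow> norm (f (x + h *\<^sub>R u + h *\<^sub>R v) - f (x + h *\<^sub>R u) - f (x + h *\<^sub>R v) + f x - h\<^sup>2 *\<^sub>R fu v)
      \<le> e * (2 * norm u + norm v) * h\<^sup>2" and
      b2: "\<And>h. 0 < h \<Longrightarrow> h < d2 \<Longrightarrow> norm (f (x + h *\<^sub>R v + h *\<^sub>R u) - f (x + h *\<^sub>R v) - f (x + h *\<^sub>R u) + f x - h\<^sup>2 *\<^sub>R fv u)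
      \<le> e * (2 * norm v + norm u) * h\<^sup>2"
      using second_difference_bound[OF ev du \<open>e > 0\<close>, of v] second_difference_bound[OF ev dv \<open>e > 0\<close>, of u] by blast
    define h where "h = min d1 d2 / 2"
    have h: "0 < h" "h < d1" "h < d2" using d by (auto simp: h_def)
    define \<Delta> where "\<Delta> = f (x + h *\<^sub>R u + h *\<^sub>R v) - f (x + h *\<^sub>R u) - f (x + h *\<^sub>R v) + f x"
    have e2: "f (x + h *\<^sub>R v + h *\<^sub>R u) - f (x + h *\<^sub>R v) - f (x + h *\<^sub>R u) + f x = \<Delta>"
      by (simp add: \<Delta>_def algebra_simps)
    have "h\<^sup>2 * norm (fu v - fv u) = norm ((\<Delta> - h\<^sup>2 *\<^sub>R fv u) - (\<Delta> - h\<^sup>2 *\<^sub>R fu v))"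
      by (simp add: scaleR_diff_right[symmetric])
    also have "\<dots> \<le> e * (2 * norm v + norm u) * h\<^sup>2 + e * (2 * norm u + norm v) * h\<^sup>2"
      using b1[OF h(1,2)] b2[OF h(1,3)] unfolding e2 \<Delta>_def[symmetric]
      by (intro order_trans[OF norm_triangle_ineq4 add_mono])
    also have "\<dots> = h\<^sup>2 * (e * K)" by (simp add: K_def algebra_simps)
    finally show ?thesis using h by simp
  qed
  then have "norm (fu v - fv u) \<le> e" if "e > 0" for e
  proof (cases "K > 0")
    case True
    then show ?thesis using \<open>\<And>e. e > 0 \<Longrightarrow> norm (fu v - fv u) \<le> e * K\<close>[of "e / K"] that by simp
  next
    case False
    then have "K = 0" unfolding K_def using norm_ge_zero[of u] norm_ge_zero[of v] by linarith
    then show ?thesis using \<open>\<And>e. e > 0 \<Longrightarrow> norm (fu v - fv u) \<le> e * K\<close>[of 1] that by simp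
  qed
  then have "norm (fu v - fv u) \<le> 0" using field_le_epsilon[of "norm (fu v - fv u)" 0] by simp
  then show ?thesis by simp
qed

section \<open>Ordinary differential equations\<close>

text \<open>Picard iteration is a contraction when \<open>K * (b - a) < 1\<close>.\<close>

lemma linear_ode_exists_short:
  fixes A :: "real \<Rightarrow> 'a \<Rightarrow> 'a::euclidean_space"
  assumes ab: "a \<le> b" and lin: "\<And>t. t \<in> {a..b} \<Longrightarrow> linear (A t)"
    and cont: "\<And>v. continuous_on {a..b} (\<lambda>t. A t v)"
    and K: "\<And>t v. t \<in> {a..b} \<Longrightarrow> norm (A t v) \<le> K * norm v" "0 \<le> K" "K * (b - a) < 1"
  shows "\<exists>y. y a = y0 \<and> (\<forall>t\<in>{a..b}. (y has_vector_derivative A t (y t)) (at t within {a..b}))"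
proof -
  have contA: "continuous_on {a..b} (\<lambda>t. A t (y t))" if "continuous_on {a..b} y" for y
  proof -
    have "continuous_on {a..b} (\<lambda>t. \<Sum>i\<in>Basis. (y t \<bullet> i) *\<^sub>R A t i)"
      by (intro continuous_intros that cont)
    then show ?thesis
    proof (rule continuous_on_eq)
      fix t assume "t \<in> {a..b}"
      then have "linear (A t)" by (rule lin)
      then show "(\<Sum>i\<in>Basis. (y t \<bullet> i) *\<^sub>R A t i) = A t (y t)" by (rule linear_expand[symmetric])
    qed
  qed
  \<comment> \<open>Clamping time to \<open>{a..b}\<close> lets the iteration act on bounded
    continuous functions on the whole line, a complete space to which the Banach fixed point theorem
    applies.\<close>
  define cl where "cl t = max a (min b t)" for t
  have cl: "cl t \<in> {a..b}" for t using ab by (auto simp: cl_def)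
  have cl_id: "cl t = t" if "t \<in> {a..b}" for t using that by (auto simp: cl_def)
  define I where "I y t = y0 + integral {a..t} (\<lambda>s. A s (y s))" for y t
  define T where "T y = Bcontfun (\<lambda>t. I (apply_bcontfun y) (cl t))" for y :: "real \<Rightarrow>\<^sub>C 'a"
  have contI: "continuous_on {a..b} (I y)" if "continuous_on {a..b} y" for y
    unfolding I_def using contA[OF that]
    by (intro continuous_intros indefinite_integral_continuous_1 integrable_continuous_interval)
  have mem: "(\<lambda>t. I (apply_bcontfun y) (cl t)) \<in> bcontfun" for y :: "real \<Rightarrow>\<^sub>C 'a"
    unfolding bcontfun_def
  proof (intro CollectI conjI)
    have c: "continuous_on {a..b} (I (apply_bcontfun y))" by (intro contI) auto
    show "continuous_on UNIV (\<lambda>t. I (apply_bcontfun y) (cl t))"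
      by (rule continuous_on_compose2[OF c]) (use cl in \<open>auto simp: cl_def intro!: continuous_intros\<close>)
    have "bounded (I (apply_bcontfun y) ` {a..b})"
      by (intro compact_imp_bounded compact_continuous_image c) auto
    then show "bounded (range (\<lambda>t. I (apply_bcontfun y) (cl t)))"
      by (rule bounded_subset) (use cl in auto)
  qed
  have T: "apply_bcontfun (T y) t = I (apply_bcontfun y) (cl t)" for y t
    unfolding T_def using Bcontfun_inverse[OF mem] by simp
  have "\<exists>!y. T y = y"
  proof (rule banach_fix_type[OF _ K(3)])
    show "0 \<le> K * (b - a)" using K ab by simp
    show "\<forall>y z. dist (T y) (T z) \<le> K * (b - a) * dist y z"
    proof (intro allI dist_bound)
      fix y z :: "real \<Rightarrow>\<^sub>C 'a" and t
      have int: "(\<lambda>s. A s (apply_bcontfun x s)) integrable_on {a..cl t}" for x :: "real \<Rightarrow>\<^sub>C 'a"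
        using cl[of t]
        by (intro integrable_continuous_interval continuous_on_subset[OF contA[of "apply_bcontfun x"]]) auto
      have "dist (apply_bcontfun (T y) t) (apply_bcontfun (T z) t)
          = norm (integral {a..cl t} (\<lambda>s. A s (apply_bcontfun y s) - A s (apply_bcontfun z s)))"
        by (simp add: T I_def dist_norm integral_diff[OF int int])
      also have "\<dots> \<le> (K * dist y z) * (cl t - a)"
      proof (rule integral_bound)
        show "continuous_on {a..cl t} (\<lambda>s. A s (apply_bcontfun y s) - A s (apply_bcontfun z s))"
          using cl[of t] by (intro continuous_intros continuous_on_subset[OF contA]) auto
        fix s assume "s \<in> {a..cl t}"
        then have s: "s \<in> {a..b}" using cl[of t] by auto
        have "norm (A s (apply_bcontfun y s) - A s (apply_bcontfun z s)) \<le> K * norm (apply_bcontfun y s - apply_bcontfun z s)"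
          using K(1)[OF s, of "apply_bcontfun y s - apply_bcontfun z s"] by (simp add: linear_diff[OF lin[OF s]])
        also have "\<dots> \<le> K * dist y z"
          using K(2) dist_bounded[of y s z] by (intro mult_left_mono) (auto simp: dist_norm)
        finally show "norm (A s (apply_bcontfun y s) - A s (apply_bcontfun z s)) \<le> K * dist y z" .
      qed (use cl[of t] in auto)
      also have "\<dots> \<le> K * dist y z * (b - a)"
        using K cl[of t] by (intro mult_left_mono) auto
      finally show "dist (apply_bcontfun (T y) t) (apply_bcontfun (T z) t) \<le> K * (b - a) * dist y z"
        by (simp add: mult_ac)
    qed
  qed
  then obtain y where y: "T y = y" by blast
  let ?y = "apply_bcontfun y"
  have eq: "?y t = I ?y t" if "t \<in> {a..b}" for t
    using T[of y t] that by (simp add: y cl_id)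
  have "(?y has_vector_derivative A t (?y t)) (at t within {a..b})" if t: "t \<in> {a..b}" for t
  proof -
    have "(I ?y has_vector_derivative A t (?y t)) (at t within {a..b})"
      unfolding I_def using contA[of ?y] t
      by (auto intro!: derivative_eq_intros integral_has_vector_derivative)
    then show ?thesis
      by (rule has_vector_derivative_transform[OF t, rotated]) (simp add: eq)
  qed
  moreover have "?y a = y0" using eq[of a] ab by (simp add: I_def)
  ultimately show ?thesis by blast
qed

text \<open>At the joint both one-sided derivatives are \<open>D\<close>. Used to glue solutions of
  differential equations and parallel fields.\<close>

lemma has_vector_derivative_join:
  fixes f g :: "real \<Rightarrow> 'a::real_normed_vector"
  assumes "a \<le> b" "b \<le> c" "t \<in> {a..c}" and "t = b \<Longrightarrow> f b = g b"
    and f: "t \<in> {a..b} \<Longrightarrow> (f has_vector_derivative D) (at t within {a..b})"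
    and g: "t \<in> {b..c} \<Longrightarrow> (g has_vector_derivative D) (at t within {b..c})"
  shows "((\<lambda>t. if t \<in> {a..b} then f t else g t) has_vector_derivative D) (at t within {a..c})"
proof -
  have i: "{a..b} \<inter> {b..c} = {b}" using assms(1,2) by auto
  have i1: "{a..b} \<union> {a..b} \<inter> {b..c} = {a..b}" "{b..c} \<union> {a..b} \<inter> {b..c} = {b..c}" by auto
  have "((\<lambda>t. if t \<in> {a..b} then f t else g t) has_vector_derivative (if t \<in> {a..b} then D else D)) (at t within {a..c})"
  proof (rule has_vector_derivative_If_within_closures[where T="{b..c}"])
    show "{a..c} = {a..b} \<union> {b..c}" using assms(1,2) by auto
    show "t \<in> {a..b} \<union> {b..c}" using assms by auto
    show "(f has_vector_derivative D) (at t within {a..b} \<union> closure {a..b} \<inter> closure {b..c})"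
      if "t \<in> {a..b} \<union> closure {a..b} \<inter> closure {b..c}"
      using f that by (simp only: closure_closed[OF closed_atLeastAtMost] i1)
    show "(g has_vector_derivative D) (at t within {b..c} \<union> closure {a..b} \<inter> closure {b..c})"
      if "t \<in> {b..c} \<union> closure {a..b} \<inter> closure {b..c}"
      using g that by (simp only: closure_closed[OF closed_atLeastAtMost] i1)
    show "f t = g t" if "t \<in> closure {a..b}" "t \<in> closure {b..c}"
    proof -
      have "t = b" using that i by auto
      then show "f t = g t" using assms by auto
    qed
  qed simp
  then show ?thesis by simp
qed

text \<open>Short intervals are covered by the contraction, and solutions on adjacent intervals can
  be joined; linearity gives one bound \<open>K\<close>, hence one admissible length, for the whole
  interval.\<close>

lemma linear_ode_exists:
  fixes A :: "real \<Rightarrow> 'a \<Rightarrow> 'a::euclidean_space"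
  assumes ab: "a \<le> b" and lin: "\<And>t. t \<in> {a..b} \<Longrightarrow> linear (A t)"
    and cont: "\<And>v. continuous_on {a..b} (\<lambda>t. A t v)"
  shows "\<exists>y. y a = y0 \<and> (\<forall>t\<in>{a..b}. (y has_vector_derivative A t (y t)) (at t within {a..b}))"
proof -
  have "\<exists>B. \<forall>t\<in>{a..b}. norm (A t i) \<le> B" for i
    using compact_imp_bounded[OF compact_continuous_image[OF cont[of i] compact_Icc]]
    unfolding bounded_iff by auto
  then obtain B where B: "\<And>i t. t \<in> {a..b} \<Longrightarrow> norm (A t i) \<le> B i" by metis
  define K where "K = (\<Sum>i\<in>(Basis::'a set). \<bar>B i\<bar>)"
  have K0: "0 \<le> K" by (auto simp: K_def intro: sum_nonneg)
  have K: "norm (A t v) \<le> K * norm v" if t: "t \<in> {a..b}" for t v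
  proof -
    have "A t v = (\<Sum>i\<in>Basis. (v \<bullet> i) *\<^sub>R A t i)" by (rule linear_expand[OF lin[OF t]])
    also have "norm \<dots> \<le> (\<Sum>i\<in>Basis. \<bar>v \<bullet> i\<bar> * norm (A t i))"
      by (rule order_trans[OF norm_sum]) simp
    also have "\<dots> \<le> (\<Sum>i\<in>Basis. norm v * \<bar>B i\<bar>)"
      using B[OF t] by (intro sum_mono mult_mono Basis_le_norm) (auto intro: order_trans[OF _ abs_ge_self])
    finally show ?thesis by (simp add: K_def sum_distrib_left mult.commute)
  qed
  \<comment> \<open>The guard makes \<open>P\<close> vacuous on intervals that stick out of
    \<open>{a..b}\<close>, which the local premise of \<open>Bolzano\<close> allows. The initial
    value is quantified because the second piece starts where the first one ends.\<close>
  define P where "P c d \<longleftrightarrow> (a \<le> c \<and> d \<le> b \<and> c \<le> d \<longrightarrow> (\<forall>y0. \<exists>y. y c = y0 \<and>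
     (\<forall>t\<in>{c..d}. (y has_vector_derivative A t (y t)) (at t within {c..d}))))" for c d
  have "P a b"
  proof (rule Bolzano[OF ab])
    fix c d e assume cd: "P c d" and de: "P d e" and le: "c \<le> d" "d \<le> e"
    show "P c e" unfolding P_def
    proof (intro impI allI)
      fix y0 assume "a \<le> c \<and> e \<le> b \<and> c \<le> e"
      then obtain y where y: "y c = y0" "\<And>t. t \<in> {c..d} \<Longrightarrow> (y has_vector_derivative A t (y t)) (at t within {c..d})"
        using cd le unfolding P_def by fastforce
      obtain z where z: "z d = y d" "\<And>t. t \<in> {d..e} \<Longrightarrow> (z has_vector_derivative A t (z t)) (at t within {d..e})"
        using de le \<open>a \<le> c \<and> e \<le> b \<and> c \<le> e\<close> unfolding P_def by fastforce
      let ?w = "\<lambda>t. if t \<in> {c..d} then y t else z t"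
      have "(?w has_vector_derivative A t (?w t)) (at t within {c..e})" if t: "t \<in> {c..e}" for t
      proof (rule has_vector_derivative_join[OF le t])
        show "(y has_vector_derivative A t (?w t)) (at t within {c..d})" if "t \<in> {c..d}"
          using y(2)[OF that] that by simp
        show "(z has_vector_derivative A t (?w t)) (at t within {d..e})" if "t \<in> {d..e}"
        proof -
          have "?w t = z t" using that z(1) le by auto
          then show ?thesis using z(2)[OF that] by simp
        qed
      qed (simp add: z(1))
      moreover have "?w c = y0" using y(1) le by simp
      ultimately show "\<exists>y. y c = y0 \<and> (\<forall>t\<in>{c..e}. (y has_vector_derivative A t (y t)) (at t within {c..e}))"
        by (intro exI[of _ ?w]) blast
    qed
  next
    fix x
    show "\<exists>d>0. \<forall>c e. c \<le> x \<and> x \<le> e \<and> e - c < d \<longrightarrow> P c e"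
    proof (intro exI conjI allI impI)
      \<comment> \<open>This length keeps \<open>K * (e - c)\<close> below \<open>1\<close> and is
        meaningful for \<open>K = 0\<close>.\<close>
      show "1 / (K + 1) > 0" using K0 by simp
      fix c e assume ce: "c \<le> x \<and> x \<le> e \<and> e - c < 1 / (K + 1)"
      show "P c e" unfolding P_def
      proof (intro impI allI)
        fix y0 assume *: "a \<le> c \<and> e \<le> b \<and> c \<le> e"
        have "K * (e - c) \<le> (K + 1) * (e - c)" using * by (intro mult_right_mono) auto
        also have "\<dots> < (K + 1) * (1 / (K + 1))" using K0 ce by (intro mult_strict_left_mono) auto
        finally have "K * (e - c) < 1" using K0 by simp
        then show "\<exists>y. y c = y0 \<and> (\<forall>t\<in>{c..e}. (y has_vector_derivative A t (y t)) (at t within {c..e}))"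
          using * K0 by (intro linear_ode_exists_short[of _ _ _ K] lin K continuous_on_subset[OF cont]) auto
      qed
    qed
  qed
  then show ?thesis using ab unfolding P_def by simp
qed

section \<open>Product rules for families of linear and bilinear maps\<close>

text \<open>\<open>L\<close> is known to be differentiable only for each fixed vector
  \<open>u\<close>; expanding \<open>v\<close> in the basis makes this sufficient.\<close>

lemma linear_family_has_derivative:
  fixes L :: "'p::real_normed_vector \<Rightarrow> 'a::euclidean_space \<Rightarrow> 'c::real_normed_vector"
  assumes S: "open S" "p t \<in> S" "t \<in> T" and lin: "\<And>q. q \<in> S \<Longrightarrow> linear (L q)"
    and dL: "\<And>u. ((\<lambda>q. L q u) has_derivative L' u) (at (p t))"
    and p: "(p has_derivative p') (at t within T)"
    and v: "(v has_derivative v') (at t within T)"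
  shows "((\<lambda>\<tau>. L (p \<tau>) (v \<tau>)) has_derivative (\<lambda>h. L' (v t) (p' h) + L (p t) (v' h))) (at t within T)"
proof -
  have ev: "\<forall>\<^sub>F \<tau> in at t within T. p \<tau> \<in> S"
    using has_derivative_continuous[OF p] S unfolding continuous_within by (metis topological_tendstoD)
  have "L' u h = (\<Sum>i\<in>Basis. (u \<bullet> i) *\<^sub>R L' i h)" for u h
  proof -
    have "((\<lambda>q. \<Sum>i\<in>Basis. (u \<bullet> i) *\<^sub>R L q i) has_derivative (\<lambda>h. \<Sum>i\<in>Basis. (u \<bullet> i) *\<^sub>R L' i h)) (at (p t))"
      by (intro has_derivative_sum has_derivative_scaleR_right dL)
    then have "((\<lambda>q. L q u) has_derivative (\<lambda>h. \<Sum>i\<in>Basis. (u \<bullet> i) *\<^sub>R L' i h)) (at (p t))"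
      by (rule has_derivative_transform_within_open[OF _ S(1,2)]) (simp add: linear_expand[OF lin, of _ u])
    from fun_cong[OF has_derivative_unique[OF dL this], of h] show ?thesis .
  qed
  note L'_exp = this
  have "((\<lambda>\<tau>. \<Sum>i\<in>Basis. (v \<tau> \<bullet> i) *\<^sub>R L (p \<tau>) i) has_derivative
     (\<lambda>h. \<Sum>i\<in>Basis. (v t \<bullet> i) *\<^sub>R L' i (p' h) + (v' h \<bullet> i) *\<^sub>R L (p t) i)) (at t within T)"
    by (intro has_derivative_sum has_derivative_scaleR has_derivative_inner_left v has_derivative_compose[OF p dL])
  also have "(\<lambda>h. \<Sum>i\<in>Basis. (v t \<bullet> i) *\<^sub>R L' i (p' h) + (v' h \<bullet> i) *\<^sub>R L (p t) i) = (\<lambda>h. L' (v t) (p' h) + L (p t) (v' h))"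
    by (simp add: L'_exp[of "v t"] linear_expand[OF lin[OF S(2)], of "v' _"] sum.distrib)
  finally show ?thesis
  proof (rule has_derivative_transform_eventually)
    show "\<forall>\<^sub>F \<tau> in at t within T. (\<Sum>i\<in>Basis. (v \<tau> \<bullet> i) *\<^sub>R L (p \<tau>) i) = L (p \<tau>) (v \<tau>)"
      using ev by eventually_elim (simp add: linear_expand[OF lin, of _ "v _"])
    show "(\<Sum>i\<in>Basis. (v t \<bullet> i) *\<^sub>R L (p t) i) = L (p t) (v t)"
      using S by (simp add: linear_expand[OF lin, of _ "v _"])
  qed (rule S)
qed

text \<open>The derivative of a family of bilinear maps is bilinear in the same arguments, by
  uniqueness of derivatives.\<close>

lemma bilinear_family_derivative_expand:
  fixes B :: "'p::real_normed_vector \<Rightarrow> 'a::euclidean_space \<Rightarrow> 'b::euclidean_space \<Rightarrow> 'c::real_normed_vector"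
  assumes S: "open S" "p \<in> S" and bil: "\<And>q. q \<in> S \<Longrightarrow> bilinear (B q)"
    and dB: "\<And>u w. ((\<lambda>q. B q u w) has_derivative B' u w) (at p)"
  shows "B' u w h = (\<Sum>i\<in>Basis. \<Sum>j\<in>Basis. ((u \<bullet> i) * (w \<bullet> j)) *\<^sub>R B' i j h)"
proof -
  have "((\<lambda>q. \<Sum>i\<in>Basis. \<Sum>j\<in>Basis. ((u \<bullet> i) * (w \<bullet> j)) *\<^sub>R B q i j) has_derivative
    (\<lambda>h. \<Sum>i\<in>Basis. \<Sum>j\<in>Basis. ((u \<bullet> i) * (w \<bullet> j)) *\<^sub>R B' i j h)) (at p)"
    by (intro has_derivative_sum has_derivative_scaleR_right dB)
  then have "((\<lambda>q. B q u w) has_derivative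
    (\<lambda>h. \<Sum>i\<in>Basis. \<Sum>j\<in>Basis. ((u \<bullet> i) * (w \<bullet> j)) *\<^sub>R B' i j h)) (at p)"
    by (rule has_derivative_transform_within_open[OF _ S]) (simp add: bilinear_expand[OF bil, of _ u w])
  from fun_cong[OF has_derivative_unique[OF dB this], of h] show ?thesis .
qed

lemma bilinear_family_has_derivative:
  fixes B :: "'p::real_normed_vector \<Rightarrow> 'a::euclidean_space \<Rightarrow> 'b::euclidean_space \<Rightarrow> 'c::real_normed_vector"
  assumes S: "open S" "p t \<in> S" "t \<in> T" and bil: "\<And>q. q \<in> S \<Longrightarrow> bilinear (B q)"
    and dB: "\<And>u w. ((\<lambda>q. B q u w) has_derivative B' u w) (at (p t))"
    and p: "(p has_derivative p') (at t within T)"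
    and v: "(v has_derivative v') (at t within T)"
    and w: "(w has_derivative w') (at t within T)"
  shows "((\<lambda>\<tau>. B (p \<tau>) (v \<tau>) (w \<tau>)) has_derivative
    (\<lambda>h. B' (v t) (w t) (p' h) + B (p t) (v' h) (w t) + B (p t) (v t) (w' h))) (at t within T)"
proof -
  have ev: "\<forall>\<^sub>F \<tau> in at t within T. p \<tau> \<in> S"
    using has_derivative_continuous[OF p] S unfolding continuous_within by (metis topological_tendstoD)
  have "((\<lambda>\<tau>. \<Sum>i\<in>Basis. \<Sum>j\<in>Basis. ((v \<tau> \<bullet> i) * (w \<tau> \<bullet> j)) *\<^sub>R B (p \<tau>) i j) has_derivative
     (\<lambda>h. \<Sum>i\<in>Basis. \<Sum>j\<in>Basis. ((v t \<bullet> i) * (w t \<bullet> j)) *\<^sub>R B' i j (p' h)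
       + ((v t \<bullet> i) * (w' h \<bullet> j) + (v' h \<bullet> i) * (w t \<bullet> j)) *\<^sub>R B (p t) i j)) (at t within T)"
    by (intro has_derivative_sum has_derivative_scaleR has_derivative_mult has_derivative_inner_left v w
        has_derivative_compose[OF p dB])
  also have "(\<lambda>h. \<Sum>i\<in>Basis. \<Sum>j\<in>Basis. ((v t \<bullet> i) * (w t \<bullet> j)) *\<^sub>R B' i j (p' h)
       + ((v t \<bullet> i) * (w' h \<bullet> j) + (v' h \<bullet> i) * (w t \<bullet> j)) *\<^sub>R B (p t) i j)
     = (\<lambda>h. B' (v t) (w t) (p' h) + B (p t) (v' h) (w t) + B (p t) (v t) (w' h))"
    by (simp add: bilinear_family_derivative_expand[where B'=B' and B=B and u="v t", OF S(1,2) bil dB]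
      bilinear_expand[OF bil[OF S(2)], of "v' _"] bilinear_expand[OF bil[OF S(2)], of "v t" "w' _"]
      sum.distrib scaleR_add_left fun_eq_iff)
  finally show ?thesis
  proof (rule has_derivative_transform_eventually)
    show "\<forall>\<^sub>F \<tau> in at t within T. (\<Sum>i\<in>Basis. \<Sum>j\<in>Basis. ((v \<tau> \<bullet> i) * (w \<tau> \<bullet> j)) *\<^sub>R B (p \<tau>) i j) = B (p \<tau>) (v \<tau>) (w \<tau>)"
      using ev by eventually_elim (simp add: bilinear_expand[OF bil, of _ "v _"])
    show "(\<Sum>i\<in>Basis. \<Sum>j\<in>Basis. ((v t \<bullet> i) * (w t \<bullet> j)) *\<^sub>R B (p t) i j) = B (p t) (v t) (w t)"
      using S by (simp add: bilinear_expand[OF bil, of _ "v _"])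
  qed (rule S)
qed

section \<open>A priori estimates and local uniqueness for differential equations\<close>

lemma has_vector_derivative_tendsto_nhds:
  assumes "(q has_vector_derivative d) (at t)"
  shows "(q \<longlongrightarrow> q t) (nhds t)"
  using has_vector_derivative_continuous[OF assms] unfolding continuous_within tendsto_at_iff_tendsto_nhds .

lemma norm_diff_le_of_vector_derivative:
  fixes y :: "real \<Rightarrow> 'a::real_normed_vector"
  assumes "\<And>t. t \<in> {a..b} \<Longrightarrow> (y has_vector_derivative y' t) (at t within {a..b})"
    and "\<And>t. t \<in> {a..b} \<Longrightarrow> norm (y' t) \<le> M" and "s \<in> {a..b}" "t \<in> {a..b}"
  shows "norm (y t - y s) \<le> M * \<bar>t - s\<bar>"
proof -
  have "norm (y t - y s) \<le> M * norm (t - s)"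
  proof (rule differentiable_bound[of "{a..b}" y "\<lambda>t h. h *\<^sub>R y' t"])
    fix x assume "x \<in> {a..b}"
    then show "onorm (\<lambda>h. h *\<^sub>R y' x) \<le> M"
      using assms(2) by (intro onorm_bound) (auto simp: mult.commute[of M] intro!: mult_left_mono intro: order_trans[OF norm_ge_zero])
  qed (use assms in \<open>auto simp: has_vector_derivative_def\<close>)
  then show ?thesis by simp
qed

text \<open>At a time where the difference is largest, its norm is at most \<open>L * d < 1\<close>
  times itself and therefore zero.\<close>

lemma ode_unique_near:
  fixes y z :: "real \<Rightarrow> 'a::real_normed_vector"
  assumes "0 \<le> d" and y: "\<And>t. t \<in> {t0-d..t0+d} \<Longrightarrow> (y has_vector_derivative y' t) (at t)"
    and z: "\<And>t. t \<in> {t0-d..t0+d} \<Longrightarrow> (z has_vector_derivative z' t) (at t)"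
    and L: "\<And>t. t \<in> {t0-d..t0+d} \<Longrightarrow> norm (y' t - z' t) \<le> L * norm (y t - z t)" "L * d < 1" "0 \<le> L"
    and init: "y t0 = z t0" and t: "t \<in> {t0-d..t0+d}"
  shows "y t = z t"
proof -
  let ?I = "{t0-d..t0+d}"
  define w where "w t = y t - z t" for t
  have dw: "(w has_vector_derivative y' t - z' t) (at t within ?I)" if "t \<in> ?I" for t
    unfolding w_def by (rule has_vector_derivative_at_within[OF has_vector_derivative_diff[OF y[OF that] z[OF that]]])
  have "continuous_on ?I (\<lambda>t. norm (w t))"
    by (rule continuous_on_norm[OF continuous_on_vector_derivative[OF dw]])
  moreover have "?I \<noteq> {}" using \<open>0 \<le> d\<close> by auto
  ultimately obtain m where m: "m \<in> ?I" "\<And>t. t \<in> ?I \<Longrightarrow> norm (w t) \<le> norm (w m)"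
    using continuous_attains_sup[OF compact_Icc, of "t0-d" "t0+d" "\<lambda>t. norm (w t)"] by blast
  have "norm (w m - w t0) \<le> (L * norm (w m)) * \<bar>m - t0\<bar>"
  proof (rule norm_diff_le_of_vector_derivative[OF dw])
    fix t assume "t \<in> ?I"
    then have "norm (y' t - z' t) \<le> L * norm (w t)" using L(1) by (simp add: w_def)
    also have "\<dots> \<le> L * norm (w m)" using m(2) \<open>t \<in> ?I\<close> L(3) by (intro mult_left_mono) auto
    finally show "norm (y' t - z' t) \<le> L * norm (w m)" .
  qed (use m \<open>0 \<le> d\<close> in auto)
  also have "\<dots> \<le> (L * norm (w m)) * d"
    using m(1) L(3) by (intro mult_left_mono) auto
  finally have "norm (w m) * (1 - L * d) \<le> 0" using init by (simp add: w_def algebra_simps)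
  then have "norm (w m) \<le> 0" using L(2) by (simp add: mult_le_0_iff)
  then have "w t = 0" using m(2)[OF t] by simp
  then show ?thesis by (simp add: w_def)
qed

text \<open>Let \<open>m\<close> be a time of maximal \<open>norm (b t)\<close>. Since the time span
  is one, \<open>z\<close> is bounded by \<open>norm (b m)\<close>, and integrating \<open>c\<close>
  adds at most \<open>2 * \<kappa> * norm (b m) + R\<close>. The condition
  \<open>\<kappa> \<le> 1/4\<close> allows half of the maximum to be absorbed. Applied below to
  differences of solutions, to variations and to the Taylor remainder of the flow.\<close>

lemma second_order_bound:
  fixes z b c :: "real \<Rightarrow> 'a::real_normed_vector"
  assumes z: "\<And>t. t \<in> {0..1} \<Longrightarrow> (z has_vector_derivative b t) (at t within {0..1})"
    and b: "\<And>t. t \<in> {0..1} \<Longrightarrow> (b has_vector_derivative c t) (at t within {0..1})"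
    and c: "\<And>t. t \<in> {0..1} \<Longrightarrow> norm (c t) \<le> \<kappa> * (norm (z t) + norm (b t)) + R"
    and "z 0 = 0" "0 \<le> \<kappa>" "\<kappa> \<le> 1/4" "0 \<le> R" and t: "t \<in> {0..1}"
  shows "norm (b t) \<le> 2 * (norm (b 0) + R)" "norm (z t) \<le> 2 * (norm (b 0) + R)"
proof -
  have "continuous_on {0..1} (\<lambda>t. norm (b t))"
    by (rule continuous_on_norm[OF continuous_on_vector_derivative[OF b]])
  then obtain m where m: "m \<in> {0..1}" "\<And>t. t \<in> {0..1} \<Longrightarrow> norm (b t) \<le> norm (b m)"
    using continuous_attains_sup[OF compact_Icc, of "0::real" 1 "\<lambda>t. norm (b t)"] by auto
  have zt: "norm (z t) \<le> norm (b m)" if t: "t \<in> {0..1}" for t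
  proof -
    have "norm (z t - z 0) \<le> norm (b m) * \<bar>t - 0\<bar>"
      by (rule norm_diff_le_of_vector_derivative[OF z m(2)]) (use t in auto)
    also have "\<dots> \<le> norm (b m) * 1" using t by (intro mult_left_mono) auto
    finally show ?thesis using \<open>z 0 = 0\<close> by simp
  qed
  have "norm (b m - b 0) \<le> (\<kappa> * (2 * norm (b m)) + R) * \<bar>m - 0\<bar>"
  proof (rule norm_diff_le_of_vector_derivative[OF b])
    fix t :: real assume t: "t \<in> {0..1}"
    have "norm (c t) \<le> \<kappa> * (norm (z t) + norm (b t)) + R" by (rule c[OF t])
    also have "\<dots> \<le> \<kappa> * (norm (b m) + norm (b m)) + R"
      using zt[OF t] m(2)[OF t] \<open>0 \<le> \<kappa>\<close> by (intro add_mono mult_left_mono) auto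
    finally show "norm (c t) \<le> \<kappa> * (2 * norm (b m)) + R" by simp
  qed (use m in auto)
  also have "\<dots> \<le> (\<kappa> * (2 * norm (b m)) + R) * 1"
    using m(1) \<open>0 \<le> R\<close> \<open>0 \<le> \<kappa>\<close> by (intro mult_left_mono) auto
  also have "\<dots> \<le> 1/4 * (2 * norm (b m)) + R"
    using \<open>\<kappa> \<le> 1/4\<close> mult_right_mono[of \<kappa> "1/4" "2 * norm (b m)"] by simp
  finally have "norm (b m - b 0) \<le> norm (b m) / 2 + R" by simp
  moreover have "norm (b m) \<le> norm (b m - b 0) + norm (b 0)" by (metis diff_add_cancel norm_triangle_ineq)
  ultimately have "norm (b m) \<le> 2 * (norm (b 0) + R)" by simp
  then show "norm (b t) \<le> 2 * (norm (b 0) + R)" "norm (z t) \<le> 2 * (norm (b 0) + R)"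
    using m(2)[OF t] zt[OF t] by linarith+
qed

section \<open>Smooth dependence on the initial velocity\<close>

text \<open>Models a Christoffel form \<open>\<Gamma>\<close> and its derivative
  \<open>\<Gamma>'\<close> in the base point, with the direction as second argument. In the
  application \<open>S\<close> is a closed coordinate ball, hence the derivative within
  \<open>S\<close>. One constant \<open>K\<close> serves all estimates; the Lipschitz bound on
  \<open>\<Gamma>'\<close> makes Taylor remainders quadratic.\<close>

locale spray_field =
  fixes \<Gamma> :: "'a::euclidean_space \<Rightarrow> 'a \<Rightarrow> 'a \<Rightarrow> 'a"
    and \<Gamma>' :: "'a \<Rightarrow> 'a \<Rightarrow> 'a \<Rightarrow> 'a \<Rightarrow> 'a"
    and S :: "'a set" and K :: real
  assumes convex: "convex S"
    and bil: "p \<in> S \<Longrightarrow> bilinear (\<Gamma> p)" and bil': "p \<in> S \<Longrightarrow> bilinear (\<Gamma>' p h)"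
    and sym: "p \<in> S \<Longrightarrow> \<Gamma> p u v = \<Gamma> p v u"
    and deriv: "p \<in> S \<Longrightarrow> ((\<lambda>q. \<Gamma> q u v) has_derivative (\<lambda>h. \<Gamma>' p h u v)) (at p within S)"
    and K: "0 \<le> K" and bound: "p \<in> S \<Longrightarrow> norm (\<Gamma> p u v) \<le> K * norm u * norm v"
    and bound': "p \<in> S \<Longrightarrow> norm (\<Gamma>' p h u v) \<le> K * norm h * norm u * norm v"
    and lip': "p \<in> S \<Longrightarrow> q \<in> S \<Longrightarrow>
      norm (\<Gamma>' p h u v - \<Gamma>' q h u v) \<le> K * norm (p - q) * norm h * norm u * norm v"
begin

lemma bound_le:
  assumes "p \<in> S" "norm u \<le> a" "norm v \<le> b"
  shows "norm (\<Gamma> p u v) \<le> K * a * b"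
proof -
  have "norm (\<Gamma> p u v) \<le> K * norm u * norm v" by (rule bound[OF assms(1)])
  also have "\<dots> \<le> K * a * b"
    using assms K by (intro mult_mono) (auto intro: order_trans[OF norm_ge_zero] mult_nonneg_nonneg)
  finally show ?thesis .
qed

lemma bound'_le:
  assumes "p \<in> S" "norm h \<le> d" "norm u \<le> a" "norm v \<le> b"
  shows "norm (\<Gamma>' p h u v) \<le> K * d * a * b"
proof -
  have "norm (\<Gamma>' p h u v) \<le> K * norm h * norm u * norm v" by (rule bound'[OF assms(1)])
  also have "\<dots> \<le> K * d * a * b"
    using assms K by (intro mult_mono) (auto intro!: mult_nonneg_nonneg intro: order_trans[OF norm_ge_zero])
  finally show ?thesis .
qed

lemma lipschitz:
  assumes "p \<in> S" "q \<in> S" "norm (p - q) \<le> d" "norm u \<le> a" "norm v \<le> b"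
  shows "norm (\<Gamma> p u v - \<Gamma> q u v) \<le> K * d * a * b"
proof -
  have "norm (\<Gamma> p u v - \<Gamma> q u v) \<le> (K * norm u * norm v) * norm (p - q)"
  proof (rule differentiable_bound[OF convex deriv])
    fix x assume "x \<in> S"
    then show "onorm (\<lambda>h. \<Gamma>' x h u v) \<le> K * norm u * norm v"
      using bound'[of x _ u v] K by (intro onorm_bound) (auto simp: mult_ac)
  qed (use assms in auto)
  also have "\<dots> \<le> (K * a * b) * d"
    using assms K by (intro mult_mono) (auto intro!: mult_nonneg_nonneg intro: order_trans[OF norm_ge_zero])
  finally show ?thesis by (simp add: mult_ac)
qed

text \<open>Mean value inequality on the segment from \<open>p\<close> to \<open>q\<close>, where
  \<open>lip'\<close> bounds the variation of the derivative; this is the source of the factor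
  \<open>d * d\<close>.\<close>

lemma linearization:
  assumes "p \<in> S" "q \<in> S" "norm (q - p) \<le> d" "norm u \<le> a" "norm v \<le> b"
  shows "norm (\<Gamma> q u v - \<Gamma> p u v - \<Gamma>' p (q - p) u v) \<le> K * d * d * a * b"
proof -
  have seg: "closed_segment p q \<subseteq> S" using convex assms by (simp add: closed_segment_subset)
  have "norm (\<Gamma> q u v - \<Gamma> p u v - \<Gamma>' p (q - p) u v) \<le> norm (q - p) * (K * norm (q - p) * norm u * norm v)"
  proof (rule differentiable_bound_linearization[of p q "closed_segment p q" "\<lambda>q. \<Gamma> q u v" "\<lambda>x h. \<Gamma>' x h u v" p])
    show "p + t *\<^sub>R (q - p) \<in> closed_segment p q" if "t \<in> {0..1}" for t
      using that by (auto simp: closed_segment_def algebra_simps intro!: exI[of _ t])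
    show "((\<lambda>q. \<Gamma> q u v) has_derivative (\<lambda>h. \<Gamma>' x h u v)) (at x within closed_segment p q)"
      if "x \<in> closed_segment p q" for x
      using that seg by (intro has_derivative_subset[OF deriv]) auto
    show "onorm ((\<lambda>h. \<Gamma>' x h u v) - (\<lambda>h. \<Gamma>' p h u v)) \<le> K * norm (q - p) * norm u * norm v"
      if "x \<in> closed_segment p q" for x
    proof (rule onorm_bound)
      fix h
      have "norm (\<Gamma>' x h u v - \<Gamma>' p h u v) \<le> K * norm (x - p) * norm h * norm u * norm v"
        using that seg assms by (intro lip') auto
      also have "\<dots> \<le> K * norm (q - p) * norm h * norm u * norm v"
        using that K segment_bound1[OF that] by (intro mult_right_mono mult_left_mono) auto
      finally show "norm (((\<lambda>h. \<Gamma>' x h u v) - (\<lambda>h. \<Gamma>' p h u v)) h) \<le> K * norm (q - p) * norm u * norm v * norm h"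
        by (simp add: mult_ac)
    qed (use K in auto)
  qed auto
  also have "\<dots> \<le> d * (K * d * a * b)"
    using assms K by (intro mult_mono) (auto intro!: mult_nonneg_nonneg intro: order_trans[OF norm_ge_zero])
  finally show ?thesis by (simp add: mult_ac)
qed

text \<open>The difference is telescoped: the base point is moved first, then one vector argument at
  a time.\<close>

lemma spray_diff_le:
  assumes S: "p \<in> S" "q \<in> S" and R: "norm u \<le> R" "norm v \<le> R"
  shows "norm (\<Gamma> p u u - \<Gamma> q v v) \<le> K * R * R * norm (p - q) + 2 * (K * R) * norm (u - v)"
proof -
  have "norm (\<Gamma> p u u - \<Gamma> q v v) = norm ((\<Gamma> p u u - \<Gamma> q u u) + \<Gamma> q (u - v) u + \<Gamma> q v (u - v))"
    by (simp add: bilinear_lsub[OF bil[OF S(2)]] bilinear_rsub[OF bil[OF S(2)]])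
  also have "\<dots> \<le> K * norm (p - q) * R * R + K * norm (u - v) * R + K * R * norm (u - v)"
    by (intro norm_triangle_le add_mono lipschitz bound_le S R order_refl)
  finally show ?thesis by (simp add: algebra_simps)
qed

text \<open>The pair of position and velocity solves a first-order system whose right-hand side is
  Lipschitz where velocities are bounded by \<open>R\<close>.\<close>

lemma solution_unique_near:
  assumes sol1: "\<forall>\<^sub>F t in nhds t0. (p1 has_vector_derivative q1 t) (at t) \<and>
      (q1 has_vector_derivative - \<Gamma> (p1 t) (q1 t) (q1 t)) (at t) \<and> p1 t \<in> S"
    and sol2: "\<forall>\<^sub>F t in nhds t0. (p2 has_vector_derivative q2 t) (at t) \<and>
      (q2 has_vector_derivative - \<Gamma> (p2 t) (q2 t) (q2 t)) (at t) \<and> p2 t \<in> S"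
    and init: "p1 t0 = p2 t0" "q1 t0 = q2 t0"
  shows "\<forall>\<^sub>F t in nhds t0. p1 t = p2 t \<and> q1 t = q2 t"
proof -
  define R where "R = norm (q1 t0) + 1"
  have bnd: "\<forall>\<^sub>F t in nhds t0. norm (q t) \<le> R"
    if "(q has_vector_derivative d) (at t0)" "q t0 = q1 t0" for q d
  proof -
    have "\<forall>\<^sub>F t in nhds t0. norm (q t) < R"
      using has_vector_derivative_tendsto_nhds[OF that(1)]
      by (intro order_tendstoD(2)[OF tendsto_norm]) (auto simp: R_def that)
    then show ?thesis by eventually_elim simp
  qed
  have "\<forall>\<^sub>F t in nhds t0. norm (q1 t) \<le> R" "\<forall>\<^sub>F t in nhds t0. norm (q2 t) \<le> R"
    using eventually_nhds_x_imp_x[OF sol1] eventually_nhds_x_imp_x[OF sol2] init by (auto intro!: bnd)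
  then have "\<forall>\<^sub>F t in nhds t0. (p1 has_vector_derivative q1 t) (at t) \<and>
      (q1 has_vector_derivative - \<Gamma> (p1 t) (q1 t) (q1 t)) (at t) \<and>
      (p2 has_vector_derivative q2 t) (at t) \<and> (q2 has_vector_derivative - \<Gamma> (p2 t) (q2 t) (q2 t)) (at t) \<and>
      p1 t \<in> S \<and> p2 t \<in> S \<and> norm (q1 t) \<le> R \<and> norm (q2 t) \<le> R"
    using sol1 sol2 by eventually_elim blast
  then obtain e where e: "e > 0" and sol: "\<And>t. dist t t0 < e \<Longrightarrow>
      (p1 has_vector_derivative q1 t) (at t) \<and>
      (q1 has_vector_derivative - \<Gamma> (p1 t) (q1 t) (q1 t)) (at t) \<and>
      (p2 has_vector_derivative q2 t) (at t) \<and> (q2 has_vector_derivative - \<Gamma> (p2 t) (q2 t) (q2 t)) (at t) \<and>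
      p1 t \<in> S \<and> p2 t \<in> S \<and> norm (q1 t) \<le> R \<and> norm (q2 t) \<le> R"
    unfolding eventually_nhds_metric by blast
  \<comment> \<open>Lipschitz constant of \<open>(p, q) \<mapsto> (q, - \<Gamma> p q q)\<close>: the
    summand \<open>1\<close> belongs to the first component, the others come from
    \<open>spray_diff_le\<close>.\<close>
  define L where "L = 1 + K * R * R + 2 * (K * R)"
  have L: "L > 0" using K by (simp add: L_def R_def add_pos_nonneg)
  define d where "d = min (e / 2) (1 / (2 * L))"
  have d: "d > 0" "d < e" using e L by (auto simp: d_def)
  have Ld: "L * d < 1"
  proof -
    have "L * d \<le> L * (1 / (2 * L))" using L by (intro mult_left_mono) (auto simp: d_def)
    also have "\<dots> < 1" using L by simp
    finally show ?thesis .
  qed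
  have "(p1 t, q1 t) = (p2 t, q2 t)" if t: "t \<in> {t0-d..t0+d}" for t
  proof (rule ode_unique_near[where y="\<lambda>t. (p1 t, q1 t)" and z="\<lambda>t. (p2 t, q2 t)" and d=d and ?t0.0=t0 and L=L])
    fix t assume "t \<in> {t0-d..t0+d}"
    then have "dist t t0 < e" using d by (auto simp: dist_real_def)
    note s = sol[OF this]
    show "((\<lambda>t. (p1 t, q1 t)) has_vector_derivative (q1 t, - \<Gamma> (p1 t) (q1 t) (q1 t))) (at t)"
      "((\<lambda>t. (p2 t, q2 t)) has_vector_derivative (q2 t, - \<Gamma> (p2 t) (q2 t) (q2 t))) (at t)"
      using s by (auto intro!: has_vector_derivative_Pair)
    let ?n = "norm ((p1 t, q1 t) - (p2 t, q2 t))"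
    have n: "norm (p1 t - p2 t) \<le> ?n" "norm (q1 t - q2 t) \<le> ?n"
      by (simp_all add: norm_fst_le norm_snd_le)
    have "norm ((q1 t, - \<Gamma> (p1 t) (q1 t) (q1 t)) - (q2 t, - \<Gamma> (p2 t) (q2 t) (q2 t)))
      \<le> norm (q1 t - q2 t) + norm (\<Gamma> (p1 t) (q1 t) (q1 t) - \<Gamma> (p2 t) (q2 t) (q2 t))"
      using norm_Pair_le[of "q1 t - q2 t" "- (\<Gamma> (p1 t) (q1 t) (q1 t) - \<Gamma> (p2 t) (q2 t) (q2 t))"]
      by (simp add: norm_minus_commute)
    also have "\<dots> \<le> ?n + (K * R * R * ?n + 2 * (K * R) * ?n)"
    proof (rule add_mono[OF n(2)])
      have "norm (\<Gamma> (p1 t) (q1 t) (q1 t) - \<Gamma> (p2 t) (q2 t) (q2 t))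
        \<le> K * R * R * norm (p1 t - p2 t) + 2 * (K * R) * norm (q1 t - q2 t)"
        by (rule spray_diff_le) (use s in auto)
      also have "\<dots> \<le> K * R * R * ?n + 2 * (K * R) * ?n"
        using n K by (intro add_mono mult_left_mono) (auto simp: R_def)
      finally show "norm (\<Gamma> (p1 t) (q1 t) (q1 t) - \<Gamma> (p2 t) (q2 t) (q2 t)) \<le> K * R * R * ?n + 2 * (K * R) * ?n" .
    qed
    finally show "norm ((q1 t, - \<Gamma> (p1 t) (q1 t) (q1 t)) - (q2 t, - \<Gamma> (p2 t) (q2 t) (q2 t))) \<le> L * ?n"
      by (simp add: L_def algebra_simps)
  qed (use d L Ld init t in auto)
  then have "\<And>t. dist t t0 < d \<Longrightarrow> p1 t = p2 t \<and> q1 t = q2 t"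
    by (auto simp: dist_real_def abs_less_iff)
  then show ?thesis using d(1) unfolding eventually_nhds_metric by blast
qed

end

text \<open>The smallness of \<open>\<delta>\<close> is what lets \<open>second_order_bound\<close> replace a Gronwall argument.\<close>

locale spray = spray_field \<Gamma> \<Gamma>' S K
  for \<Gamma> :: "'a::euclidean_space \<Rightarrow> 'a \<Rightarrow> 'a \<Rightarrow> 'a"
    and \<Gamma>' :: "'a \<Rightarrow> 'a \<Rightarrow> 'a \<Rightarrow> 'a \<Rightarrow> 'a"
    and S :: "'a set" and K :: real +
  fixes p0 :: 'a and C \<delta> :: real and P V :: "'a \<Rightarrow> real \<Rightarrow> 'a"
  assumes p0: "p0 \<in> S"
    and C: "0 \<le> C" and \<delta>: "0 < \<delta>" "C * \<delta> \<le> 1" "K * (C * \<delta>) \<le> 1/16"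
    and P: "\<lbrakk>norm v < \<delta>; t \<in> {0..1}\<rbrakk> \<Longrightarrow> (P v has_vector_derivative V v t) (at t within {0..1})"
    and V: "\<lbrakk>norm v < \<delta>; t \<in> {0..1}\<rbrakk> \<Longrightarrow>
      (V v has_vector_derivative - \<Gamma> (P v t) (V v t) (V v t)) (at t within {0..1})"
    and PS: "\<lbrakk>norm v < \<delta>; t \<in> {0..1}\<rbrakk> \<Longrightarrow> P v t \<in> S"
    and V_le: "\<lbrakk>norm v < \<delta>; t \<in> {0..1}\<rbrakk> \<Longrightarrow> norm (V v t) \<le> C * norm v"
    and P_0: "norm v < \<delta> \<Longrightarrow> P v 0 = p0" and V_0: "norm v < \<delta> \<Longrightarrow> V v 0 = v"
begin

abbreviation m :: real where "m \<equiv> C * \<delta>"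

lemma m_nonneg: "0 \<le> m" using C \<delta> by simp

lemma Km: "K * m * m \<le> K * m" "0 \<le> K * m"
  using K m_nonneg \<delta>(2) by (simp_all add: mult_left_le)

lemma V_le_m: "\<lbrakk>norm v < \<delta>; t \<in> {0..1}\<rbrakk> \<Longrightarrow> norm (V v t) \<le> m"
  using V_le[of v t] C mult_left_mono[of "norm v" \<delta> C] by simp

text \<open>The difference of two solutions starts with position \<open>0\<close> and velocity
  \<open>w - v\<close>, and by the choice of \<open>\<delta>\<close> its acceleration is small
  relative to itself.\<close>

lemma flow_lipschitz:
  assumes v: "norm v < \<delta>" and w: "norm w < \<delta>" and t: "t \<in> {0..1}"
  shows "norm (V w t - V v t) \<le> 2 * norm (w - v)" "norm (P w t - P v t) \<le> 2 * norm (w - v)"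
proof -
  let ?c = "\<lambda>t. - \<Gamma> (P w t) (V w t) (V w t) - - \<Gamma> (P v t) (V v t) (V v t)"
  \<comment> \<open>\<open>3/16\<close> is one sixteenth or less from moving the base point and two
    from moving the velocities; it stays below the \<open>1/4\<close> of
    \<open>second_order_bound\<close>.\<close>
  have c: "norm (?c t) \<le> 3/16 * (norm (P w t - P v t) + norm (V w t - V v t)) + 0" if t: "t \<in> {0..1}" for t
  proof -
    note S = PS[OF v t] PS[OF w t] and Vm = V_le_m[OF v t] V_le_m[OF w t]
    let ?D = "norm (P w t - P v t)" and ?E = "norm (V w t - V v t)"
    have "norm (?c t) = norm ((\<Gamma> (P w t) (V w t) (V w t) - \<Gamma> (P v t) (V w t) (V w t))
        + \<Gamma> (P v t) (V w t - V v t) (V w t) + \<Gamma> (P v t) (V v t) (V w t - V v t))"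
      by (subst norm_minus_cancel[symmetric])
         (simp add: bilinear_lsub[OF bil[OF S(1)]] bilinear_rsub[OF bil[OF S(1)]])
    also have "\<dots> \<le> K * ?D * m * m + K * ?E * m + K * m * ?E"
      by (intro norm_triangle_le add_mono lipschitz bound_le S Vm order_refl)
    also have "\<dots> = (K * m * m) * ?D + 2 * (K * m) * ?E" by (simp add: algebra_simps)
    also have "\<dots> \<le> 3/16 * ?D + 3/16 * ?E"
      using Km \<delta>(3) by (intro add_mono mult_right_mono) auto
    finally show ?thesis by simp
  qed
  have z: "((\<lambda>t. P w t - P v t) has_vector_derivative V w t - V v t) (at t within {0..1})"
    "((\<lambda>t. V w t - V v t) has_vector_derivative ?c t) (at t within {0..1})" if "t \<in> {0..1}" for t
    by (intro has_vector_derivative_diff P V v w that)+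
  show "norm (V w t - V v t) \<le> 2 * norm (w - v)" "norm (P w t - P v t) \<le> 2 * norm (w - v)"
    using second_order_bound[OF z c _ _ _ _ t] by (simp_all add: P_0 V_0 v w)
qed

text \<open>Linearization of \<open>p' = q, q' = - \<Gamma> p q q\<close> along \<open>P v\<close>; \<open>a\<close> and \<open>b\<close> are the variations
  of \<open>p\<close> and \<open>q\<close>.\<close>

definition is_variation :: "'a \<Rightarrow> 'a \<Rightarrow> (real \<Rightarrow> 'a) \<Rightarrow> (real \<Rightarrow> 'a) \<Rightarrow> bool" where
  "is_variation v z a b \<longleftrightarrow> a 0 = 0 \<and> b 0 = z \<and> (\<forall>t\<in>{0..1}.
     (a has_vector_derivative b t) (at t within {0..1}) \<and>
     (b has_vector_derivative - (\<Gamma>' (P v t) (a t) (V v t) (V v t) + 2 *\<^sub>R \<Gamma> (P v t) (V v t) (b t)))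
       (at t within {0..1}))"

lemma linear_\<Gamma>'_direction: "p \<in> S \<Longrightarrow> linear (\<lambda>h. \<Gamma>' p h u v)"
  using has_derivative_linear[OF deriv] .

text \<open>The equation is linear in the pair \<open>(a, b)\<close>, and its coefficients are
  continuous in time since \<open>\<Gamma>\<close> is differentiable and \<open>\<Gamma>'\<close> is
  Lipschitz in the base point.\<close>

lemma variation_exists:
  assumes v: "norm v < \<delta>"
  shows "\<exists>a b. is_variation v z a b"
proof -
  define A where "A t ab = (snd ab, - (\<Gamma>' (P v t) (fst ab) (V v t) (V v t) + 2 *\<^sub>R \<Gamma> (P v t) (V v t) (snd ab)))"
    for t and ab :: "'a \<times> 'a"
  have contP: "continuous_on {0..1} (P v)" and contV: "continuous_on {0..1} (V v)"
    by (rule continuous_on_vector_derivative, rule P[OF v], assumption)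
       (rule continuous_on_vector_derivative, rule V[OF v], assumption)
  have c\<Gamma>: "continuous_on S (\<lambda>p. \<Gamma> p i j)" for i j
    using deriv has_derivative_continuous continuous_on_eq_continuous_within by blast
  have c\<Gamma>': "continuous_on S (\<lambda>p. \<Gamma>' p h i j)" for h i j
  proof (rule lipschitz_on_continuous_on, rule lipschitz_onI)
    show "dist (\<Gamma>' p h i j) (\<Gamma>' q h i j) \<le> (K * norm h * norm i * norm j) * dist p q" if "p \<in> S" "q \<in> S" for p q
      using lip'[OF that, of h i j] by (simp add: dist_norm mult_ac)
  qed (use K in auto)
  have "\<exists>y. y 0 = (0, z) \<and> (\<forall>t\<in>{0..1}. (y has_vector_derivative A t (y t)) (at t within {0..1}))"
  proof (rule linear_ode_exists)
    fix t :: real assume t: "t \<in> {0..1}"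
    show "linear (A t)"
      using linear_\<Gamma>'_direction[OF PS[OF v t], of "V v t" "V v t"] bil[OF PS[OF v t]]
      unfolding A_def by (simp add: linear_iff bilinear_def algebra_simps)
  next
    fix ab :: "'a \<times> 'a"
    have "continuous_on {0..1} (\<lambda>t. (snd ab, - ((\<Sum>i\<in>Basis. \<Sum>j\<in>Basis. ((V v t \<bullet> i) * (V v t \<bullet> j)) *\<^sub>R \<Gamma>' (P v t) (fst ab) i j)
       + 2 *\<^sub>R (\<Sum>i\<in>Basis. \<Sum>j\<in>Basis. ((V v t \<bullet> i) * (snd ab \<bullet> j)) *\<^sub>R \<Gamma> (P v t) i j))))"
      using PS[OF v]
      by (intro continuous_intros contV continuous_on_compose2[OF c\<Gamma>' contP] continuous_on_compose2[OF c\<Gamma> contP]) auto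
    then show "continuous_on {0..1} (\<lambda>t. A t ab)"
      by (rule continuous_on_eq)
         (simp add: A_def bilinear_expand[OF bil'[OF PS[OF v]], of _ _ "V v _"] bilinear_expand[OF bil[OF PS[OF v]], of _ "V v _"])
  qed auto
  then obtain y where y: "y 0 = (0, z)"
    "\<And>t. t \<in> {0..1} \<Longrightarrow> (y has_vector_derivative A t (y t)) (at t within {0..1})" by blast
  have "is_variation v z (\<lambda>t. fst (y t)) (\<lambda>t. snd (y t))"
    using y(1) bounded_linear.has_vector_derivative[OF bounded_linear_fst y(2)]
      bounded_linear.has_vector_derivative[OF bounded_linear_snd y(2)]
    by (simp add: is_variation_def A_def)
  then show ?thesis by blast
qed

lemma variation_rhs_le:
  assumes v: "norm v < \<delta>" and t: "t \<in> {0..1}"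
  shows "norm (\<Gamma>' (P v t) a (V v t) (V v t) + 2 *\<^sub>R \<Gamma> (P v t) (V v t) b) \<le> 3/16 * (norm a + norm b)"
proof -
  have "norm (\<Gamma>' (P v t) a (V v t) (V v t) + 2 *\<^sub>R \<Gamma> (P v t) (V v t) b) \<le> K * norm a * m * m + 2 * (K * m * norm b)"
    using bound'_le[OF PS[OF v t] order_refl V_le_m[OF v t] V_le_m[OF v t], of a]
      bound_le[OF PS[OF v t] V_le_m[OF v t] order_refl, of b]
    by (intro norm_triangle_le add_mono) auto
  also have "\<dots> = (K * m * m) * norm a + 2 * (K * m) * norm b" by (simp add: algebra_simps)
  also have "\<dots> \<le> 3/16 * norm a + 3/16 * norm b"
    using Km \<delta>(3) by (intro add_mono mult_right_mono) auto
  finally show ?thesis by simp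
qed

lemma variation_bound:
  assumes v: "norm v < \<delta>" and ab: "is_variation v z a b" and t: "t \<in> {0..1}"
  shows "norm (b t) \<le> 2 * norm z" "norm (a t) \<le> 2 * norm z"
proof -
  let ?c = "\<lambda>t. - (\<Gamma>' (P v t) (a t) (V v t) (V v t) + 2 *\<^sub>R \<Gamma> (P v t) (V v t) (b t))"
  have "norm (?c t) \<le> 3/16 * (norm (a t) + norm (b t)) + 0" if "t \<in> {0..1}" for t
    using variation_rhs_le[OF v that] by (simp only: norm_minus_cancel add_0_right)
  from second_order_bound[of a b ?c, OF _ _ this _ _ _ _ t] ab
  show "norm (b t) \<le> 2 * norm z" "norm (a t) \<le> 2 * norm z"
    by (simp_all add: is_variation_def)
qed

text \<open>Superposition. With coefficients \<open>1\<close> and \<open>-1\<close> and equal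
  initial data it yields uniqueness, and in general the linearity of \<open>\<Phi>'\<close>.\<close>

lemma variation_lincomb:
  assumes v: "norm v < \<delta>" and ab: "is_variation v z a b" "is_variation v z' a' b'"
  shows "is_variation v (c *\<^sub>R z + d *\<^sub>R z') (\<lambda>t. c *\<^sub>R a t + d *\<^sub>R a' t) (\<lambda>t. c *\<^sub>R b t + d *\<^sub>R b' t)"
  unfolding is_variation_def
proof (intro conjI ballI)
  fix t :: real assume t: "t \<in> {0..1}"
  have 1: "(a has_vector_derivative b t) (at t within {0..1})" "(a' has_vector_derivative b' t) (at t within {0..1})"
    "(b has_vector_derivative - (\<Gamma>' (P v t) (a t) (V v t) (V v t) + 2 *\<^sub>R \<Gamma> (P v t) (V v t) (b t))) (at t within {0..1})"
    "(b' has_vector_derivative - (\<Gamma>' (P v t) (a' t) (V v t) (V v t) + 2 *\<^sub>R \<Gamma> (P v t) (V v t) (b' t))) (at t within {0..1})"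
    using ab t by (simp_all add: is_variation_def)
  note sc = bounded_linear.has_vector_derivative[OF bounded_linear_scaleR_right]
  show "((\<lambda>t. c *\<^sub>R a t + d *\<^sub>R a' t) has_vector_derivative c *\<^sub>R b t + d *\<^sub>R b' t) (at t within {0..1})"
    by (intro has_vector_derivative_add sc 1)
  have "((\<lambda>t. c *\<^sub>R b t + d *\<^sub>R b' t) has_vector_derivative
      c *\<^sub>R (- (\<Gamma>' (P v t) (a t) (V v t) (V v t) + 2 *\<^sub>R \<Gamma> (P v t) (V v t) (b t)))
    + d *\<^sub>R (- (\<Gamma>' (P v t) (a' t) (V v t) (V v t) + 2 *\<^sub>R \<Gamma> (P v t) (V v t) (b' t)))) (at t within {0..1})"
    by (intro has_vector_derivative_add sc 1)
  moreover have "c *\<^sub>R (- (\<Gamma>' (P v t) (a t) (V v t) (V v t) + 2 *\<^sub>R \<Gamma> (P v t) (V v t) (b t)))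
    + d *\<^sub>R (- (\<Gamma>' (P v t) (a' t) (V v t) (V v t) + 2 *\<^sub>R \<Gamma> (P v t) (V v t) (b' t))) =
    - (\<Gamma>' (P v t) (c *\<^sub>R a t + d *\<^sub>R a' t) (V v t) (V v t) + 2 *\<^sub>R \<Gamma> (P v t) (V v t) (c *\<^sub>R b t + d *\<^sub>R b' t))"
    using linear_\<Gamma>'_direction[OF PS[OF v t], of "V v t" "V v t"] bil[OF PS[OF v t]]
    by (simp add: linear_iff bilinear_def algebra_simps)
  ultimately show "((\<lambda>t. c *\<^sub>R b t + d *\<^sub>R b' t) has_vector_derivative
    - (\<Gamma>' (P v t) (c *\<^sub>R a t + d *\<^sub>R a' t) (V v t) (V v t) + 2 *\<^sub>R \<Gamma> (P v t) (V v t) (c *\<^sub>R b t + d *\<^sub>R b' t)))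
     (at t within {0..1})" by simp
qed (use ab in \<open>auto simp: is_variation_def\<close>)

lemma variation_unique:
  assumes v: "norm v < \<delta>" and ab: "is_variation v z a b" "is_variation v z a' b'" and t: "t \<in> {0..1}"
  shows "a t = a' t"
  using variation_bound(2)[OF v variation_lincomb[OF v ab, of 1 "-1"] t] by simp

text \<open>Candidate for the derivative of \<open>v \<mapsto> P v 1\<close>: the position at time
  one of the variation with initial velocity \<open>z\<close>. The choice is harmless because
  variations are unique.\<close>

definition \<Phi>' :: "'a \<Rightarrow> 'a \<Rightarrow> 'a" where
  "\<Phi>' v z = (SOME y. \<exists>a b. is_variation v z a b \<and> a 1 = y)"

lemma \<Phi>'_eq:
  assumes v: "norm v < \<delta>" and ab: "is_variation v z a b"
  shows "\<Phi>' v z = a 1"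
  unfolding \<Phi>'_def
proof (rule some_equality)
  show "\<exists>a' b'. is_variation v z a' b' \<and> a' 1 = a 1" using ab by blast
  fix y assume "\<exists>a' b'. is_variation v z a' b' \<and> a' 1 = y"
  then obtain a' b' where ab': "is_variation v z a' b'" "a' 1 = y" by blast
  then show "y = a 1" using variation_unique[OF v ab'(1) ab, of 1] by simp
qed

lemma linear_\<Phi>':
  assumes v: "norm v < \<delta>"
  shows "linear (\<Phi>' v)"
proof (rule linearI)
  have lc: "\<Phi>' v (c *\<^sub>R z + d *\<^sub>R z') = c *\<^sub>R \<Phi>' v z + d *\<^sub>R \<Phi>' v z'" for c d z z'
  proof -
    obtain a b a' b' where ab: "is_variation v z a b" "is_variation v z' a' b'"
      using variation_exists[OF v] by metis
    show ?thesis
      using \<Phi>'_eq[OF v variation_lincomb[OF v ab, of c d]] \<Phi>'_eq[OF v ab(1)] \<Phi>'_eq[OF v ab(2)] by simp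
  qed
  show "\<Phi>' v (z + z') = \<Phi>' v z + \<Phi>' v z'" for z z' using lc[of 1 z 1 z'] by simp
  show "\<Phi>' v (c *\<^sub>R z) = c *\<^sub>R \<Phi>' v z" for c z using lc[of c z 0 0] by simp
qed

text \<open>The error \<open>P w - P v - a\<close> satisfies the variation equation up to a forcing
  term quadratic in \<open>norm (w - v)\<close>, with zero initial position and velocity.\<close>

lemma flow_remainder:
  assumes v: "norm v < \<delta>" and w: "norm w < \<delta>"
  shows "norm (P w 1 - P v 1 - \<Phi>' v (w - v)) \<le> 32 * K * (norm (w - v))\<^sup>2"
proof -
  obtain a b where ab: "is_variation v (w - v) a b" using variation_exists[OF v] by blast
  define n where "n = norm (w - v)"
  let ?v = "\<lambda>t. \<Gamma>' (P v t) (a t) (V v t) (V v t) + 2 *\<^sub>R \<Gamma> (P v t) (V v t) (b t)"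
  let ?c = "\<lambda>t. - \<Gamma> (P w t) (V w t) (V w t) - - \<Gamma> (P v t) (V v t) (V v t) - - ?v t"
  let ?e = "\<lambda>t. P w t - P v t - a t" and ?f = "\<lambda>t. V w t - V v t - b t"
  have e: "(?e has_vector_derivative ?f t) (at t within {0..1})"
    "(?f has_vector_derivative ?c t) (at t within {0..1})" if t: "t \<in> {0..1}" for t
    using ab t unfolding is_variation_def
    by (intro has_vector_derivative_diff P V v w; simp)+
  \<comment> \<open>\<open>16 = 4 + 8 + 4\<close>, from \<open>R1\<close>, twice \<open>R2\<close>,
    and the term quadratic in the velocity difference; \<open>flow_lipschitz\<close> gives
    \<open>2 * n\<close> for both differences.\<close>
  have c: "norm (?c t) \<le> 3/16 * (norm (?e t) + norm (?f t)) + 16 * K * n\<^sup>2" if t: "t \<in> {0..1}" for t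
  proof -
    let ?\<Delta> = "P w t - P v t" and ?D = "V w t - V v t" and ?V = "V v t" and ?p = "P v t" and ?q = "P w t"
    note S = PS[OF v t] PS[OF w t] and Vm = V_le_m[OF v t]
    note fl = flow_lipschitz[OF v w t, folded n_def]
    \<comment> \<open>\<open>R1\<close> is the Taylor remainder in the base point, \<open>R2\<close>
      the mixed increment in base point and velocity. The two velocity cross terms merge by
      \<open>sym\<close>, which matches the factor \<open>2\<close> in the variation
      equation.\<close>
    define R1 where "R1 = \<Gamma> ?q ?V ?V - \<Gamma> ?p ?V ?V - \<Gamma>' ?p ?\<Delta> ?V ?V"
    define R2 where "R2 = \<Gamma> ?q ?V ?D - \<Gamma> ?p ?V ?D"
    have "?c t = - (R1 + 2 *\<^sub>R R2 + \<Gamma> ?q ?D ?D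
       + (\<Gamma>' ?p (?e t) ?V ?V + 2 *\<^sub>R \<Gamma> ?p ?V (?f t)))"
    proof -
      have "\<Gamma> ?q (V w t) (V w t) = \<Gamma> ?q ?V ?V + 2 *\<^sub>R \<Gamma> ?q ?V ?D + \<Gamma> ?q ?D ?D"
        using sym[OF S(2), of ?D ?V]
        by (simp add: bilinear_lsub[OF bil[OF S(2)]] bilinear_rsub[OF bil[OF S(2)]] scaleR_2 algebra_simps)
      moreover have "\<Gamma>' ?p (?e t) ?V ?V = \<Gamma>' ?p ?\<Delta> ?V ?V - \<Gamma>' ?p (a t) ?V ?V"
        by (rule linear_diff[OF linear_\<Gamma>'_direction[OF S(1)]])
      moreover have "\<Gamma> ?p ?V (?f t) = \<Gamma> ?p ?V ?D - \<Gamma> ?p ?V (b t)"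
        by (rule bilinear_rsub[OF bil[OF S(1)]])
      ultimately show ?thesis
        unfolding R1_def R2_def by (simp only: scaleR_right_diff_distrib) simp
    qed
    then have "norm (?c t) \<le> norm R1 + 2 * norm R2 + norm (\<Gamma> ?q ?D ?D)
        + norm (\<Gamma>' ?p (?e t) ?V ?V + 2 *\<^sub>R \<Gamma> ?p ?V (?f t))"
      by (simp only: norm_minus_cancel) (intro norm_triangle_le add_mono order_refl, simp)
    also have "\<dots> \<le> K * (2 * n) * (2 * n) * 1 * 1 + 2 * (K * (2 * n) * 1 * (2 * n)) + K * (2 * n) * (2 * n)
        + 3/16 * (norm (?e t) + norm (?f t))"
      unfolding R1_def R2_def
      by (intro add_mono mult_left_mono linearization lipschitz bound_le S fl variation_rhs_le v t
          order_trans[OF Vm \<delta>(2)]) auto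
    finally show ?thesis by (simp add: power2_eq_square algebra_simps)
  qed
  have "norm (?e 1) \<le> 2 * (norm (?f 0) + 16 * K * n\<^sup>2)"
    by (rule second_order_bound(2)[OF e c]) (use ab K in \<open>auto simp: P_0 v w is_variation_def\<close>)
  also have "?f 0 = 0" using ab by (simp add: V_0 v w is_variation_def)
  finally show ?thesis using \<Phi>'_eq[OF v ab] by (simp add: n_def)
qed

lemma flow_has_derivative:
  assumes v: "norm v < \<delta>"
  shows "((\<lambda>v. P v 1) has_derivative \<Phi>' v) (at v)"
  unfolding has_derivative_at_alt
proof (intro conjI allI impI)
  show "bounded_linear (\<Phi>' v)" using linear_\<Phi>'[OF v] by (rule linear_conv_bounded_linear[THEN iffD1])
  fix e :: real assume e: "e > 0"
  let ?d = "min (\<delta> - norm v) (e / (32 * K + 1))"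
  have "?d > 0" using e K v by (auto intro: divide_pos_pos add_nonneg_pos)
  moreover have "norm (P w 1 - P v 1 - \<Phi>' v (w - v)) \<le> e * norm (w - v)" if w: "norm (w - v) < ?d" for w
  proof -
    have "norm w < \<delta>" using w norm_triangle_sub[of w v] by simp
    then have "norm (P w 1 - P v 1 - \<Phi>' v (w - v)) \<le> 32 * K * (norm (w - v))\<^sup>2"
      by (rule flow_remainder[OF v])
    also have "\<dots> \<le> ((32 * K + 1) * norm (w - v)) * norm (w - v)"
      by (simp add: power2_eq_square algebra_simps)
    also have "\<dots> \<le> e * norm (w - v)"
      using w K by (intro mult_right_mono) (auto simp: field_simps less_divide_eq add_nonneg_pos)
    finally show ?thesis .
  qed
  ultimately show "\<exists>d>0. \<forall>y. norm (y - v) < d \<longrightarrow> norm (P y 1 - P v 1 - \<Phi>' v (y - v)) \<le> e * norm (y - v)"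
    by blast
qed

text \<open>To lowest order the base point is \<open>p0\<close>, the velocity \<open>v\<close> and
  the varied velocity \<open>z\<close>, so the second derivative of \<open>a\<close> is
  \<open>-2 \<Gamma> p0 v z\<close>; integrating twice over unit time gives
  \<open>z - \<Gamma> p0 v z\<close>. The rest of the proof bounds the cost of these
  replacements.\<close>

lemma \<Phi>'_expansion:
  assumes v: "norm v < \<delta>"
  shows "norm (\<Phi>' v z - z + \<Gamma> p0 v z) \<le> (6 * K * C\<^sup>2 + 4 * K\<^sup>2 * C\<^sup>2 + 12 * K\<^sup>2 * C) * (norm v)\<^sup>2 * norm z"
proof -
  obtain a b where ab: "is_variation v z a b" using variation_exists[OF v] by blast
  define n where "n = norm v"
  define k where "k = norm z"
  have nk: "0 \<le> n" "0 \<le> k" by (auto simp: n_def k_def)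
  let ?c = "\<lambda>t. - (\<Gamma>' (P v t) (a t) (V v t) (V v t) + 2 *\<^sub>R \<Gamma> (P v t) (V v t) (b t))"
  have da: "(a has_vector_derivative b t) (at t within {0..1})"
    and db: "(b has_vector_derivative ?c t) (at t within {0..1})" if "t \<in> {0..1}" for t
    using ab that by (simp_all add: is_variation_def)
  note vb = variation_bound[OF v ab, folded k_def] and Vn = V_le[OF v, folded n_def]
  have Vv: "norm (V v t - v) \<le> K * (C * n) * (C * n)" if t: "t \<in> {0..1}" for t
  proof -
    have "norm (V v t - V v 0) \<le> (K * (C * n) * (C * n)) * \<bar>t - 0\<bar>"
    proof (rule norm_diff_le_of_vector_derivative[OF V[OF v]])
      show "norm (- \<Gamma> (P v t) (V v t) (V v t)) \<le> K * (C * n) * (C * n)" if "t \<in> {0..1}" for t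
        using bound_le[OF PS[OF v that] Vn[OF that] Vn[OF that]] by simp
    qed (use t in auto)
    also have "\<dots> \<le> (K * (C * n) * (C * n)) * 1"
      using t K C nk by (intro mult_left_mono) auto
    finally show ?thesis by (simp add: V_0 v)
  qed
  have Pp: "norm (P v t - p0) \<le> C * n" if t: "t \<in> {0..1}" for t
  proof -
    have "norm (P v t - P v 0) \<le> (C * n) * \<bar>t - 0\<bar>"
      by (rule norm_diff_le_of_vector_derivative[OF P[OF v] Vn]) (use t in auto)
    also have "\<dots> \<le> (C * n) * 1" using t C nk by (intro mult_left_mono) auto
    finally show ?thesis by (simp add: P_0 v)
  qed
  \<comment> \<open>First order in \<open>n\<close> is enough here, so one of the two velocity
    factors in the \<open>\<Gamma>'\<close> term is bounded by \<open>1\<close>;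
    \<open>6 = 2 + 4\<close>.\<close>
  have bz: "norm (b t - z) \<le> 6 * K * C * n * k" if t: "t \<in> {0..1}" for t
  proof -
    have "norm (b t - b 0) \<le> (6 * K * C * n * k) * \<bar>t - 0\<bar>"
    proof (rule norm_diff_le_of_vector_derivative[OF db])
      fix t :: real assume t: "t \<in> {0..1}"
      have "norm (?c t) \<le> K * (2 * k) * 1 * (C * n) + 2 * (K * (C * n) * (2 * k))"
        using bound'_le[OF PS[OF v t] vb(2)[OF t] order_trans[OF V_le_m[OF v t] \<delta>(2)] Vn[OF t]]
          mult_left_mono[OF bound_le[OF PS[OF v t] Vn[OF t] vb(1)[OF t]], of 2]
        unfolding norm_minus_cancel by (intro norm_triangle_le add_mono) (simp_all only: norm_scaleR abs_numeral real_norm_def zero_le_numeral)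
      also have "\<dots> = 6 * K * C * n * k" by simp
      finally show "norm (?c t) \<le> 6 * K * C * n * k" .
    qed (use t in auto)
    also have "\<dots> \<le> (6 * K * C * n * k) * 1"
      using t K C nk by (intro mult_left_mono) auto
    finally show ?thesis using ab by (simp add: is_variation_def)
  qed
  define M where "M = (6 * K * C\<^sup>2 + 4 * K\<^sup>2 * C\<^sup>2 + 12 * K\<^sup>2 * C) * n\<^sup>2 * k"
  have M: "0 \<le> M" using K C nk by (simp add: M_def)
  let ?G = "\<Gamma> p0 v z"
  have dz: "norm (?c t + 2 *\<^sub>R ?G) \<le> M" if t: "t \<in> {0..1}" for t
  proof -
    let ?p = "P v t" and ?V = "V v t"
    note S = PS[OF v t]
    \<comment> \<open>\<open>T1\<close> is already of second order in \<open>n\<close>;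
      \<open>T2\<close>, \<open>T3\<close> and \<open>T4\<close> successively freeze the base point,
      the velocity and the varied velocity.\<close>
    define T1 where "T1 = \<Gamma>' ?p (a t) ?V ?V"
    define T2 where "T2 = \<Gamma> ?p ?V (b t) - \<Gamma> p0 ?V (b t)"
    define T3 where "T3 = \<Gamma> p0 (?V - v) (b t)"
    define T4 where "T4 = \<Gamma> p0 v (b t - z)"
    have "?c t + 2 *\<^sub>R ?G = - (T1 + 2 *\<^sub>R T2 + 2 *\<^sub>R T3 + 2 *\<^sub>R T4)"
      unfolding T1_def T2_def T3_def T4_def
      by (simp add: bilinear_rsub[OF bil[OF p0]] bilinear_lsub[OF bil[OF p0]] scaleR_2 algebra_simps)
    then have "norm (?c t + 2 *\<^sub>R ?G) \<le> norm T1 + 2 * norm T2 + 2 * norm T3 + 2 * norm T4"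
      by (simp only: norm_minus_cancel) (intro norm_triangle_le add_mono order_refl; simp)
    also have "\<dots> \<le> K * (2 * k) * (C * n) * (C * n) + 2 * (K * (C * n) * (C * n) * (2 * k))
       + 2 * (K * (K * (C * n) * (C * n)) * (2 * k)) + 2 * (K * n * (6 * K * C * n * k))"
      unfolding T1_def T2_def T3_def T4_def
      by (intro add_mono mult_left_mono bound'_le bound_le lipschitz S p0 vb Vn Vv Pp bz t)
         (auto simp: n_def)
    also have "\<dots> = M" by (simp add: M_def power2_eq_square algebra_simps)
    finally show ?thesis .
  qed
  define y where "y t = b t - z + (2 * t) *\<^sub>R ?G" for t
  have dy: "(y has_vector_derivative ?c t + 2 *\<^sub>R ?G) (at t within {0..1})" if "t \<in> {0..1}" for t
    unfolding y_def by (rule derivative_eq_intros db that refl | simp)+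
  have y_le: "norm (y t) \<le> M" if t: "t \<in> {0..1}" for t
  proof -
    have "norm (y t - y 0) \<le> M * \<bar>t - 0\<bar>"
      by (rule norm_diff_le_of_vector_derivative[OF dy dz]) (use t in auto)
    also have "\<dots> \<le> M * 1" using t M by (intro mult_left_mono) auto
    also have "y 0 = 0" using ab by (simp add: y_def is_variation_def)
    finally show ?thesis by simp
  qed
  \<comment> \<open>\<open>x\<close> has derivative \<open>y\<close>, vanishes at time
    \<open>0\<close>, and equals \<open>\<Phi>' v z - z + \<Gamma> p0 v z\<close> at time
    \<open>1\<close>.\<close>
  define x where "x t = a t - t *\<^sub>R z + (t\<^sup>2) *\<^sub>R ?G" for t
  have dx: "(x has_vector_derivative y t) (at t within {0..1})" if "t \<in> {0..1}" for t
  proof -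
    have "((\<lambda>t. t *\<^sub>R z) has_vector_derivative z) (at t within {0..1})"
      by (auto intro!: derivative_eq_intros)
    moreover have "((\<lambda>t. (t\<^sup>2) *\<^sub>R ?G) has_vector_derivative (2 * t) *\<^sub>R ?G) (at t within {0..1})"
      by (auto intro!: derivative_eq_intros)
    ultimately show ?thesis
      unfolding x_def y_def by (intro has_vector_derivative_add has_vector_derivative_diff da that)
  qed
  have "norm (x 1 - x 0) \<le> M * \<bar>1 - 0\<bar>"
    by (rule norm_diff_le_of_vector_derivative[OF dx y_le]) auto
  then show ?thesis using ab \<Phi>'_eq[OF v ab] by (simp add: x_def M_def n_def k_def is_variation_def)
qed

lemma \<Phi>'_0: "\<Phi>' 0 z = z"
proof -
  have "norm (\<Phi>' 0 z - z + \<Gamma> p0 0 z) \<le> 0" using \<Phi>'_expansion[of 0 z] \<delta>(1) by simp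
  then show ?thesis by (simp add: bilinear_lzero[OF bil[OF p0]])
qed

text \<open>The second derivative of the time-one map, at the origin only: the error in
  \<open>\<Phi>'_expansion\<close> is quadratic in \<open>v\<close>.\<close>

lemma \<Phi>'_has_derivative_0: "((\<lambda>v. \<Phi>' v z) has_derivative (\<lambda>u. - \<Gamma> p0 u z)) (at 0)"
  unfolding has_derivative_at_alt
proof (intro conjI allI impI)
  show "bounded_linear (\<lambda>u. - \<Gamma> p0 u z)"
    using bil[OF p0] by (intro bounded_linear_minus) (simp add: bilinear_def linear_conv_bounded_linear)
  define M where "M = (6 * K * C\<^sup>2 + 4 * K\<^sup>2 * C\<^sup>2 + 12 * K\<^sup>2 * C) * norm z"
  have M: "0 \<le> M" using K C by (simp add: M_def)
  fix e :: real assume e: "e > 0"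
  let ?d = "min \<delta> (e / (M + 1))"
  have "?d > 0" using e M \<delta> by (auto intro: divide_pos_pos add_nonneg_pos)
  moreover have "norm (\<Phi>' v z - \<Phi>' 0 z - - \<Gamma> p0 (v - 0) z) \<le> e * norm (v - 0)" if v: "norm (v - 0) < ?d" for v
  proof -
    have "norm (\<Phi>' v z - z + \<Gamma> p0 v z) \<le> (M * norm v) * norm v"
      using \<Phi>'_expansion[of v z] v by (simp add: M_def power2_eq_square mult_ac)
    also have "\<dots> \<le> ((M + 1) * norm v) * norm v" by (intro mult_right_mono) auto
    also have "\<dots> \<le> e * norm v"
      using v M by (intro mult_right_mono) (auto simp: field_simps less_divide_eq add_nonneg_pos)
    finally show ?thesis by (simp add: \<Phi>'_0)
  qed
  ultimately show "\<exists>d>0. \<forall>v. norm (v - 0) < d \<longrightarrow> norm (\<Phi>' v z - \<Phi>' 0 z - - \<Gamma> p0 (v - 0) z) \<le> e * norm (v - 0)"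
    by blast
qed

end

section \<open>Charts, metric and Christoffel symbols\<close>

locale riemannian =
  fixes M :: "('m::{t2_space,second_countable_topology}, 'e::euclidean_space) riem"
  assumes riemannian: "riemannian_manifold M"
begin

lemma smooth_atlas: "smooth_atlas (atlas M)"
  using riemannian by (simp add: riemannian_manifold_def)

lemma
  assumes "c \<in> atlas M"
  shows open_chart: "open (fst c)" and open_coords: "open (snd c ` fst c)"
    and continuous_on_chart: "continuous_on (fst c) (snd c)"
    and continuous_on_chart_inv: "continuous_on (snd c ` fst c) (chart_inv c)"
    and chart_inv_chart: "\<And>x. x \<in> fst c \<Longrightarrow> chart_inv c (snd c x) = x"
  using assms smooth_atlas by (auto simp: smooth_atlas_def homeomorphism_def)

lemma chart_inv_mem:
  assumes "c \<in> atlas M" "p \<in> snd c ` fst c"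
  shows "chart_inv c p \<in> fst c" "snd c (chart_inv c p) = p"
  using assms chart_inv_chart[OF assms(1)] by auto

lemma chart_at: "chart_at M x \<in> atlas M" "x \<in> fst (chart_at M x)"
proof -
  have "\<exists>c. c \<in> atlas M \<and> x \<in> fst c" using smooth_atlas unfolding smooth_atlas_def by blast
  then have "chart_at M x \<in> atlas M \<and> x \<in> fst (chart_at M x)"
    unfolding chart_at_def by (rule someI_ex)
  then show "chart_at M x \<in> atlas M" "x \<in> fst (chart_at M x)" by auto
qed

lemma open_chart_image:
  assumes "c \<in> atlas M" "open W" "W \<subseteq> fst c"
  shows "open (snd c ` W)"
proof -
  have "snd c ` W = (snd c ` fst c) \<inter> chart_inv c -` W"
    using assms(3) chart_inv_chart[OF assms(1)] by (auto simp: image_iff)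
  then show ?thesis
    using continuous_on_chart_inv[OF assms(1)] open_coords[OF assms(1)] assms(2)
    by (metis continuous_on_open_vimage inf_commute)
qed

abbreviation overlap :: "('m, 'e) chart \<Rightarrow> ('m, 'e) chart \<Rightarrow> 'e set" where
  "overlap c d \<equiv> snd c ` (fst c \<inter> fst d)"

lemma open_overlap: "c \<in> atlas M \<Longrightarrow> d \<in> atlas M \<Longrightarrow> open (overlap c d)"
  by (intro open_chart_image open_Int open_chart) auto

lemma transition_chart: "c \<in> atlas M \<Longrightarrow> x \<in> fst c \<Longrightarrow> transition c d (snd c x) = snd d x"
  by (simp add: transition_def chart_inv_chart)

definition DT :: "('m, 'e) chart \<Rightarrow> ('m, 'e) chart \<Rightarrow> 'e \<Rightarrow> 'e \<Rightarrow> 'e" where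
  "DT c d p = frechet_derivative (transition c d) (at p)"

text \<open>\<open>u\<close> is fed to the Jacobian; the argument after it is the direction of
  differentiation.\<close>

definition D2T :: "('m, 'e) chart \<Rightarrow> ('m, 'e) chart \<Rightarrow> 'e \<Rightarrow> 'e \<Rightarrow> 'e \<Rightarrow> 'e" where
  "D2T c d p u = frechet_derivative (\<lambda>q. DT c d q u) (at p)"

context
  fixes c d :: "('m, 'e) chart"
  assumes cd: "c \<in> atlas M" "d \<in> atlas M"
begin

lemma Cn_on_transition: "Cn_on n (overlap c d) (transition c d)"
  using smooth_atlas cd by (auto simp: smooth_atlas_def smooth_on_def)

lemma DT: "p \<in> overlap c d \<Longrightarrow> (transition c d has_derivative DT c d p) (at p)"
  unfolding DT_def by (rule Cn_on_Suc_has_derivative[OF Cn_on_transition[of "Suc 0"]])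

lemma linear_DT: "p \<in> overlap c d \<Longrightarrow> linear (DT c d p)"
  by (rule has_derivative_linear[OF DT])

lemma D2T: "p \<in> overlap c d \<Longrightarrow> ((\<lambda>q. DT c d q u) has_derivative D2T c d p u) (at p)"
  unfolding D2T_def DT_def
  by (rule Cn_on_Suc_has_derivative[of 0])
     (use Cn_on_transition[of "Suc (Suc 0)"] in \<open>simp_all only: Cn_on.simps(2)[of "Suc 0"]\<close>)

lemma D2T_sym:
  assumes p: "p \<in> overlap c d"
  shows "D2T c d p u v = D2T c d p v u"
proof (rule second_derivative_symmetric[OF _ D2T[OF p] D2T[OF p]])
  show "\<forall>\<^sub>F y in nhds p. (transition c d has_derivative DT c d y) (at y)"
    using open_overlap[OF cd] p DT eventually_nhds by blast
qed

end

text \<open>The chain rule on a triple overlap. Taking the preferred chart as one of the three gives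
  the composition rules for \<open>to_chart\<close> and \<open>of_chart\<close>.\<close>

lemma DT_cocycle:
  assumes "c \<in> atlas M" "d \<in> atlas M" "e \<in> atlas M" "x \<in> fst c" "x \<in> fst d" "x \<in> fst e"
  shows "DT d e (snd d x) (DT c d (snd c x) v) = DT c e (snd c x) v"
proof -
  have p: "snd c x \<in> overlap c d" "snd d x \<in> overlap d e" "snd c x \<in> overlap c e" using assms by auto
  have t: "transition c d (snd c x) = snd d x" using assms by (simp add: transition_chart)
  have "((\<lambda>q. transition d e (transition c d q)) has_derivative
      (\<lambda>v. DT d e (snd d x) (DT c d (snd c x) v))) (at (snd c x))"
    using has_derivative_compose[OF DT[OF assms(1,2) p(1)], of "transition d e"] DT[OF assms(2,3) p(2)]
    by (simp add: t)
  then have "(transition c e has_derivative (\<lambda>v. DT d e (snd d x) (DT c d (snd c x) v))) (at (snd c x))"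
  proof (rule has_derivative_transform_within_open)
    show "open (snd c ` (fst c \<inter> fst d \<inter> fst e))"
      using assms by (intro open_chart_image open_Int open_chart) auto
    show "snd c x \<in> snd c ` (fst c \<inter> fst d \<inter> fst e)" using assms by auto
    show "transition d e (transition c d q) = transition c e q" if "q \<in> snd c ` (fst c \<inter> fst d \<inter> fst e)" for q
      using that assms by (auto simp: transition_chart)
  qed
  from has_derivative_unique[OF this DT[OF assms(1,3) p(3)]] show ?thesis by metis
qed

lemma DT_self:
  assumes "c \<in> atlas M" "x \<in> fst c"
  shows "DT c c (snd c x) v = v"
proof -
  have p: "snd c x \<in> overlap c c" using assms by auto
  have "(transition c c has_derivative (\<lambda>v. v)) (at (snd c x))"
    by (rule has_derivative_transform_within_open[OF has_derivative_ident open_overlap[OF assms(1,1)] p])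
       (use assms in \<open>auto simp: transition_chart\<close>)
  from has_derivative_unique[OF this DT[OF assms(1,1) p]] show ?thesis by metis
qed

lemma to_chart_DT: "to_chart M c x v = DT (chart_at M x) c (snd (chart_at M x) x) v"
  by (simp add: to_chart_def DT_def)

lemma of_chart_DT: "of_chart M c x v = DT c (chart_at M x) (snd c x) v"
  by (simp add: of_chart_def DT_def)

lemma DT_to_chart:
  assumes "c \<in> atlas M" "d \<in> atlas M" "x \<in> fst c" "x \<in> fst d"
  shows "DT c d (snd c x) (to_chart M c x v) = to_chart M d x v"
  using assms chart_at[of x] by (simp add: to_chart_DT DT_cocycle)

lemma to_chart_self: "to_chart M (chart_at M x) x v = v"
  using chart_at[of x] by (simp add: to_chart_DT DT_self)

lemma
  assumes "c \<in> atlas M" "x \<in> fst c"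
  shows of_chart_to_chart: "of_chart M c x (to_chart M c x v) = v"
    and to_chart_of_chart: "to_chart M c x (of_chart M c x v) = v"
    and linear_to_chart: "linear (to_chart M c x)" and linear_of_chart: "linear (of_chart M c x)"
    and of_chart_DT_eq: "d \<in> atlas M \<Longrightarrow> x \<in> fst d \<Longrightarrow> of_chart M d x (DT c d (snd c x) v) = of_chart M c x v"
proof -
  have p: "snd c x \<in> overlap c (chart_at M x)" "snd (chart_at M x) x \<in> overlap (chart_at M x) c"
    using assms chart_at[of x] by auto
  show "of_chart M c x (to_chart M c x v) = v" "to_chart M c x (of_chart M c x v) = v"
    using assms chart_at[of x] by (simp_all add: to_chart_DT of_chart_DT DT_cocycle DT_self)
  show "linear (to_chart M c x)" "linear (of_chart M c x)"
    using linear_DT[OF chart_at(1) assms(1) p(2)] linear_DT[OF assms(1) chart_at(1) p(1)]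
    by (simp_all add: to_chart_DT of_chart_DT linear_iff)
  show "of_chart M d x (DT c d (snd c x) v) = of_chart M c x v" if "d \<in> atlas M" "x \<in> fst d"
    using that assms chart_at[of x] by (simp add: of_chart_DT DT_cocycle)
qed

lemma bilinear_metric: "bilinear (metric M x)"
  and metric_sym: "metric M x u v = metric M x v u"
  and metric_pos: "u \<noteq> 0 \<Longrightarrow> metric M x u u > 0"
  using riemannian by (auto simp: riemannian_manifold_def)

abbreviation g :: "('m, 'e) chart \<Rightarrow> 'e \<Rightarrow> 'e \<Rightarrow> 'e \<Rightarrow> real" where
  "g \<equiv> metric_in_chart M"

definition dg :: "('m, 'e) chart \<Rightarrow> 'e \<Rightarrow> 'e \<Rightarrow> 'e \<Rightarrow> 'e \<Rightarrow> real" where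
  "dg c p u v = frechet_derivative (\<lambda>q. g c q u v) (at p)"

text \<open>\<open>Chr c p u v\<close> is the contraction of the Christoffel symbols of the chart \<open>c\<close> with \<open>u\<close> and \<open>v\<close>.\<close>

definition Chr :: "('m, 'e) chart \<Rightarrow> 'e \<Rightarrow> 'e \<Rightarrow> 'e \<Rightarrow> 'e" where
  "Chr c p u v = (THE w. \<forall>z. g c p w z = (dg c p v z u + dg c p u z v - dg c p u v z) / 2)"

lemma g_chart: "c \<in> atlas M \<Longrightarrow> x \<in> fst c \<Longrightarrow> g c (snd c x) u v = metric M x (of_chart M c x u) (of_chart M c x v)"
  by (simp add: metric_in_chart_def chart_inv_chart)

lemma g_to_chart:
  "c \<in> atlas M \<Longrightarrow> x \<in> fst c \<Longrightarrow> g c (snd c x) (to_chart M c x u) (to_chart M c x v) = metric M x u v"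
  by (simp add: g_chart of_chart_to_chart)

lemma g_chart_at: "g (chart_at M x) (snd (chart_at M x) x) u v = metric M x u v"
  using g_to_chart[OF chart_at, of x u v] by (simp add: to_chart_self)

lemma g_DT:
  assumes "c \<in> atlas M" "d \<in> atlas M" "x \<in> fst c" "x \<in> fst d"
  shows "g d (snd d x) (DT c d (snd c x) u) (DT c d (snd c x) v) = g c (snd c x) u v"
  using assms by (simp add: g_chart of_chart_DT_eq)

context
  fixes c :: "('m, 'e) chart" and p :: 'e
  assumes c: "c \<in> atlas M" and p: "p \<in> snd c ` fst c"
begin

lemma bilinear_g: "bilinear (g c p)"
  using linear_of_chart[OF c chart_inv_mem(1)[OF c p]] bilinear_metric
  unfolding metric_in_chart_def bilinear_def linear_iff by simp

lemma g_sym: "g c p u v = g c p v u"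
  by (simp add: metric_in_chart_def metric_sym)

lemma g_pos:
  assumes "u \<noteq> 0"
  shows "g c p u u > 0"
proof -
  have "of_chart M c (chart_inv c p) u \<noteq> 0"
    using to_chart_of_chart[OF c chart_inv_mem(1)[OF c p], of u] assms
      linear_0[OF linear_to_chart[OF c chart_inv_mem(1)[OF c p]]] by metis
  then show ?thesis unfolding metric_in_chart_def by (rule metric_pos)
qed

end

context
  fixes c :: "('m, 'e) chart"
  assumes c: "c \<in> atlas M"
begin

lemma Cn_on_g: "Cn_on n (snd c ` fst c) (\<lambda>p. g c p u v)"
  using riemannian c by (simp add: riemannian_manifold_def smooth_on_def)

lemma dg: "p \<in> snd c ` fst c \<Longrightarrow> ((\<lambda>q. g c q u v) has_derivative dg c p u v) (at p)"
  unfolding dg_def by (rule Cn_on_Suc_has_derivative[OF Cn_on_g[of "Suc 0"]])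

lemma Cn_on_dg: "Cn_on n (snd c ` fst c) (\<lambda>p. dg c p u v h)"
  using Cn_on_g[of "Suc n" u v] by (simp add: dg_def)

lemma dg_expand:
  "p \<in> snd c ` fst c \<Longrightarrow> dg c p u v h = (\<Sum>i\<in>Basis. \<Sum>j\<in>Basis. ((u \<bullet> i) * (v \<bullet> j)) *\<^sub>R dg c p i j h)"
  by (rule bilinear_family_derivative_expand[of "snd c ` fst c" p "g c"])
     (auto intro: open_coords[OF c] bilinear_g[OF c] dg)

lemma dg_linear:
  assumes p: "p \<in> snd c ` fst c"
  shows "linear (\<lambda>u. dg c p u v h)" "linear (\<lambda>v. dg c p u v h)" "linear (\<lambda>h. dg c p u v h)"
proof -
  show "linear (\<lambda>h. dg c p u v h)" using has_derivative_linear[OF dg[OF p]] .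
  show "linear (\<lambda>u. dg c p u v h)" "linear (\<lambda>v. dg c p u v h)"
    by (subst dg_expand[OF p], simp add: linear_iff sum.distrib sum_distrib_left algebra_simps)+
qed

lemma dg_sym:
  assumes p: "p \<in> snd c ` fst c"
  shows "dg c p u v h = dg c p v u h"
proof -
  have "((\<lambda>q. g c q u v) has_derivative dg c p v u) (at p)"
    by (rule has_derivative_transform_within_open[OF dg[OF p] open_coords[OF c] p])
       (rule g_sym[OF c])
  from has_derivative_unique[OF this dg[OF p]] show ?thesis by metis
qed

text \<open>The right-hand side, the Koszul formula for coordinate fields, is linear in
  \<open>z\<close> and hence represented by a unique vector.\<close>

lemma Chr_spec:
  assumes p: "p \<in> snd c ` fst c"
  shows "g c p (Chr c p u v) z = (dg c p v z u + dg c p u z v - dg c p u v z) / 2"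
proof -
  have "linear (\<lambda>z. (dg c p v z u + dg c p u z v - dg c p u v z) / 2)"
    using dg_linear[OF p] by (simp add: linear_iff algebra_simps add_divide_distrib diff_divide_distrib)
  from theI'[OF pos_def_represent[OF bilinear_g[OF c p] g_pos[OF c p] this]]
  show ?thesis unfolding Chr_def by blast
qed

lemma Chr_sym:
  assumes p: "p \<in> snd c ` fst c"
  shows "Chr c p u v = Chr c p v u"
  by (rule pos_def_cancel[OF bilinear_g[OF c p] g_pos[OF c p]])
     (auto simp: Chr_spec[OF p] dg_sym[OF p, of u v])

lemma bilinear_Chr:
  assumes p: "p \<in> snd c ` fst c"
  shows "bilinear (Chr c p)"
proof -
  note cancel = pos_def_cancel[OF bilinear_g[OF c p] g_pos[OF c p]]
  have 1: "Chr c p (u + u') v = Chr c p u v + Chr c p u' v" for u u' v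
    by (rule cancel)
       (auto simp: Chr_spec[OF p] bilinear_ladd[OF bilinear_g[OF c p]] dg_linear[OF p, THEN linear_add] field_simps)
  have 2: "Chr c p (r *\<^sub>R u) v = r *\<^sub>R Chr c p u v" for r u v
    by (rule cancel)
       (auto simp: Chr_spec[OF p] bilinear_lmul[OF bilinear_g[OF c p]] dg_linear[OF p, THEN linear_scale] field_simps)
  show ?thesis
    unfolding bilinear_def linear_iff
    using 1 2 by (simp add: Chr_sym[OF p, of _ "_ + _"] Chr_sym[OF p, of _ "_ *\<^sub>R _"])
       (metis Chr_sym[OF p])
qed

text \<open>In the sum of the two Koszul expressions everything but one derivative of the metric
  cancels, by symmetry of \<open>dg\<close> in its two vectors.\<close>

lemma metric_compatible:
  assumes p: "p \<in> snd c ` fst c"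
  shows "dg c p u v h = g c p (Chr c p h u) v + g c p u (Chr c p h v)"
  unfolding g_sym[OF c p, of u] Chr_spec[OF p]
  using dg_sym[OF p, of u v h] dg_sym[OF p, of u h v] dg_sym[OF p, of v h u] by (simp add: field_simps)

text \<open>The Christoffel form is defined implicitly through the metric, and its inner products
  are combinations of smooth derivatives of the metric.\<close>

lemma Cn_on_Chr: "Cn_on n (snd c ` fst c) (\<lambda>p. Chr c p u v)"
proof (rule pos_def_Cn_on[of _ "g c"])
  note S = open_coords[OF c]
  show "Cn_on n (snd c ` fst c) (\<lambda>p. g c p (Chr c p u v) z)" for z
  proof (rule Cn_on_cong[OF S])
    show "Cn_on n (snd c ` fst c) (\<lambda>p. (1/2) * (dg c p v z u + dg c p u z v - dg c p u v z))"
      by (intro Cn_on_mult[OF S] Cn_on_const[OF S] Cn_on_diff[OF S] Cn_on_add[OF S] Cn_on_dg)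
  qed (simp add: Chr_spec)
qed (auto intro: open_coords[OF c] bilinear_g[OF c] g_pos[OF c] Cn_on_g)

end

lemma christoffel_Chr: "christoffel M x u v = Chr (chart_at M x) (snd (chart_at M x) x) u v"
  unfolding christoffel_def Chr_def metric_deriv_def dg_def g_chart_at ..

text \<open>The relation between the metrics of the two charts is differentiated and inserted into
  the Koszul formula; by symmetry of second derivatives the terms with \<open>D2T\<close> combine to
  a single one, the inhomogeneous part of the law.\<close>

lemma Chr_transform:
  assumes c: "c \<in> atlas M" and d: "d \<in> atlas M" and x: "x \<in> fst c" "x \<in> fst d"
  defines "p \<equiv> snd c x" and "q \<equiv> snd d x"
  shows "DT c d p (Chr c p u v) = Chr d q (DT c d p u) (DT c d p v) + D2T c d p u v"
proof -
  have p: "p \<in> overlap c d" "p \<in> snd c ` fst c" and q: "q \<in> snd d ` fst d"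
    using x by (auto simp: p_def q_def)
  have t: "transition c d p = q" using c x by (simp add: p_def q_def transition_chart)
  let ?D = "DT c d p" and ?E = "D2T c d p"
  have dg_tr: "dg c p u v h = dg d q (?D u) (?D v) (?D h) + g d q (?E u h) (?D v) + g d q (?D u) (?E v h)" for u v h
  proof -
    have "((\<lambda>y. g d (transition c d y) (DT c d y u) (DT c d y v)) has_derivative
      (\<lambda>h. dg d (transition c d p) (DT c d p u) (DT c d p v) (DT c d p h)
        + g d (transition c d p) (D2T c d p u h) (DT c d p v)
        + g d (transition c d p) (DT c d p u) (D2T c d p v h))) (at p)"
      by (rule bilinear_family_has_derivative[OF open_coords[OF d] _ UNIV_I bilinear_g[OF d]])
         (use q in \<open>simp_all add: t dg[OF d] DT[OF c d p(1)] D2T[OF c d p(1)]\<close>)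
    then have "((\<lambda>y. g c y u v) has_derivative
      (\<lambda>h. dg d q (?D u) (?D v) (?D h) + g d q (?E u h) (?D v) + g d q (?D u) (?E v h))) (at p)"
      unfolding t
    proof (rule has_derivative_transform_within_open[OF _ open_overlap[OF c d] p(1)])
      fix y assume "y \<in> overlap c d"
      then obtain x' where "y = snd c x'" "x' \<in> fst c" "x' \<in> fst d" by auto
      then show "g d (transition c d y) (DT c d y u) (DT c d y v) = g c y u v"
        using g_DT[OF c d, of x'] c by (simp add: transition_chart)
    qed
    from has_derivative_unique[OF dg[OF c p(2)] this] show ?thesis by metis
  qed
  note bil = bilinear_g[OF d q]
  show ?thesis
  proof (rule pos_def_cancel[OF bil g_pos[OF d q]])
    fix z
    \<comment> \<open>The two Jacobians are inverse to each other, so every test vector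
      \<open>z\<close> is the image of some \<open>z'\<close> and the comparison can be pulled back
      to \<open>c\<close>.\<close>
    define z' where "z' = DT d c q z"
    have z: "z = ?D z'"
      using DT_cocycle[OF d c d x(2,1,2)] DT_self[OF d x(2)] by (simp add: z'_def p_def q_def)
    have "g d q (?D (Chr c p u v)) (?D z') = g c p (Chr c p u v) z'"
      unfolding p_def q_def by (rule g_DT[OF c d x])
    also have "\<dots> = (dg c p v z' u + dg c p u z' v - dg c p u v z') / 2" by (rule Chr_spec[OF c p(2)])
    also have "\<dots> = g d q (Chr d q (?D u) (?D v)) (?D z') + g d q (?E u v) (?D z')"
      unfolding dg_tr Chr_spec[OF d q]
      using D2T_sym[OF c d p(1), of u v] D2T_sym[OF c d p(1), of z' u] D2T_sym[OF c d p(1), of z' v]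
        g_sym[OF d q, of "?D v"] g_sym[OF d q, of "?D u"]
      by (simp add: field_simps)
    finally show "g d q (?D (Chr c p u v)) z = g d q (Chr d q (?D u) (?D v) + ?E u v) z"
      by (simp add: z bilinear_ladd[OF bil])
  qed
qed

section \<open>Covariant derivatives and geodesics\<close>

lemma open_curve_preimage: "differentiable_curve M \<gamma> \<Longrightarrow> open W \<Longrightarrow> open (\<gamma> -` W)"
  by (simp add: differentiable_curve_def open_vimage continuous_on_eq_continuous_at)

lemma eventually_curve_in:
  assumes "differentiable_curve M \<gamma>" "open W" "\<gamma> t \<in> W"
  shows "\<forall>\<^sub>F \<tau> in nhds t. \<gamma> \<tau> \<in> W"
  using open_curve_preimage[OF assms(1,2)] assms(3) unfolding eventually_nhds by blast

lemma velocity_chart_at: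
  assumes "differentiable_curve M \<gamma>"
  shows "((\<lambda>\<tau>. snd (chart_at M (\<gamma> t)) (\<gamma> \<tau>)) has_vector_derivative velocity M \<gamma> t) (at t)"
  using assms vector_derivative_works unfolding velocity_def differentiable_curve_def by blast

text \<open>Chain rule from the preferred chart at the point, in which the velocity is defined, to a
  chart that stays fixed in time.\<close>

lemma curve_coords_derivative:
  assumes \<gamma>: "differentiable_curve M \<gamma>" and c: "c \<in> atlas M" "\<gamma> t \<in> fst c"
  shows "((\<lambda>\<tau>. snd c (\<gamma> \<tau>)) has_vector_derivative to_chart M c (\<gamma> t) (velocity M \<gamma> t)) (at t)"
proof -
  define d where "d = chart_at M (\<gamma> t)"
  have d: "d \<in> atlas M" "\<gamma> t \<in> fst d" using chart_at by (auto simp: d_def)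
  have p: "snd d (\<gamma> t) \<in> overlap d c" using d c by auto
  have "((\<lambda>\<tau>. transition d c (snd d (\<gamma> \<tau>))) has_derivative (\<lambda>h. DT d c (snd d (\<gamma> t)) (h *\<^sub>R velocity M \<gamma> t))) (at t)"
    using velocity_chart_at[OF \<gamma>, of t] unfolding has_vector_derivative_def d_def[symmetric]
    by (rule has_derivative_compose[where f="\<lambda>\<tau>. snd d (\<gamma> \<tau>)", OF _ DT[OF d(1) c(1) p]])
  then have "((\<lambda>\<tau>. transition d c (snd d (\<gamma> \<tau>))) has_vector_derivative to_chart M c (\<gamma> t) (velocity M \<gamma> t)) (at t)"
    unfolding has_vector_derivative_def to_chart_DT d_def[symmetric] linear_scale[OF linear_DT[OF d(1) c(1) p]] .
  then show ?thesis
    by (rule has_vector_derivative_transform_within_open[OF _ open_curve_preimage[OF \<gamma> open_Int[OF open_chart[OF c(1)] open_chart[OF d(1)]]]])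
       (use c d in \<open>auto simp: transition_chart\<close>)
qed

text \<open>\<open>has_cov_deriv\<close> works in the preferred chart at \<open>\<gamma> t\<close>, which may jump with \<open>t\<close>;
  \<open>cov_deriv_in\<close> works in one fixed chart.\<close>

definition cov_deriv_in ::
  "('m, 'e) chart \<Rightarrow> (real \<Rightarrow> 'm) \<Rightarrow> (real \<Rightarrow> 'e) \<Rightarrow> 'e \<Rightarrow> real \<Rightarrow> real set \<Rightarrow> bool" where
  "cov_deriv_in c \<gamma> V D t T \<longleftrightarrow> ((\<lambda>\<tau>. to_chart M c (\<gamma> \<tau>) (V \<tau>)) has_vector_derivative
     to_chart M c (\<gamma> t) D - Chr c (snd c (\<gamma> t)) (to_chart M c (\<gamma> t) (velocity M \<gamma> t)) (to_chart M c (\<gamma> t) (V t)))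
     (at t within T)"

text \<open>Differentiating the Jacobian along the curve produces a \<open>D2T\<close> term, which
  the inhomogeneous term of \<open>Chr_transform\<close> cancels.\<close>

lemma cov_deriv_in_change:
  assumes \<gamma>: "differentiable_curve M \<gamma>" and c: "c \<in> atlas M" "\<gamma> t \<in> fst c" and d: "d \<in> atlas M" "\<gamma> t \<in> fst d"
    and t: "t \<in> T" and cov: "cov_deriv_in c \<gamma> V D t T"
  shows "cov_deriv_in d \<gamma> V D t T"
proof -
  let ?p = "\<lambda>\<tau>. snd c (\<gamma> \<tau>)" and ?v = "\<lambda>\<tau>. to_chart M c (\<gamma> \<tau>) (V \<tau>)"
  let ?x = "to_chart M c (\<gamma> t) (velocity M \<gamma> t)"
  let ?w = "to_chart M c (\<gamma> t) D - Chr c (?p t) ?x (?v t)"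
  have p: "?p t \<in> overlap c d" using c d by auto
  have dp: "(?p has_derivative (\<lambda>h. h *\<^sub>R ?x)) (at t within T)"
    using has_vector_derivative_at_within[OF curve_coords_derivative[OF \<gamma> c]] by (simp add: has_vector_derivative_def)
  have dv: "(?v has_derivative (\<lambda>h. h *\<^sub>R ?w)) (at t within T)"
    using cov by (simp add: cov_deriv_in_def has_vector_derivative_def)
  have "((\<lambda>\<tau>. DT c d (?p \<tau>) (?v \<tau>)) has_derivative
     (\<lambda>h. D2T c d (?p t) (?v t) (h *\<^sub>R ?x) + DT c d (?p t) (h *\<^sub>R ?w))) (at t within T)"
    by (rule linear_family_has_derivative[where p="?p" and L="DT c d" and v="?v", OF open_overlap[OF c(1) d(1)] p t linear_DT[OF c(1) d(1)] D2T[OF c(1) d(1) p] dp dv])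
  also have "(\<lambda>h. D2T c d (?p t) (?v t) (h *\<^sub>R ?x) + DT c d (?p t) (h *\<^sub>R ?w)) =
     (\<lambda>h. h *\<^sub>R (D2T c d (?p t) (?v t) ?x + DT c d (?p t) ?w))"
    using has_derivative_linear[OF D2T[OF c(1) d(1) p]] linear_DT[OF c(1) d(1) p]
    by (simp add: linear_scale scaleR_add_right)
  also have "D2T c d (?p t) (?v t) ?x + DT c d (?p t) ?w = to_chart M d (\<gamma> t) D
     - Chr d (snd d (\<gamma> t)) (to_chart M d (\<gamma> t) (velocity M \<gamma> t)) (to_chart M d (\<gamma> t) (V t))"
    using Chr_transform[OF c(1) d(1) c(2) d(2), of ?x "?v t"] D2T_sym[OF c(1) d(1) p, of ?x "?v t"]
    by (simp add: linear_diff[OF linear_DT[OF c(1) d(1) p]] DT_to_chart c d)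
  finally have "((\<lambda>\<tau>. DT c d (?p \<tau>) (?v \<tau>)) has_vector_derivative to_chart M d (\<gamma> t) D
     - Chr d (snd d (\<gamma> t)) (to_chart M d (\<gamma> t) (velocity M \<gamma> t)) (to_chart M d (\<gamma> t) (V t))) (at t within T)"
    by (simp add: has_vector_derivative_def)
  then show ?thesis
    unfolding cov_deriv_in_def has_vector_derivative_def
  proof (rule has_derivative_transform_eventually)
    have "\<forall>\<^sub>F \<tau> in nhds t. \<gamma> \<tau> \<in> fst c \<inter> fst d"
      using c d by (intro eventually_curve_in[OF \<gamma>] open_Int open_chart) auto
    then have "\<forall>\<^sub>F \<tau> in at t within T. \<gamma> \<tau> \<in> fst c \<inter> fst d"
      unfolding eventually_at_filter by (rule eventually_mono) simp
    then show "\<forall>\<^sub>F \<tau> in at t within T. DT c d (?p \<tau>) (?v \<tau>) = to_chart M d (\<gamma> \<tau>) (V \<tau>)"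
      by eventually_elim (simp add: DT_to_chart c d)
  qed (use t c d in \<open>simp_all add: DT_to_chart\<close>)
qed

lemma has_cov_deriv_iff:
  assumes \<gamma>: "differentiable_curve M \<gamma>" and c: "c \<in> atlas M" "\<gamma> t \<in> fst c" and t: "t \<in> T"
  shows "has_cov_deriv M \<gamma> V D t T \<longleftrightarrow> cov_deriv_in c \<gamma> V D t T"
proof -
  have "has_cov_deriv M \<gamma> V D t T \<longleftrightarrow> cov_deriv_in (chart_at M (\<gamma> t)) \<gamma> V D t T"
    by (simp add: has_cov_deriv_def cov_deriv_in_def to_chart_self christoffel_Chr)
  then show ?thesis
    using cov_deriv_in_change[OF \<gamma> c chart_at t] cov_deriv_in_change[OF \<gamma> chart_at c t] by blast
qed

text \<open>Metric compatibility along a curve. It gives both the constant speed of geodesics and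
  the isometry property of parallel transport.\<close>

lemma metric_parallel_derivative:
  assumes \<gamma>: "differentiable_curve M \<gamma>" and t: "t \<in> T"
    and V: "has_cov_deriv M \<gamma> V 0 t T" and W: "has_cov_deriv M \<gamma> W 0 t T"
  shows "((\<lambda>\<tau>. metric M (\<gamma> \<tau>) (V \<tau>) (W \<tau>)) has_derivative (\<lambda>h. 0)) (at t within T)"
proof -
  define c where "c = chart_at M (\<gamma> t)"
  have c: "c \<in> atlas M" "\<gamma> t \<in> fst c" using chart_at by (auto simp: c_def)
  let ?p = "\<lambda>\<tau>. snd c (\<gamma> \<tau>)" and ?v = "\<lambda>\<tau>. to_chart M c (\<gamma> \<tau>) (V \<tau>)" and ?w = "\<lambda>\<tau>. to_chart M c (\<gamma> \<tau>) (W \<tau>)"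
  let ?x = "to_chart M c (\<gamma> t) (velocity M \<gamma> t)"
  have p: "?p t \<in> snd c ` fst c" using c by auto
  have z: "to_chart M c (\<gamma> t) 0 = 0" by (rule linear_0[OF linear_to_chart[OF c]])
  have dp: "(?p has_derivative (\<lambda>h. h *\<^sub>R ?x)) (at t within T)"
    using has_vector_derivative_at_within[OF curve_coords_derivative[OF \<gamma> c]] by (simp add: has_vector_derivative_def)
  have dv: "(?v has_derivative (\<lambda>h. h *\<^sub>R - Chr c (?p t) ?x (?v t))) (at t within T)"
    "(?w has_derivative (\<lambda>h. h *\<^sub>R - Chr c (?p t) ?x (?w t))) (at t within T)"
    using V W unfolding has_cov_deriv_iff[OF \<gamma> c t] by (simp_all add: cov_deriv_in_def has_vector_derivative_def z)
  have "((\<lambda>\<tau>. g c (?p \<tau>) (?v \<tau>) (?w \<tau>)) has_derivative (\<lambda>h. dg c (?p t) (?v t) (?w t) (h *\<^sub>R ?x)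
     + g c (?p t) (h *\<^sub>R - Chr c (?p t) ?x (?v t)) (?w t) + g c (?p t) (?v t) (h *\<^sub>R - Chr c (?p t) ?x (?w t)))) (at t within T)"
    by (rule bilinear_family_has_derivative[where p="?p" and B="g c" and v="?v" and w="?w",
          OF open_coords[OF c(1)] p t bilinear_g[OF c(1)] dg[OF c(1) p] dp dv])
  also have "(\<lambda>h. dg c (?p t) (?v t) (?w t) (h *\<^sub>R ?x)
     + g c (?p t) (h *\<^sub>R - Chr c (?p t) ?x (?v t)) (?w t) + g c (?p t) (?v t) (h *\<^sub>R - Chr c (?p t) ?x (?w t))) = (\<lambda>h. 0)"
    using bilinear_g[OF c(1) p]
    by (simp add: metric_compatible[OF c(1) p] bilinear_lmul bilinear_rmul bilinear_lneg bilinear_rneg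
      bilinear_lmul[OF bilinear_Chr[OF c(1) p]] algebra_simps)
  finally show ?thesis
  proof (rule has_derivative_transform_eventually)
    have "\<forall>\<^sub>F \<tau> in nhds t. \<gamma> \<tau> \<in> fst c"
      using c by (intro eventually_curve_in[OF \<gamma>] open_chart) auto
    then have "\<forall>\<^sub>F \<tau> in at t within T. \<gamma> \<tau> \<in> fst c"
      unfolding eventually_at_filter by (rule eventually_mono) simp
    then show "\<forall>\<^sub>F \<tau> in at t within T. g c (?p \<tau>) (?v \<tau>) (?w \<tau>) = metric M (\<gamma> \<tau>) (V \<tau>) (W \<tau>)"
      by eventually_elim (simp add: g_to_chart c)
  qed (use t c in \<open>simp_all add: g_to_chart\<close>)
qed

text \<open>The geodesic equation as a first-order system in a fixed chart, the form that the spray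
  estimates take as input.\<close>

lemma geodesic_in_chart:
  assumes "geodesic M \<gamma>" and c: "c \<in> atlas M" "\<gamma> t \<in> fst c"
  defines "p \<equiv> \<lambda>\<tau>. snd c (\<gamma> \<tau>)" and "q \<equiv> \<lambda>\<tau>. to_chart M c (\<gamma> \<tau>) (velocity M \<gamma> \<tau>)"
  shows "(p has_vector_derivative q t) (at t)"
    and "(q has_vector_derivative - Chr c (p t) (q t) (q t)) (at t)"
proof -
  have \<gamma>: "differentiable_curve M \<gamma>" and cov: "has_cov_deriv M \<gamma> (velocity M \<gamma>) 0 t UNIV"
    using assms(1) by (auto simp: geodesic_def)
  show "(p has_vector_derivative q t) (at t)"
    unfolding p_def q_def by (rule curve_coords_derivative[OF \<gamma> c])
  show "(q has_vector_derivative - Chr c (p t) (q t) (q t)) (at t)"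
    using cov unfolding has_cov_deriv_iff[OF \<gamma> c UNIV_I] cov_deriv_in_def p_def q_def
    by (simp add: linear_0[OF linear_to_chart[OF c]])
qed

lemma geodesic_speed_const:
  assumes "geodesic M \<gamma>"
  shows "metric M (\<gamma> t) (velocity M \<gamma> t) (velocity M \<gamma> t) = metric M (\<gamma> 0) (velocity M \<gamma> 0) (velocity M \<gamma> 0)"
proof -
  have "\<exists>c. \<forall>t\<in>UNIV. metric M (\<gamma> t) (velocity M \<gamma> t) (velocity M \<gamma> t) = c"
    by (rule has_derivative_zero_constant)
       (use assms in \<open>auto simp: geodesic_def intro!: metric_parallel_derivative\<close>)
  then show ?thesis by auto
qed

section \<open>Local bounds on Christoffel forms; uniqueness and rescaling of geodesics\<close>

definition dChr :: "('m, 'e) chart \<Rightarrow> 'e \<Rightarrow> 'e \<Rightarrow> 'e \<Rightarrow> 'e \<Rightarrow> 'e" where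
  "dChr c p h u v = frechet_derivative (\<lambda>q. Chr c q u v) (at p) h"

context
  fixes c :: "('m, 'e) chart"
  assumes c: "c \<in> atlas M"
begin

lemma dChr: "p \<in> snd c ` fst c \<Longrightarrow> ((\<lambda>q. Chr c q u v) has_derivative (\<lambda>h. dChr c p h u v)) (at p)"
  unfolding dChr_def using Cn_on_Suc_has_derivative[OF Cn_on_Chr[OF c, of "Suc 0"]] .

lemma linear_dChr: "p \<in> snd c ` fst c \<Longrightarrow> linear (\<lambda>h. dChr c p h u v)"
  by (rule has_derivative_linear[OF dChr])

lemma bilinear_dChr:
  assumes p: "p \<in> snd c ` fst c"
  shows "bilinear (dChr c p h)"
proof -
  have "dChr c p h u v = (\<Sum>i\<in>Basis. \<Sum>j\<in>Basis. ((u \<bullet> i) * (v \<bullet> j)) *\<^sub>R dChr c p h i j)" for u v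
    by (rule bilinear_family_derivative_expand[of "snd c ` fst c" p "Chr c" "\<lambda>u v h. dChr c p h u v"])
       (auto intro: open_coords[OF c] bilinear_Chr[OF c] dChr p)
  then have e: "dChr c p h = (\<lambda>u v. \<Sum>i\<in>Basis. \<Sum>j\<in>Basis. ((u \<bullet> i) * (v \<bullet> j)) *\<^sub>R dChr c p h i j)"
    by (intro ext)
  show ?thesis
    by (subst e) (simp add: bilinear_def linear_iff sum.distrib scaleR_sum_right algebra_simps)
qed

lemma Cn_on_dChr: "Cn_on n (snd c ` fst c) (\<lambda>p. dChr c p h u v)"
  using Cn_on_Chr[OF c, of "Suc n" u v] by (simp add: dChr_def)

text \<open>The entries of the Christoffel form and of its derivative are smooth, hence bounded and
  Lipschitz on a compact ball, and the summed bounds serve as \<open>K\<close>. The cap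
  \<open>\<rho>\<close> on the radius leaves room for a further condition, coercivity of the
  metric.\<close>

lemma Chr_spray_field:
  assumes p0: "p0 \<in> snd c ` fst c" and "\<rho> > 0"
  shows "\<exists>r>0. r \<le> \<rho> \<and> (\<exists>K. cball p0 r \<subseteq> snd c ` fst c \<and> spray_field (Chr c) (dChr c) (cball p0 r) K)"
proof -
  obtain r' where r': "r' > 0" "cball p0 r' \<subseteq> snd c ` fst c"
    using open_coords[OF c] p0 open_contains_cball by blast
  define r where "r = min r' \<rho>"
  have "cball p0 r \<subseteq> cball p0 r'" by (rule subset_cball) (simp add: r_def)
  then have r: "r > 0" "r \<le> \<rho>" "cball p0 r \<subseteq> snd c ` fst c" using r' \<open>\<rho> > 0\<close> by (auto simp: r_def)
  let ?S = "cball p0 r"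
  have S: "p \<in> snd c ` fst c" if "p \<in> ?S" for p using that r by auto
  have "\<exists>B. \<forall>p\<in>?S. norm (Chr c p i j) \<le> B" "\<exists>B. \<forall>p\<in>?S. norm (dChr c p k i j) \<le> B"
    "\<exists>B. \<forall>p\<in>?S. \<forall>q\<in>?S. norm (dChr c p k i j - dChr c q k i j) \<le> B * norm (p - q)" for k i j
    using Cn_on_Chr[OF c, of 0] Cn_on_dChr[of 0]
    by (auto intro!: compact_bound Cn_on_1_lipschitz[OF Cn_on_dChr[of "Suc 0"] compact_cball convex_cball r(3)]
          intro: continuous_on_subset[OF _ r(3)] simp del: Cn_on.simps(2))
  then obtain B1 B2 B3 where
    B1: "\<And>p i j. p \<in> ?S \<Longrightarrow> norm (Chr c p i j) \<le> B1 i j" and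
    B2: "\<And>p k i j. p \<in> ?S \<Longrightarrow> norm (dChr c p k i j) \<le> B2 k i j" and
    B3: "\<And>p q k i j. p \<in> ?S \<Longrightarrow> q \<in> ?S \<Longrightarrow> norm (dChr c p k i j - dChr c q k i j) \<le> B3 k i j * norm (p - q)"
    by metis
  define K1 where "K1 = (\<Sum>i\<in>Basis. \<Sum>j\<in>Basis. \<bar>B1 i j\<bar>)"
  define K2 where "K2 = (\<Sum>k\<in>Basis. \<Sum>i\<in>Basis. \<Sum>j\<in>Basis. \<bar>B2 k i j\<bar>)"
  define K3 where "K3 = (\<Sum>k\<in>Basis. \<Sum>i\<in>Basis. \<Sum>j\<in>Basis. \<bar>B3 k i j\<bar>)"
  have K0: "0 \<le> K1" "0 \<le> K2" "0 \<le> K3" by (auto simp: K1_def K2_def K3_def intro!: sum_nonneg)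
  define K where "K = K1 + K2 + K3"
  have K: "0 \<le> K" "K1 \<le> K" "K2 \<le> K" "K3 \<le> K" using K0 by (auto simp: K_def)
  have "spray_field (Chr c) (dChr c) ?S K"
  proof
    show "convex ?S" by (rule convex_cball)
    show "0 \<le> K" by (rule K)
    fix p u v h assume p: "p \<in> ?S"
    show "bilinear (Chr c p)" "bilinear (dChr c p h)" "Chr c p u v = Chr c p v u"
      using bilinear_Chr[OF c S[OF p]] bilinear_dChr[OF S[OF p]] Chr_sym[OF c S[OF p]] by auto
    show "((\<lambda>q. Chr c q u v) has_derivative (\<lambda>h. dChr c p h u v)) (at p within ?S)"
      by (rule has_derivative_at_withinI[OF dChr[OF S[OF p]]])
    have "norm (Chr c p u v) \<le> (\<Sum>i\<in>Basis. \<Sum>j\<in>Basis. norm (Chr c p i j)) * norm u * norm v"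
      by (rule bilinear_norm_le_sum[OF bilinear_Chr[OF c S[OF p]]])
    also have "\<dots> \<le> K * norm u * norm v"
      using K(2) B1[OF p] by (intro mult_right_mono order_trans[OF _ K(2)[unfolded K1_def]] sum_mono)
        (auto intro: order_trans[OF _ abs_ge_self])
    finally show "norm (Chr c p u v) \<le> K * norm u * norm v" .
    have "norm (dChr c p h u v) \<le> K2 * norm h * norm u * norm v" unfolding K2_def
      by (rule trilinear_norm_le[of "dChr c p", OF linear_dChr[OF S[OF p]] bilinear_dChr[OF S[OF p]]])
         (rule order_trans[OF B2[OF p] abs_ge_self])
    also have "\<dots> \<le> K * norm h * norm u * norm v" by (intro mult_right_mono K) auto
    finally show "norm (dChr c p h u v) \<le> K * norm h * norm u * norm v" .
    fix q assume q: "q \<in> ?S"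
    have "norm (dChr c p h u v - dChr c q h u v)
       \<le> (\<Sum>k\<in>Basis. \<Sum>i\<in>Basis. \<Sum>j\<in>Basis. \<bar>B3 k i j\<bar> * norm (p - q)) * norm h * norm u * norm v"
    proof (rule trilinear_norm_le[of "\<lambda>h u v. dChr c p h u v - dChr c q h u v"])
      show "linear (\<lambda>h. dChr c p h u v - dChr c q h u v)" for u v
        by (intro linear_compose_sub linear_dChr S p q)
      show "bilinear (\<lambda>u v. dChr c p h u v - dChr c q h u v)" for h
        by (intro bilinear_diff_fun bilinear_dChr S p q)
      show "norm (dChr c p k i j - dChr c q k i j) \<le> \<bar>B3 k i j\<bar> * norm (p - q)" for k i j
        using B3[OF p q, of k i j] mult_right_mono[OF abs_ge_self[of "B3 k i j"], of "norm (p - q)"] by simp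
    qed
    also have "\<dots> = K3 * norm (p - q) * norm h * norm u * norm v" by (simp add: K3_def sum_distrib_right)
    also have "\<dots> \<le> K * norm (p - q) * norm h * norm u * norm v" by (intro mult_right_mono K) auto
    finally show "norm (dChr c p h u v - dChr c q h u v) \<le> K * norm (p - q) * norm h * norm u * norm v" .
  qed
  then show ?thesis using r by blast
qed

end

lemma geodesic_unique_near:
  assumes geo: "geodesic M \<gamma>1" "geodesic M \<gamma>2"
    and init: "\<gamma>1 t0 = \<gamma>2 t0" "velocity M \<gamma>1 t0 = velocity M \<gamma>2 t0"
  shows "\<forall>\<^sub>F t in nhds t0. \<gamma>1 t = \<gamma>2 t \<and> velocity M \<gamma>1 t = velocity M \<gamma>2 t"
proof -
  define c where "c = chart_at M (\<gamma>1 t0)"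
  have c: "c \<in> atlas M" "\<gamma>1 t0 \<in> fst c" "\<gamma>2 t0 \<in> fst c" using chart_at init by (auto simp: c_def)
  let ?p = "\<lambda>\<gamma> t. snd c (\<gamma> t)" and ?q = "\<lambda>\<gamma> t. to_chart M c (\<gamma> t) (velocity M \<gamma> t)"
  have p0: "?p \<gamma>1 t0 \<in> snd c ` fst c" using c by auto
  obtain r K where r: "r > 0" "cball (?p \<gamma>1 t0) r \<subseteq> snd c ` fst c"
    and sf: "spray_field (Chr c) (dChr c) (cball (?p \<gamma>1 t0) r) K"
    using Chr_spray_field[OF c(1) p0 zero_less_one] by blast
  have sol: "\<forall>\<^sub>F t in nhds t0. (?p \<gamma> has_vector_derivative ?q \<gamma> t) (at t) \<and>
     (?q \<gamma> has_vector_derivative - Chr c (?p \<gamma> t) (?q \<gamma> t) (?q \<gamma> t)) (at t) \<and> ?p \<gamma> t \<in> cball (?p \<gamma>1 t0) r"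
     and ev_c: "\<forall>\<^sub>F t in nhds t0. \<gamma> t \<in> fst c"
    if \<gamma>: "geodesic M \<gamma>" "\<gamma> t0 = \<gamma>1 t0" for \<gamma>
  proof -
    have dc: "differentiable_curve M \<gamma>" using \<gamma> by (simp add: geodesic_def)
    show ev_c: "\<forall>\<^sub>F t in nhds t0. \<gamma> t \<in> fst c"
      using \<gamma> c by (intro eventually_curve_in[OF dc] open_chart) auto
    have "\<gamma> t0 \<in> fst c" using \<gamma>(2) c(2) by simp
    from has_vector_derivative_tendsto_nhds[OF geodesic_in_chart(1)[OF \<gamma>(1) c(1) this]]
    have "\<forall>\<^sub>F t in nhds t0. ?p \<gamma> t \<in> ball (?p \<gamma>1 t0) r"
      by (rule topological_tendstoD) (use r \<gamma> in auto)
    with ev_c show "\<forall>\<^sub>F t in nhds t0. (?p \<gamma> has_vector_derivative ?q \<gamma> t) (at t) \<and>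
     (?q \<gamma> has_vector_derivative - Chr c (?p \<gamma> t) (?q \<gamma> t) (?q \<gamma> t)) (at t) \<and> ?p \<gamma> t \<in> cball (?p \<gamma>1 t0) r"
      by eventually_elim (use geodesic_in_chart[OF \<gamma>(1) c(1)] in auto)
  qed
  have "\<forall>\<^sub>F t in nhds t0. ?p \<gamma>1 t = ?p \<gamma>2 t \<and> ?q \<gamma>1 t = ?q \<gamma>2 t"
    by (rule spray_field.solution_unique_near[OF sf sol sol]) (use geo init in auto)
  with ev_c[OF geo(1) refl] ev_c[OF geo(2) init(1)[symmetric]] show ?thesis
  proof eventually_elim
    case (elim t)
    have "\<gamma>1 t = chart_inv c (?p \<gamma>1 t)" "\<gamma>2 t = chart_inv c (?p \<gamma>2 t)"
      by (rule chart_inv_chart[OF c(1) elim(1), symmetric], rule chart_inv_chart[OF c(1) elim(2), symmetric])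
    then have eq: "\<gamma>1 t = \<gamma>2 t" using elim by simp
    have "velocity M \<gamma> t = of_chart M c (\<gamma> t) (?q \<gamma> t)" if "\<gamma> t \<in> fst c" for \<gamma>
      using of_chart_to_chart[OF c(1) that] by simp
    from this[of \<gamma>1] this[of \<gamma>2] eq elim show ?case by simp
  qed
qed

text \<open>The times of agreement form a set that is open by local uniqueness and also closed, so
  connectedness of the line applies. For closedness, distinct positions are separated by the
  Hausdorff property, and distinct velocities at one position by their coordinates in a fixed
  chart.\<close>

lemma geodesic_unique:
  assumes geo: "geodesic M \<gamma>1" "geodesic M \<gamma>2"
    and init: "\<gamma>1 t0 = \<gamma>2 t0" "velocity M \<gamma>1 t0 = velocity M \<gamma>2 t0"
  shows "\<gamma>1 t = \<gamma>2 t" "velocity M \<gamma>1 t = velocity M \<gamma>2 t"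
proof -
  define A where "A = {t. \<gamma>1 t = \<gamma>2 t \<and> velocity M \<gamma>1 t = velocity M \<gamma>2 t}"
  have dc: "differentiable_curve M \<gamma>1" "differentiable_curve M \<gamma>2" using geo by (auto simp: geodesic_def)
  have "open A"
    unfolding open_subopen[of A]
  proof
    fix t assume "t \<in> A"
    then have "\<forall>\<^sub>F t in nhds t. \<gamma>1 t = \<gamma>2 t \<and> velocity M \<gamma>1 t = velocity M \<gamma>2 t"
      by (intro geodesic_unique_near[OF geo]) (auto simp: A_def)
    then have "\<forall>\<^sub>F t in nhds t. t \<in> A" by (simp add: A_def)
    then show "\<exists>T. open T \<and> t \<in> T \<and> T \<subseteq> A" unfolding eventually_nhds by blast
  qed
  moreover have "open (- A)"
    unfolding open_subopen[of "- A"]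
  proof
    fix t assume t: "t \<in> - A"
    have "\<forall>\<^sub>F t in nhds t. t \<in> - A"
    proof (cases "\<gamma>1 t = \<gamma>2 t")
      case False
      from hausdorff[OF this] obtain U V
        where UV: "open U" "open V" "\<gamma>1 t \<in> U" "\<gamma>2 t \<in> V" "U \<inter> V = {}" by blast
      from eventually_curve_in[OF dc(1) UV(1,3)] eventually_curve_in[OF dc(2) UV(2,4)]
      show ?thesis by eventually_elim (use UV(5) in \<open>auto simp: A_def\<close>)
    next
      case True
      \<comment> \<open>\<open>velocity\<close> itself may jump with the preferred chart; its
        coordinates in the fixed chart \<open>c\<close> are continuous.\<close>
      define c where "c = chart_at M (\<gamma>1 t)"
      have c: "c \<in> atlas M" "\<gamma>1 t \<in> fst c" "\<gamma>2 t \<in> fst c" using chart_at True by (auto simp: c_def)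
      let ?q = "\<lambda>\<gamma> t. to_chart M c (\<gamma> t) (velocity M \<gamma> t)"
      have "velocity M \<gamma>1 t = of_chart M c (\<gamma>1 t) (?q \<gamma>1 t)" "velocity M \<gamma>2 t = of_chart M c (\<gamma>2 t) (?q \<gamma>2 t)"
        using of_chart_to_chart[OF c(1)] c(2,3) by simp_all
      moreover have "velocity M \<gamma>1 t \<noteq> velocity M \<gamma>2 t" using t True by (simp add: A_def)
      ultimately have "?q \<gamma>1 t - ?q \<gamma>2 t \<noteq> 0" using True by auto
      moreover have "((\<lambda>\<tau>. ?q \<gamma>1 \<tau> - ?q \<gamma>2 \<tau>) \<longlongrightarrow> ?q \<gamma>1 t - ?q \<gamma>2 t) (nhds t)"
        by (intro tendsto_diff has_vector_derivative_tendsto_nhds[OF geodesic_in_chart(2)[OF geo(1) c(1,2)]]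
          has_vector_derivative_tendsto_nhds[OF geodesic_in_chart(2)[OF geo(2) c(1,3)]])
      ultimately have "\<forall>\<^sub>F \<tau> in nhds t. ?q \<gamma>1 \<tau> - ?q \<gamma>2 \<tau> \<noteq> 0"
        using tendsto_imp_eventually_ne by blast
      then show ?thesis by eventually_elim (auto simp: A_def)
    qed
    then show "\<exists>T. open T \<and> t \<in> T \<and> T \<subseteq> - A" unfolding eventually_nhds by blast
  qed
  moreover have "t0 \<in> A" using init by (simp add: A_def)
  moreover have "connected (UNIV :: real set)" by (rule connected_UNIV)
  ultimately have "A = UNIV"
    using connectedD[of UNIV A "- A"] by blast
  then show "\<gamma>1 t = \<gamma>2 t" "velocity M \<gamma>1 t = velocity M \<gamma>2 t" by (auto simp: A_def)
qed

text \<open>The Christoffel term is quadratic in the velocity, so it scales by \<open>a^2\<close>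
  like the second derivative.\<close>

lemma geodesic_rescale:
  assumes geo: "geodesic M \<gamma>"
  shows "geodesic M (\<lambda>t. \<gamma> (a * t))" and "velocity M (\<lambda>t. \<gamma> (a * t)) t = a *\<^sub>R velocity M \<gamma> (a * t)"
proof -
  have dc: "differentiable_curve M \<gamma>" using geo by (auto simp: geodesic_def)
  let ?\<beta> = "\<lambda>t. \<gamma> (a * t)"
  have scale: "((\<lambda>\<tau>. f (a * \<tau>)) has_vector_derivative a *\<^sub>R f') (at t)"
    if "(f has_vector_derivative f') (at (a * t))" for f :: "real \<Rightarrow> 'e" and f' t
  proof -
    have "((\<lambda>\<tau>. a * \<tau>) has_vector_derivative a) (at t)" by (auto intro!: derivative_eq_intros)
    from vector_diff_chain_at[OF this that] show ?thesis by (simp add: o_def)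
  qed
  have d: "((\<lambda>\<tau>. snd (chart_at M (?\<beta> t)) (?\<beta> \<tau>)) has_vector_derivative a *\<^sub>R velocity M \<gamma> (a * t)) (at t)" for t
    by (rule scale[OF velocity_chart_at[OF dc]])
  show vel: "velocity M ?\<beta> t = a *\<^sub>R velocity M \<gamma> (a * t)" for t
    unfolding velocity_def[of M ?\<beta>] by (rule vector_derivative_at[OF d])
  have "continuous_on UNIV \<gamma>" using dc by (simp add: differentiable_curve_def)
  then have "continuous_on UNIV ?\<beta>"
    by (rule continuous_on_compose2) (auto intro!: continuous_intros)
  then have dc': "differentiable_curve M ?\<beta>"
    unfolding differentiable_curve_def using differentiableI_vector[OF d] by blast
  have "has_cov_deriv M ?\<beta> (velocity M ?\<beta>) 0 t UNIV" for t
  proof -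
    define c where "c = chart_at M (?\<beta> t)"
    have c: "c \<in> atlas M" "?\<beta> t \<in> fst c" using chart_at by (auto simp: c_def)
    have p: "snd c (?\<beta> t) \<in> snd c ` fst c" using c by auto
    let ?q = "\<lambda>\<tau>. to_chart M c (\<gamma> \<tau>) (velocity M \<gamma> \<tau>)"
    have lin: "to_chart M c y (a *\<^sub>R v) = a *\<^sub>R to_chart M c y v" if "y \<in> fst c" for y v
      using linear_scale[OF linear_to_chart[OF c(1) that]] .
    have "((\<lambda>\<tau>. a *\<^sub>R ?q (a * \<tau>)) has_vector_derivative a *\<^sub>R a *\<^sub>R - Chr c (snd c (?\<beta> t)) (?q (a * t)) (?q (a * t))) (at t)"
      by (rule bounded_linear.has_vector_derivative[OF bounded_linear_scaleR_right scale[OF geodesic_in_chart(2)[OF geo c]]])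
    moreover have "\<forall>\<^sub>F \<tau> in nhds t. ?\<beta> \<tau> \<in> fst c"
      using c by (intro eventually_curve_in[OF dc'] open_chart) auto
    ultimately have "((\<lambda>\<tau>. to_chart M c (?\<beta> \<tau>) (velocity M ?\<beta> \<tau>)) has_vector_derivative
        a *\<^sub>R a *\<^sub>R - Chr c (snd c (?\<beta> t)) (?q (a * t)) (?q (a * t))) (at t)"
    proof -
      assume *: "((\<lambda>\<tau>. a *\<^sub>R ?q (a * \<tau>)) has_vector_derivative
        a *\<^sub>R a *\<^sub>R - Chr c (snd c (?\<beta> t)) (?q (a * t)) (?q (a * t))) (at t)"
      assume "\<forall>\<^sub>F \<tau> in nhds t. ?\<beta> \<tau> \<in> fst c"
      then obtain W where W: "open W" "t \<in> W" "\<And>\<tau>. \<tau> \<in> W \<Longrightarrow> ?\<beta> \<tau> \<in> fst c"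
        unfolding eventually_nhds by blast
      show ?thesis
        by (rule has_vector_derivative_transform_within_open[OF * W(1,2)]) (simp add: vel lin W(3))
    qed
    then show ?thesis
      unfolding has_cov_deriv_iff[OF dc' c UNIV_I] cov_deriv_in_def
      using c by (simp add: vel lin linear_0[OF linear_to_chart[OF c]]
          bilinear_lmul[OF bilinear_Chr[OF c(1) p]] bilinear_rmul[OF bilinear_Chr[OF c(1) p]])
  qed
  then show "geodesic M ?\<beta>" using dc' by (simp add: geodesic_def)
qed

text \<open>The rescaled curve realizes the initial velocity \<open>t *\<^sub>R v\<close>, and
  uniqueness settles the \<open>THE\<close> in \<open>Exp\<close>. Hence the curve in the definition
  of \<open>transport\<close> is a geodesic.\<close>

lemma Exp_geodesic:
  assumes geo: "geodesic M \<gamma>" "\<gamma> 0 = x" "velocity M \<gamma> 0 = v"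
  shows "Exp M x (t *\<^sub>R v) = \<gamma> t"
  unfolding Exp_def
proof (rule the_equality)
  show "\<exists>\<beta>. geodesic M \<beta> \<and> \<beta> 0 = x \<and> velocity M \<beta> 0 = t *\<^sub>R v \<and> \<beta> 1 = \<gamma> t"
    using geodesic_rescale[OF geo(1), of t] geo(2,3) by (intro exI[of _ "\<lambda>\<tau>. \<gamma> (t * \<tau>)"]) simp
  fix y assume "\<exists>\<beta>. geodesic M \<beta> \<and> \<beta> 0 = x \<and> velocity M \<beta> 0 = t *\<^sub>R v \<and> \<beta> 1 = y"
  then obtain \<beta> where \<beta>: "geodesic M \<beta>" "\<beta> 0 = x" "velocity M \<beta> 0 = t *\<^sub>R v" "\<beta> 1 = y" by blast
  have "\<beta> 1 = \<gamma> (t * 1)"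
    by (rule geodesic_unique(1)[OF \<beta>(1) geodesic_rescale(1)[OF geo(1), of t], of 0])
       (use \<beta> geo geodesic_rescale(2)[OF geo(1), of t 0] in auto)
  then show "y = \<gamma> t" using \<beta>(4) by simp
qed

section \<open>Parallel transport\<close>

text \<open>\<open>parallel_field\<close> on a general interval, so that fields can be built on
  short pieces and joined.\<close>

definition parallel_on :: "(real \<Rightarrow> 'm) \<Rightarrow> (real \<Rightarrow> 'e) \<Rightarrow> real \<Rightarrow> real \<Rightarrow> bool" where
  "parallel_on \<gamma> V a b \<longleftrightarrow> (\<forall>t\<in>{a..b}. has_cov_deriv M \<gamma> V 0 t {a..b})"

text \<open>In coordinates parallelism is a linear equation with continuous coefficients, hence
  solvable on the whole piece.\<close>

lemma parallel_exists_in_chart: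
  assumes geo: "geodesic M \<gamma>" and c: "c \<in> atlas M" and ab: "a \<le> b"
    and in_c: "\<And>t. t \<in> {a..b} \<Longrightarrow> \<gamma> t \<in> fst c"
  shows "\<exists>V. V a = v0 \<and> parallel_on \<gamma> V a b"
proof -
  have dc: "differentiable_curve M \<gamma>" using geo by (simp add: geodesic_def)
  let ?p = "\<lambda>\<tau>. snd c (\<gamma> \<tau>)" and ?q = "\<lambda>\<tau>. to_chart M c (\<gamma> \<tau>) (velocity M \<gamma> \<tau>)"
  have p: "?p t \<in> snd c ` fst c" if "t \<in> {a..b}" for t using in_c[OF that] by auto
  have contp: "continuous_on {a..b} ?p"
    using has_vector_derivative_continuous[OF geodesic_in_chart(1)[OF geo c in_c]]
    by (intro continuous_at_imp_continuous_on) auto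
  have contq: "continuous_on {a..b} ?q"
    using has_vector_derivative_continuous[OF geodesic_in_chart(2)[OF geo c in_c]]
    by (intro continuous_at_imp_continuous_on) auto
  have "\<exists>y. y a = to_chart M c (\<gamma> a) v0 \<and>
    (\<forall>t\<in>{a..b}. (y has_vector_derivative - Chr c (?p t) (?q t) (y t)) (at t within {a..b}))"
  proof (rule linear_ode_exists[OF ab])
    show "linear (\<lambda>u. - Chr c (?p t) (?q t) u)" if "t \<in> {a..b}" for t
      using bilinear_Chr[OF c p[OF that]] by (simp add: bilinear_def linear_iff)
    fix u
    have "continuous_on {a..b} (\<lambda>t. - (\<Sum>i\<in>Basis. \<Sum>j\<in>Basis. ((?q t \<bullet> i) * (u \<bullet> j)) *\<^sub>R Chr c (?p t) i j))"
      by (intro continuous_intros contq continuous_on_compose2[OF Cn_on_imp_continuous_on[OF Cn_on_Chr[OF c]] contp])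
         (use p in auto)
    then show "continuous_on {a..b} (\<lambda>t. - Chr c (?p t) (?q t) u)"
      by (rule continuous_on_eq) (simp add: bilinear_expand[OF bilinear_Chr[OF c p], of _ "?q _" u])
  qed
  then obtain y where y: "y a = to_chart M c (\<gamma> a) v0"
    "\<And>t. t \<in> {a..b} \<Longrightarrow> (y has_vector_derivative - Chr c (?p t) (?q t) (y t)) (at t within {a..b})" by blast
  define V where "V t = of_chart M c (\<gamma> t) (y t)" for t
  have V: "to_chart M c (\<gamma> t) (V t) = y t" if "t \<in> {a..b}" for t
    unfolding V_def by (rule to_chart_of_chart[OF c in_c[OF that]])
  have "has_cov_deriv M \<gamma> V 0 t {a..b}" if t: "t \<in> {a..b}" for t
    unfolding has_cov_deriv_iff[OF dc c in_c[OF t] t] cov_deriv_in_def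
    using has_vector_derivative_transform[OF t V y(2)[OF t]]
    by (simp add: V[OF t] linear_0[OF linear_to_chart[OF c in_c[OF t]]])
  moreover have "V a = v0" unfolding V_def y(1) using of_chart_to_chart[OF c in_c] ab by simp
  ultimately show ?thesis unfolding parallel_on_def by blast
qed

text \<open>Around each time the curve stays in one chart for a while. Pieces are joined point by
  point in the preferred chart there, so adjacent pieces may come from different charts.\<close>

lemma parallel_exists:
  assumes geo: "geodesic M \<gamma>" and ab: "a \<le> b"
  shows "\<exists>V. V a = v0 \<and> parallel_on \<gamma> V a b"
proof -
  have dc: "differentiable_curve M \<gamma>" using geo by (simp add: geodesic_def)
  have "a \<le> b \<longrightarrow> (\<forall>v0. \<exists>V. V a = v0 \<and> parallel_on \<gamma> V a b)"
  proof (rule Bolzano[OF ab])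
    fix a b c :: real
    assume P1: "a \<le> b \<longrightarrow> (\<forall>v0. \<exists>V. V a = v0 \<and> parallel_on \<gamma> V a b)"
      and P2: "b \<le> c \<longrightarrow> (\<forall>v0. \<exists>V. V b = v0 \<and> parallel_on \<gamma> V b c)" and le: "a \<le> b" "b \<le> c"
    show "a \<le> c \<longrightarrow> (\<forall>v0. \<exists>V. V a = v0 \<and> parallel_on \<gamma> V a c)"
    proof (intro impI allI)
      fix v0
      obtain V where V: "V a = v0" "parallel_on \<gamma> V a b" using P1 le by blast
      obtain W where W: "W b = V b" "parallel_on \<gamma> W b c" using P2 le by blast
      let ?U = "\<lambda>t. if t \<in> {a..b} then V t else W t"
      have "has_cov_deriv M \<gamma> ?U 0 t {a..c}" if t: "t \<in> {a..c}" for t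
      proof -
        let ?tc = "\<lambda>\<tau>. to_chart M (chart_at M (\<gamma> t)) (\<gamma> \<tau>)"
        have UW: "?U t = W t" if "t \<in> {b..c}" using that W(1) le by auto
        have "((\<lambda>\<tau>. if \<tau> \<in> {a..b} then ?tc \<tau> (V \<tau>) else ?tc \<tau> (W \<tau>)) has_vector_derivative
          0 - christoffel M (\<gamma> t) (velocity M \<gamma> t) (?U t)) (at t within {a..c})"
        proof (rule has_vector_derivative_join[OF le t])
          show "((\<lambda>\<tau>. ?tc \<tau> (V \<tau>)) has_vector_derivative 0 - christoffel M (\<gamma> t) (velocity M \<gamma> t) (?U t)) (at t within {a..b})"
            if "t \<in> {a..b}"
            using V(2) that unfolding parallel_on_def has_cov_deriv_def by simp
          show "((\<lambda>\<tau>. ?tc \<tau> (W \<tau>)) has_vector_derivative 0 - christoffel M (\<gamma> t) (velocity M \<gamma> t) (?U t)) (at t within {b..c})"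
            if "t \<in> {b..c}"
            using W(2) that unfolding parallel_on_def has_cov_deriv_def UW[OF that] by simp
        qed (simp add: W(1))
        moreover have "(\<lambda>\<tau>. if \<tau> \<in> {a..b} then ?tc \<tau> (V \<tau>) else ?tc \<tau> (W \<tau>)) = (\<lambda>\<tau>. ?tc \<tau> (?U \<tau>))" by auto
        ultimately show ?thesis unfolding has_cov_deriv_def by simp
      qed
      moreover have "?U a = v0" using V(1) le by simp
      ultimately show "\<exists>V. V a = v0 \<and> parallel_on \<gamma> V a c"
        unfolding parallel_on_def by (intro exI[of _ ?U]) blast
    qed
  next
    fix t0
    define c where "c = chart_at M (\<gamma> t0)"
    have c: "c \<in> atlas M" "\<gamma> t0 \<in> fst c" using chart_at by (auto simp: c_def)
    obtain d where d: "d > 0" "\<And>t. dist t t0 < d \<Longrightarrow> \<gamma> t \<in> fst c"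
      using eventually_curve_in[OF dc open_chart[OF c(1)] c(2)] unfolding eventually_nhds_metric by blast
    show "\<exists>d>0. \<forall>a b. a \<le> t0 \<and> t0 \<le> b \<and> b - a < d \<longrightarrow>
        (a \<le> b \<longrightarrow> (\<forall>v0. \<exists>V. V a = v0 \<and> parallel_on \<gamma> V a b))"
    proof (intro exI[of _ d] conjI allI impI d(1))
      fix a b v0 assume *: "a \<le> t0 \<and> t0 \<le> b \<and> b - a < d" "a \<le> b"
      show "\<exists>V. V a = v0 \<and> parallel_on \<gamma> V a b"
        by (rule parallel_exists_in_chart[OF geo c(1) *(2) d(2)]) (use * in \<open>auto simp: dist_real_def\<close>)
    qed
  qed
  then show ?thesis using ab by blast
qed

lemma parallel_metric_const:
  assumes dc: "differentiable_curve M \<gamma>" and VW: "parallel_on \<gamma> V a b" "parallel_on \<gamma> W a b"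
    and t: "t \<in> {a..b}"
  shows "metric M (\<gamma> t) (V t) (W t) = metric M (\<gamma> a) (V a) (W a)"
proof -
  have "\<exists>k. \<forall>t\<in>{a..b}. metric M (\<gamma> t) (V t) (W t) = k"
    by (rule has_derivative_zero_constant)
       (use VW in \<open>auto simp: parallel_on_def intro!: metric_parallel_derivative[OF dc]\<close>)
  then show ?thesis using t by auto
qed

lemma metric_diff_self: "metric M x (u - v) (u - v) = metric M x u u - 2 * metric M x u v + metric M x v v"
  by (simp add: bilinear_lsub[OF bilinear_metric] bilinear_rsub[OF bilinear_metric] metric_sym[of x v u])

lemma metric_self_eq_0: "metric M x u u = 0 \<longleftrightarrow> u = 0"
  using metric_pos[of u x] bilinear_lzero[OF bilinear_metric] by (metis less_irrefl)

text \<open>Inner products of parallel fields are constant, so the squared length of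
  \<open>V - W\<close> keeps its initial value \<open>0\<close>.\<close>

lemma parallel_unique:
  assumes dc: "differentiable_curve M \<gamma>" and VW: "parallel_on \<gamma> V a b" "parallel_on \<gamma> W a b"
    and init: "V a = W a" and t: "t \<in> {a..b}"
  shows "V t = W t"
proof -
  have "metric M (\<gamma> t) (V t - W t) (V t - W t) = 0"
    unfolding metric_diff_self parallel_metric_const[OF dc VW t] parallel_metric_const[OF dc VW(1,1) t]
      parallel_metric_const[OF dc VW(2,2) t] by (simp add: init)
  then show ?thesis by (simp add: metric_self_eq_0)
qed

end

locale complete_riemannian = riemannian M
  for M :: "('m::{t2_space,second_countable_topology}, 'e::euclidean_space) riem" +
  assumes geodesics_exist: "\<exists>\<gamma>. geodesic M \<gamma> \<and> \<gamma> 0 = x \<and> velocity M \<gamma> 0 = v"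
begin

definition geod :: "'m \<Rightarrow> 'e \<Rightarrow> real \<Rightarrow> 'm" where
  "geod x v = (SOME \<gamma>. geodesic M \<gamma> \<and> \<gamma> 0 = x \<and> velocity M \<gamma> 0 = v)"

lemma geod: "geodesic M (geod x v)" "geod x v 0 = x" "velocity M (geod x v) 0 = v"
  using someI_ex[OF geodesics_exist[of x v]] by (auto simp: geod_def)

lemma Exp_geod: "Exp M x (t *\<^sub>R v) = geod x v t"
  by (rule Exp_geodesic[OF geod])

lemma Exp_eq: "Exp M x v = geod x v 1"
  using Exp_geod[of x 1 v] by simp

lemma Exp_0: "Exp M x 0 = x"
  using Exp_geod[of x 0 0] geod(2)[of x 0] by simp

lemma transport_parallel:
  assumes V: "parallel_on (geod x s) V 0 1"
  shows "transport M x s (V 0) = V 1"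
  unfolding transport_def
proof (rule the_equality)
  have pf: "parallel_field M (\<lambda>t. Exp M x (t *\<^sub>R s)) W \<longleftrightarrow> parallel_on (geod x s) W 0 1" for W
    by (simp add: Exp_geod parallel_field_def parallel_on_def)
  show "\<exists>W. parallel_field M (\<lambda>t. Exp M x (t *\<^sub>R s)) W \<and> W 0 = V 0 \<and> W 1 = V 1"
    using V pf by blast
  have dc: "differentiable_curve M (geod x s)" using geod(1) by (simp add: geodesic_def)
  fix w assume "\<exists>W. parallel_field M (\<lambda>t. Exp M x (t *\<^sub>R s)) W \<and> W 0 = V 0 \<and> W 1 = w"
  then obtain W where W: "parallel_on (geod x s) W 0 1" "W 0 = V 0" "W 1 = w" using pf by blast
  then show "w = V 1" using parallel_unique[OF dc W(1) V W(2), of 1] by simp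
qed

lemma transport_metric:
  "metric M (Exp M x s) (transport M x s u) (transport M x s v) = metric M x u v"
proof -
  have dc: "differentiable_curve M (geod x s)" using geod(1) by (simp add: geodesic_def)
  obtain V W where V: "V 0 = u" "parallel_on (geod x s) V 0 1" and W: "W 0 = v" "parallel_on (geod x s) W 0 1"
    using parallel_exists[OF geod(1) zero_le_one] by metis
  show ?thesis
    using parallel_metric_const[OF dc V(2) W(2), of 1] transport_parallel[OF V(2)] transport_parallel[OF W(2)] V(1) W(1)
    by (simp add: Exp_eq geod(2))
qed

text \<open>A map that preserves inner products is automatically linear.\<close>

lemma surj_transport: "surj (transport M x s)"
proof -
  let ?P = "transport M x s" and ?y = "Exp M x s"
  note bil = bilinear_metric and tm = transport_metric[of x s]
  have add: "?P (u + v) = ?P u + ?P v" for u v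
  proof -
    have "metric M ?y (?P (u + v) - ?P u - ?P v) (?P (u + v) - ?P u - ?P v) =
       metric M x (u + v - u - v) (u + v - u - v)"
      by (simp only: bilinear_lsub[OF bil] bilinear_rsub[OF bil] tm)
    then have "?P (u + v) - ?P u - ?P v = 0" by (simp add: metric_self_eq_0 bilinear_lzero[OF bil])
    then show ?thesis by (simp add: algebra_simps)
  qed
  have scale: "?P (c *\<^sub>R u) = c *\<^sub>R ?P u" for c u
  proof -
    have "metric M ?y (?P (c *\<^sub>R u) - c *\<^sub>R ?P u) (?P (c *\<^sub>R u) - c *\<^sub>R ?P u) =
       metric M x (c *\<^sub>R u - c *\<^sub>R u) (c *\<^sub>R u - c *\<^sub>R u)"
      by (simp only: bilinear_lsub[OF bil] bilinear_rsub[OF bil] bilinear_lmul[OF bil] bilinear_rmul[OF bil] tm) simp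
    then show ?thesis by (simp add: metric_self_eq_0 bilinear_lzero[OF bil])
  qed
  have lin: "linear ?P" by (rule linearI[OF add scale])
  have "inj ?P"
    unfolding linear_injective_0[OF lin]
  proof (intro allI impI)
    fix u assume "?P u = 0"
    then have "metric M x u u = 0" using tm[of u u] by (simp add: bilinear_lzero[OF bil])
    then show "u = 0" by (simp add: metric_self_eq_0)
  qed
  then show ?thesis using lin linear_injective_imp_surjective by blast
qed

text \<open>Surjectivity makes \<open>inv\<close> a right inverse of the transport; the isometry
  property is then applied to the preimage.\<close>

lemma rnorm_inv_transport: "rnorm M x (inv (transport M x s) u) = rnorm M (Exp M x s) u"
  using transport_metric[of x s "inv (transport M x s) u" "inv (transport M x s) u"]
  by (simp add: rnorm_def surj_f_inv_f[OF surj_transport])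

end

context complete_riemannian
begin

section \<open>The derivative of the exponential map\<close>

text \<open>A geodesic cannot leave a coordinate ball before its length, bounded through the
  conserved speed, allows it to.\<close>

lemma geodesic_stays_in_ball:
  assumes c: "c \<in> atlas M" "x \<in> fst c" and r: "cball (snd c x) r \<subseteq> snd c ` fst c"
    and a: "a > 0" "\<And>p u. p \<in> ball (snd c x) r \<Longrightarrow> a * (norm u)\<^sup>2 \<le> g c p u u"
    and C: "\<And>v. metric M x v v \<le> a * (C * norm v)\<^sup>2" "0 \<le> C" and v: "C * norm v < r" and t: "t \<in> {0..1}"
  shows "geod x v t \<in> fst c" "snd c (geod x v t) \<in> ball (snd c x) r"
    "norm (to_chart M c (geod x v t) (velocity M (geod x v) t)) \<le> C * norm v"
proof -
  let ?\<gamma> = "geod x v" and ?B = "ball (snd c x) r"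
  let ?p = "\<lambda>t. snd c (?\<gamma> t)" and ?q = "\<lambda>t. to_chart M c (?\<gamma> t) (velocity M ?\<gamma> t)"
  define W where "W = fst c \<inter> snd c -` ?B"
  have dc: "differentiable_curve M ?\<gamma>" using geod(1) by (simp add: geodesic_def)
  have r0: "0 < r" using v C(2) by (meson le_less_trans mult_nonneg_nonneg norm_ge_zero)
  have "open W"
    unfolding W_def using continuous_on_chart[OF c(1)] open_chart[OF c(1)]
    by (metis continuous_on_open_vimage inf_commute open_ball)
  have speed: "norm (?q \<tau>) \<le> C * norm v" if "?\<gamma> \<tau> \<in> W" for \<tau>
  proof -
    have m: "?\<gamma> \<tau> \<in> fst c" "?p \<tau> \<in> ?B" using that by (auto simp: W_def)
    have "a * (norm (?q \<tau>))\<^sup>2 \<le> g c (?p \<tau>) (?q \<tau>) (?q \<tau>)" by (rule a(2)[OF m(2)])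
    also have "\<dots> = metric M x v v"
      using geodesic_speed_const[OF geod(1), of x v \<tau>] by (simp add: g_to_chart[OF c(1) m(1)] geod)
    also have "\<dots> \<le> a * (C * norm v)\<^sup>2" by (rule C)
    finally have "(norm (?q \<tau>))\<^sup>2 \<le> (C * norm v)\<^sup>2" using a(1) by simp
    then show ?thesis using C(2) by (simp add: power2_le_iff_abs_le)
  qed
  have "?\<gamma> t \<in> W" if t: "t \<in> {0..1}" for t
  proof (rule ccontr)
    assume "?\<gamma> t \<notin> W"
    \<comment> \<open>Its least element \<open>s\<close>, which exists by compactness, is the first
      time outside \<open>W\<close>.\<close>
    define bad where "bad = {0..1} \<inter> ?\<gamma> -` (- W)"
    have "closed (?\<gamma> -` (- W))"
      using open_curve_preimage[OF dc \<open>open W\<close>] by (simp add: vimage_Compl closed_def)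
    then have "compact bad" unfolding bad_def by (intro compact_Int_closed) auto
    have "bad \<noteq> {}" using t \<open>?\<gamma> t \<notin> W\<close> by (auto simp: bad_def)
    from compact_attains_inf[OF \<open>compact bad\<close> this]
    obtain s where s: "s \<in> bad" "\<And>\<tau>. \<tau> \<in> bad \<Longrightarrow> s \<le> \<tau>" by blast
    have s01: "s \<in> {0..1}" "?\<gamma> s \<notin> W" using s(1) by (auto simp: bad_def)
    have "?\<gamma> 0 \<in> W" using c r0 by (simp add: geod W_def)
    then have "s > 0" using s01 by (cases "s = 0") auto
    have W: "?\<gamma> \<tau> \<in> W" if "\<tau> \<in> {0..<s}" for \<tau>
      using that s01 s(2)[of \<tau>] by (force simp: bad_def)
    \<comment> \<open>A compact set, closed because the manifold is Hausdorff, that contains the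
      curve before time \<open>s\<close>. Closedness keeps the curve in the chart domain at time
      \<open>s\<close>; a limit of the coordinates alone would not.\<close>
    define F where "F = chart_inv c ` cball (snd c x) (C * norm v)"
    have sub: "cball (snd c x) (C * norm v) \<subseteq> snd c ` fst c"
      using r v by (meson less_imp_le order_trans subset_cball)
    have "compact F"
      unfolding F_def
      by (intro compact_continuous_image continuous_on_subset[OF continuous_on_chart_inv[OF c(1)] sub]) auto
    have F: "?\<gamma> \<tau> \<in> F" if \<tau>: "\<tau> \<in> {0..<s}" for \<tau>
    proof -
      have W\<tau>: "?\<gamma> \<sigma> \<in> W" if "\<sigma> \<in> {0..\<tau>}" for \<sigma> using W that \<tau> by auto
      have "norm (?p \<tau> - ?p 0) \<le> (C * norm v) * \<bar>\<tau> - 0\<bar>"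
      proof (rule norm_diff_le_of_vector_derivative)
        show "(?p has_vector_derivative ?q \<sigma>) (at \<sigma> within {0..\<tau>})" if "\<sigma> \<in> {0..\<tau>}" for \<sigma>
          using geodesic_in_chart(1)[OF geod(1) c(1)] W\<tau>[OF that]
          by (auto simp: W_def intro: has_vector_derivative_at_within)
        show "norm (?q \<sigma>) \<le> C * norm v" if "\<sigma> \<in> {0..\<tau>}" for \<sigma>
          by (rule speed[OF W\<tau>[OF that]])
      qed (use \<tau> in auto)
      also have "\<dots> \<le> (C * norm v) * 1" using \<tau> s01 C(2) by (intro mult_left_mono) auto
      finally have "?p \<tau> \<in> cball (snd c x) (C * norm v)" by (simp add: geod dist_norm norm_minus_commute)
      moreover have "?\<gamma> \<tau> = chart_inv c (?p \<tau>)" using W[OF \<tau>] c by (simp add: W_def chart_inv_chart)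
      ultimately show ?thesis unfolding F_def by (rule image_eqI[rotated])
    qed
    have "closed (?\<gamma> -` F)"
      using open_curve_preimage[OF dc, of "- F"] compact_imp_closed[OF \<open>compact F\<close>]
      by (simp add: vimage_Compl closed_def)
    moreover have "{0..<s} \<subseteq> ?\<gamma> -` F" using F by auto
    ultimately have "closure {0..<s} \<subseteq> ?\<gamma> -` F" by (rule closure_minimal[rotated])
    moreover have "s \<in> closure {0..<s}" using \<open>s > 0\<close> by simp
    ultimately have "?\<gamma> s \<in> F" by blast
    then obtain p where p: "p \<in> cball (snd c x) (C * norm v)" "?\<gamma> s = chart_inv c p" by (auto simp: F_def)
    have "?\<gamma> s \<in> fst c" "snd c (?\<gamma> s) = p"
      using chart_inv_mem[OF c(1), of p] p sub by auto
    then have "?\<gamma> s \<in> W" using p v by (auto simp: W_def)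
    then show False using s01 by simp
  qed
  from this[OF t] show "?\<gamma> t \<in> fst c" "?p t \<in> ?B" "norm (?q t) \<le> C * norm v"
    using speed by (auto simp: W_def)
qed

text \<open>\<open>spray\<close> is instantiated with geodesics in the preferred chart at
  \<open>x\<close>, in which a tangent vector at \<open>x\<close> is its own coordinate vector; the
  time-one map is then \<open>Exp\<close> in coordinates.\<close>

lemma Exp_chart_derivative:
  assumes c: "c = chart_at M x"
  shows "\<exists>\<delta>>0. \<exists>\<Phi>'. (\<forall>v. norm v < \<delta> \<longrightarrow> Exp M x v \<in> fst c \<and>
      ((\<lambda>v. snd c (Exp M x v)) has_derivative \<Phi>' v) (at v)) \<and> (\<forall>z. \<Phi>' 0 z = z) \<and>
      (\<forall>z. ((\<lambda>v. \<Phi>' v z) has_derivative (\<lambda>u. - Chr c (snd c x) u z)) (at 0))"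
proof -
  let ?p0 = "snd c x"
  have cx: "c \<in> atlas M" "x \<in> fst c" using chart_at c by auto
  have p0: "?p0 \<in> snd c ` fst c" using cx by auto
  have "\<exists>a>0. \<forall>\<^sub>F q in nhds ?p0. \<forall>u. g c q u u \<ge> a * (norm u)\<^sup>2"
  proof (rule bilinear_family_coercive[where B="g c" and ?B0.0="g c ?p0"])
    show "\<forall>\<^sub>F q in nhds ?p0. bilinear (g c q)"
      using open_coords[OF cx(1)] p0 bilinear_g[OF cx(1)] unfolding eventually_nhds by blast
    show "((\<lambda>q. g c q i j) \<longlongrightarrow> g c ?p0 i j) (nhds ?p0)" for i j
      using has_derivative_continuous[OF dg[OF cx(1) p0, of i j]]
      unfolding continuous_within tendsto_at_iff_tendsto_nhds[where g="\<lambda>q. g c q i j"] .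
  qed (rule bilinear_g[OF cx(1) p0], rule g_pos[OF cx(1) p0])
  then obtain a \<rho> where a: "a > 0" "\<rho> > 0" and coercive: "\<And>q u. dist q ?p0 < \<rho> \<Longrightarrow> g c q u u \<ge> a * (norm u)\<^sup>2"
    unfolding eventually_nhds_metric by blast
  obtain r K where r: "r > 0" "r \<le> \<rho>" "cball ?p0 r \<subseteq> snd c ` fst c"
    and sf: "spray_field (Chr c) (dChr c) (cball ?p0 r) K"
    using Chr_spray_field[OF cx(1) p0 a(2)] by blast
  interpret spray_field "Chr c" "dChr c" "cball ?p0 r" K by (rule sf)
  define b where "b = (\<Sum>i\<in>Basis. \<Sum>j\<in>Basis. norm (metric M x i j))"
  \<comment> \<open>\<open>b\<close> bounds the metric at \<open>x\<close> from above,
    \<open>a\<close> bounds it from below on the ball; with constant speed, coordinate velocities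
    are at most \<open>sqrt (b / a)\<close> times the initial one.\<close>
  define C where "C = sqrt (b / a)"
  have b: "0 \<le> b" by (auto simp: b_def intro!: sum_nonneg)
  have C0: "0 \<le> C" using a b by (simp add: C_def)
  have C: "metric M x v v \<le> a * (C * norm v)\<^sup>2" for v
  proof -
    have "(C * norm v)\<^sup>2 = b / a * (norm v)\<^sup>2"
      using a b by (simp add: C_def power_mult_distrib)
    then have "a * (C * norm v)\<^sup>2 = b * norm v * norm v"
      using a by (simp add: power2_eq_square)
    then show ?thesis
      using bilinear_norm_le_sum[OF bilinear_metric, of x v v, folded b_def] by simp
  qed
  \<comment> \<open>The three terms keep the geodesics in the ball and give
    \<open>C * \<delta> \<le> 1\<close> and \<open>K * (C * \<delta>) \<le> 1/16\<close>; adding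
    \<open>1\<close> to \<open>C\<close> and \<open>K\<close> avoids division by zero.\<close>
  define \<delta> where "\<delta> = min (r / (C + 1)) (min (1 / (C + 1)) (1 / (16 * (K + 1) * (C + 1))))"
  have \<delta>0: "\<delta> > 0" using r C0 K by (simp add: \<delta>_def add_nonneg_pos)
  have \<delta>1: "\<delta> * (C + 1) \<le> r" "\<delta> * (C + 1) \<le> 1" "\<delta> * (16 * (K + 1) * (C + 1)) \<le> 1"
    using C0 K by (auto simp: \<delta>_def pos_le_divide_eq[symmetric] add_nonneg_pos)
  have Cv: "C * norm v < r" if "norm v < \<delta>" for v
  proof -
    have "C * norm v \<le> C * \<delta>" using C0 that by (intro mult_left_mono) auto
    also have "\<dots> < \<delta> * (C + 1)" using \<delta>0 by (simp add: algebra_simps)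
    finally show ?thesis using \<delta>1(1) by simp
  qed
  have stay: "geod x v t \<in> fst c" "snd c (geod x v t) \<in> ball ?p0 r"
    "norm (to_chart M c (geod x v t) (velocity M (geod x v) t)) \<le> C * norm v"
    if "norm v < \<delta>" "t \<in> {0..1}" for v t
    by (rule geodesic_stays_in_ball[OF cx r(3) a(1) _ C C0 Cv[OF that(1)] that(2)];
        use r(2) in \<open>auto intro!: coercive simp: dist_commute\<close>)+
  define P where "P v t = snd c (geod x v t)" for v t
  define V where "V v t = to_chart M c (geod x v t) (velocity M (geod x v) t)" for v t
  interpret spray "Chr c" "dChr c" "cball ?p0 r" K ?p0 C \<delta> P V
  proof
    show "?p0 \<in> cball ?p0 r" using r by simp
    show "0 \<le> C" "0 < \<delta>" by fact+
    show "C * \<delta> \<le> 1" using \<delta>1(2) \<delta>0 by (simp add: algebra_simps)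
    have "K * (C * \<delta>) \<le> (K + 1) * ((C + 1) * \<delta>)"
      using K C0 \<delta>0 by (intro mult_mono) auto
    also have "\<dots> \<le> 1 / 16" using \<delta>1(3) by (simp add: mult_ac)
    finally show "K * (C * \<delta>) \<le> 1 / 16" .
    show "P v 0 = ?p0" "V v 0 = v" for v by (simp_all add: P_def V_def geod c to_chart_self)
    fix v :: 'e and t :: real assume v: "norm v < \<delta>" and t: "t \<in> {0..1}"
    note st = stay[OF v t]
    show "(P v has_vector_derivative V v t) (at t within {0..1})"
      "(V v has_vector_derivative - Chr c (P v t) (V v t) (V v t)) (at t within {0..1})"
      unfolding P_def V_def
      using geodesic_in_chart[OF geod(1) cx(1) st(1)] by (auto intro: has_vector_derivative_at_within)
    show "P v t \<in> cball ?p0 r" "norm (V v t) \<le> C * norm v" using st by (auto simp: P_def V_def)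
  qed
  have "(\<lambda>v. P v 1) = (\<lambda>v. snd c (Exp M x v))" by (simp add: P_def Exp_eq)
  then have "Exp M x v \<in> fst c \<and> ((\<lambda>v. snd c (Exp M x v)) has_derivative \<Phi>' v) (at v)" if "norm v < \<delta>" for v
    using flow_has_derivative[OF that] stay(1)[OF that, of 1] by (simp add: Exp_eq)
  then show ?thesis using \<delta>0 \<Phi>'_0 \<Phi>'_has_derivative_0 by blast
qed

section \<open>Gradient and Hessian of the pullback\<close>

definition dF :: "('m \<Rightarrow> real) \<Rightarrow> ('m, 'e) chart \<Rightarrow> 'e \<Rightarrow> 'e \<Rightarrow> real" where
  "dF f c p = frechet_derivative (f \<circ> chart_inv c) (at p)"

definition D2F :: "('m \<Rightarrow> real) \<Rightarrow> ('m, 'e) chart \<Rightarrow> 'e \<Rightarrow> 'e \<Rightarrow> 'e \<Rightarrow> real" where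
  "D2F f c p z = frechet_derivative (\<lambda>q. dF f c q z) (at p)"

context
  fixes f :: "'m \<Rightarrow> real"
  assumes f: "Cn_function 2 M f"
begin

context
  fixes c :: "('m, 'e) chart" and p :: 'e
  assumes c: "c \<in> atlas M" and p: "p \<in> snd c ` fst c"
begin

lemma dF: "((f \<circ> chart_inv c) has_derivative dF f c p) (at p)"
proof -
  have "Cn_on (Suc (Suc 0)) (snd c ` fst c) (f \<circ> chart_inv c)"
    using f c by (simp only: Cn_function_def numeral_2_eq_2)
  from Cn_on_Suc_has_derivative[OF this p] show ?thesis by (simp add: dF_def)
qed

lemma linear_dF: "linear (dF f c p)"
  by (rule has_derivative_linear[OF dF])

lemma D2F: "((\<lambda>q. dF f c q z) has_derivative D2F f c p z) (at p)"
proof -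
  have "Cn_on (Suc (Suc 0)) (snd c ` fst c) (f \<circ> chart_inv c)"
    using f c by (simp only: Cn_function_def numeral_2_eq_2)
  then have "Cn_on (Suc 0) (snd c ` fst c) (\<lambda>q. dF f c q z)"
    unfolding Cn_on.simps(2)[of "Suc 0"] dF_def by blast
  from Cn_on_Suc_has_derivative[OF this p] show ?thesis by (simp add: D2F_def)
qed

end

lemma D2F_sym:
  assumes c: "c \<in> atlas M" and p: "p \<in> snd c ` fst c"
  shows "D2F f c p u v = D2F f c p v u"
proof (rule second_derivative_symmetric[OF _ D2F[OF c p] D2F[OF c p]])
  show "\<forall>\<^sub>F y in nhds p. ((f \<circ> chart_inv c) has_derivative dF f c y) (at y)"
    using open_coords[OF c] p dF[OF c] unfolding eventually_nhds by blast
qed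

lemma dF_change:
  assumes c: "c \<in> atlas M" "y \<in> fst c" and d: "d \<in> atlas M" "y \<in> fst d"
  shows "dF f d (snd d y) (DT c d (snd c y) z) = dF f c (snd c y) z"
proof -
  have p: "snd c y \<in> overlap c d" "snd c y \<in> snd c ` fst c" and q: "snd d y \<in> snd d ` fst d"
    using c d by auto
  have "((\<lambda>p. (f \<circ> chart_inv d) (transition c d p)) has_derivative (\<lambda>z. dF f d (snd d y) (DT c d (snd c y) z))) (at (snd c y))"
    using has_derivative_compose[OF DT[OF c(1) d(1) p(1)], of "f \<circ> chart_inv d" "dF f d (snd d y)"]
      dF[OF d(1) q] c d by (simp add: transition_chart)
  then have "((f \<circ> chart_inv c) has_derivative (\<lambda>z. dF f d (snd d y) (DT c d (snd c y) z))) (at (snd c y))"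
    by (rule has_derivative_transform_within_open[OF _ open_overlap[OF c(1) d(1)] p(1)])
       (use c d in \<open>auto simp: transition_chart chart_inv_chart\<close>)
  from has_derivative_unique[OF this dF[OF c(1) p(2)]] show ?thesis by metis
qed

lemma metric_grad: "metric M y (grad M f y) v = dF f (chart_at M y) (snd (chart_at M y) y) v"
proof -
  have p: "snd (chart_at M y) y \<in> snd (chart_at M y) ` fst (chart_at M y)" using chart_at by auto
  from theI'[OF pos_def_represent[OF bilinear_metric metric_pos linear_dF[OF chart_at(1) p]]]
  show ?thesis unfolding grad_def dF_def by blast
qed

text \<open>The gradient field has to be differentiated in one chart, whereas \<open>grad\<close>
  lives in the preferred chart of each point; in every chart it represents the differential through
  the metric of that chart.\<close>

lemma grad_in_chart:
  assumes c: "c \<in> atlas M" "y \<in> fst c"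
  shows "g c (snd c y) (to_chart M c y (grad M f y)) z = dF f c (snd c y) z"
proof -
  have "g c (snd c y) (to_chart M c y (grad M f y)) z
    = g c (snd c y) (to_chart M c y (grad M f y)) (to_chart M c y (of_chart M c y z))"
    by (simp add: to_chart_of_chart c)
  also have "\<dots> = dF f (chart_at M y) (snd (chart_at M y) y) (of_chart M c y z)"
    by (simp add: g_to_chart c metric_grad)
  also have "\<dots> = dF f c (snd c y) z"
    unfolding of_chart_DT by (rule dF_change[OF c chart_at])
  finally show ?thesis .
qed

text \<open>Implicit differentiation of \<open>g c q (G q) z\<close> yields the derivative of the
  gradient coordinates, and metric compatibility moves the Christoffel term from the gradient to
  \<open>z\<close>, where it meets the differential of \<open>f\<close>.\<close>

lemma metric_Hess:
  assumes c: "c = chart_at M x" and p: "p = snd c x"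
  shows "metric M x (Hess M f x s) z = D2F f c p z s - dF f c p (Chr c p s z)"
proof -
  have cx: "c \<in> atlas M" "x \<in> fst c" using chart_at c by auto
  have pc: "p \<in> snd c ` fst c" using cx p by auto
  note U = open_coords[OF cx(1)]
  define G where "G q = to_chart M c (chart_inv c q) (grad M f (chart_inv c q))" for q
  have gG: "g c q (G q) z = dF f c q z" if "q \<in> snd c ` fst c" for q z
    using grad_in_chart[OF cx(1) chart_inv_mem(1)[OF cx(1) that]] chart_inv_mem(2)[OF cx(1) that] by (simp add: G_def)
  have Gp: "G p = grad M f x" using cx by (simp add: G_def p chart_inv_chart) (simp add: c to_chart_self)
  have gm: "g c p u v = metric M x u v" for u v by (simp add: p c g_chart_at)
  have "\<exists>W. (G has_derivative W) (at p) \<and> (\<forall>h z. g c p (W h) z = D2F f c p z h - dg c p (G p) z h)"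
  proof (rule pos_def_has_derivative)
    show "\<forall>\<^sub>F q in nhds p. bilinear (g c q)"
      using U pc bilinear_g[OF cx(1)] unfolding eventually_nhds by blast
    show "((\<lambda>q. g c q i j) has_derivative dg c p i j) (at p)" for i j by (rule dg[OF cx(1) pc])
    show "((\<lambda>q. g c q (G q) z) has_derivative D2F f c p z) (at p)" for z
      by (rule has_derivative_transform_within_open[OF D2F[OF cx(1) pc] U pc]) (simp add: gG)
  qed (rule g_pos[OF cx(1) pc])
  then obtain W where W: "(G has_derivative W) (at p)"
    "\<And>h z. g c p (W h) z = D2F f c p z h - dg c p (G p) z h" by blast
  have "Hess M f x s = W s + Chr c p s (grad M f x)"
    using frechet_derivative_at[OF W(1)]
    unfolding Hess_def c[symmetric] p[symmetric] christoffel_Chr G_def by simp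
  then have "metric M x (Hess M f x s) z = g c p (W s) z + g c p (Chr c p s (grad M f x)) z"
    by (simp add: bilinear_ladd[OF bilinear_metric] gm)
  also have "\<dots> = D2F f c p z s - g c p (G p) (Chr c p s z)"
    unfolding W(2) metric_compatible[OF cx(1) pc] by (simp add: Gp)
  also have "g c p (G p) (Chr c p s z) = dF f c p (Chr c p s z)" by (rule gG[OF pc])
  finally show ?thesis .
qed

text \<open>Both the second derivative in coordinates and the Christoffel form are symmetric. The
  gradient of the quadratic model relies on this.\<close>

lemma metric_Hess_sym: "metric M x (Hess M f x u) v = metric M x u (Hess M f x v)"
proof -
  have p: "snd (chart_at M x) x \<in> snd (chart_at M x) ` fst (chart_at M x)" using chart_at by auto
  show ?thesis
    unfolding metric_sym[of x u] metric_Hess[OF refl refl]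
    using D2F_sym[OF chart_at(1) p, of u v] Chr_sym[OF chart_at(1) p, of u v] by simp
qed

lemma linear_Hess: "linear (Hess M f x)"
proof -
  let ?c = "chart_at M x" and ?p = "snd (chart_at M x) x"
  have p: "?p \<in> snd ?c ` fst ?c" using chart_at by auto
  note H = metric_Hess[OF refl refl, of x]
  note lin = has_derivative_linear[OF D2F[OF chart_at(1) p]] linear_dF[OF chart_at(1) p]
  note bil = bilinear_Chr[OF chart_at(1) p]
  show ?thesis
  proof (rule linearI; rule pos_def_cancel[OF bilinear_metric[of x] metric_pos])
    show "metric M x (Hess M f x (u + v)) z = metric M x (Hess M f x u + Hess M f x v) z" for u v z
      by (simp add: H bilinear_ladd[OF bilinear_metric] bilinear_ladd[OF bil] lin linear_add)
    show "metric M x (Hess M f x (r *\<^sub>R u)) z = metric M x (r *\<^sub>R Hess M f x u) z" for r u z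
      by (simp add: H bilinear_lmul[OF bilinear_metric] bilinear_lmul[OF bil] lin linear_scale algebra_simps)
  qed auto
qed

end

lemma tgrad_eqI:
  assumes "(h has_derivative (\<lambda>z. metric M x w z)) (at u)"
  shows "tgrad M x h u = w"
  unfolding tgrad_def
proof (rule the_equality, rule assms)
  fix w' assume "(h has_derivative (\<lambda>z. metric M x w' z)) (at u)"
  from has_derivative_unique[OF this assms] show "w' = w"
    by (intro pos_def_cancel[OF bilinear_metric[of x] metric_pos]) (auto dest: fun_cong)
qed

text \<open>Every derivative is represented by some vector, so \<open>tgrad\<close> can be handled
  through the derivative without an explicit formula for it.\<close>

lemma metric_tgrad:
  assumes "(h has_derivative h') (at u)"
  shows "metric M x (tgrad M x h u) z = h' z"
proof -
  obtain w where w: "\<And>z. metric M x w z = h' z"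
    using pos_def_represent[OF bilinear_metric metric_pos has_derivative_linear[OF assms]] by blast
  then have "h' = (\<lambda>z. metric M x w z)" by auto
  then show ?thesis using tgrad_eqI[of h x w u] assms w by simp
qed

end

context complete_riemannian
begin

text \<open>The gradient \<open>w\<close> of the pullback is known near \<open>0\<close> through its
  inner products \<open>dF f c (\<phi> v) (\<Phi>' v z)\<close>. Their derivative at
  \<open>0\<close> is the second derivative of \<open>f\<close> in coordinates minus its
  differential on the Christoffel term that comes from \<open>\<Phi>'\<close>: exactly the form in
  \<open>metric_Hess\<close>.\<close>

lemma
  assumes f: "Cn_function 2 M f"
  shows tgrad_pullback_Exp: "tgrad M x (pullback f (Exp M) x) 0 = grad M f x"
    and tHess_pullback_Exp: "tHess M x (pullback f (Exp M) x) 0 = Hess M f x"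
proof -
  define c where "c = chart_at M x"
  define p where "p = snd c x"
  have cx: "c \<in> atlas M" "x \<in> fst c" using chart_at c_def by auto
  have pc: "p \<in> snd c ` fst c" using cx by (auto simp: p_def)
  define \<phi> where "\<phi> v = snd c (Exp M x v)" for v
  obtain \<delta> \<Phi>' where \<delta>: "\<delta> > 0" and in_c: "\<And>v. norm v < \<delta> \<Longrightarrow> Exp M x v \<in> fst c"
    and d\<phi>: "\<And>v. norm v < \<delta> \<Longrightarrow> (\<phi> has_derivative \<Phi>' v) (at v)"
    and \<Phi>'0: "\<And>z. \<Phi>' 0 z = z"
    and d\<Phi>': "\<And>z. ((\<lambda>v. \<Phi>' v z) has_derivative (\<lambda>u. - Chr c p u z)) (at 0)"
    using Exp_chart_derivative[OF c_def] unfolding \<phi>_def[abs_def] p_def by metis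
  have \<phi>0: "\<phi> 0 = p" by (simp add: \<phi>_def p_def Exp_0)
  have \<phi>c: "\<phi> v \<in> snd c ` fst c" if "norm v < \<delta>" for v using in_c[OF that] by (simp add: \<phi>_def)
  let ?h = "pullback f (Exp M) x"
  have dh: "(?h has_derivative (\<lambda>z. dF f c (\<phi> v) (\<Phi>' v z))) (at v)" if v: "norm v < \<delta>" for v
  proof (rule has_derivative_transform_within_open[OF has_derivative_compose[OF d\<phi>[OF v] dF[OF f cx(1) \<phi>c[OF v]]]])
    show "open (ball (0::'e) \<delta>)" "v \<in> ball 0 \<delta>" using v by auto
    show "(f \<circ> chart_inv c) (\<phi> y) = ?h y" if "y \<in> ball 0 \<delta>" for y
      using in_c[of y] that by (simp add: pullback_def \<phi>_def chart_inv_chart[OF cx(1)])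
  qed
  define w where "w v = tgrad M x ?h v" for v
  have w: "metric M x (w v) z = dF f c (\<phi> v) (\<Phi>' v z)" if "norm v < \<delta>" for v z
    unfolding w_def by (rule metric_tgrad[OF dh[OF that]])
  show "tgrad M x ?h 0 = grad M f x"
    using w[of 0] \<delta> metric_grad[OF f, of x, folded c_def p_def]
    by (intro pos_def_cancel[OF bilinear_metric[of x] metric_pos]) (auto simp: w_def \<phi>0 \<Phi>'0 p_def)
  \<comment> \<open>Implicit differentiation with the constant form \<open>metric M x\<close>, whose
    derivative is zero.\<close>
  have "\<exists>W. (w has_derivative W) (at 0) \<and> (\<forall>h z. metric M x (W h) z = (D2F f c p z h - dF f c p (Chr c p h z)) - 0)"
  proof (rule pos_def_has_derivative[where B="\<lambda>q. metric M x" and B'="\<lambda>i j h. 0" and l="\<lambda>z h. D2F f c p z h - dF f c p (Chr c p h z)"])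
    fix z
    have "((\<lambda>v. dF f c (\<phi> v) (\<Phi>' v z)) has_derivative
       (\<lambda>h. D2F f c p (\<Phi>' 0 z) (\<Phi>' 0 h) + dF f c (\<phi> 0) (- Chr c p h z))) (at 0)"
      by (rule linear_family_has_derivative[where L="dF f c" and p=\<phi> and v="\<lambda>v. \<Phi>' v z", OF open_coords[OF cx(1)] \<phi>c UNIV_I
            linear_dF[OF f cx(1)] _ d\<phi> d\<Phi>'])
         (use \<delta> D2F[OF f cx(1) pc] in \<open>simp_all add: \<phi>0\<close>)
    also have "(\<lambda>h. D2F f c p (\<Phi>' 0 z) (\<Phi>' 0 h) + dF f c (\<phi> 0) (- Chr c p h z)) =
        (\<lambda>h. D2F f c p z h - dF f c p (Chr c p h z))"
      by (simp add: \<phi>0 \<Phi>'0 linear_neg[OF linear_dF[OF f cx(1) pc]])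
    finally show "((\<lambda>v. metric M x (w v) z) has_derivative (\<lambda>h. D2F f c p z h - dF f c p (Chr c p h z))) (at 0)"
      by (rule has_derivative_transform_within_open[where s="ball 0 \<delta>"]) (use \<delta> in \<open>auto simp: w\<close>)
  qed (auto intro: bilinear_metric metric_pos)
  then obtain W where W: "(w has_derivative W) (at 0)"
    "\<And>h z. metric M x (W h) z = D2F f c p z h - dF f c p (Chr c p h z)" by auto
  have "W = Hess M f x"
    by (rule ext, rule pos_def_cancel[OF bilinear_metric[of x] metric_pos])
       (simp_all add: W(2) metric_Hess[OF f c_def p_def])
  then show "tHess M x ?h 0 = Hess M f x"
    using frechet_derivative_at[OF W(1)] by (simp add: tHess_def w_def[abs_def])
qed

section \<open>The ARC iteration\<close>

lemma rnorm_sq: "(rnorm M x u)\<^sup>2 = metric M x u u"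
  using metric_pos[of u x] bilinear_lzero[OF bilinear_metric, of x 0]
  by (cases "u = 0") (auto simp: rnorm_def)

lemma rnorm_nonneg: "0 \<le> rnorm M x u"
proof -
  have "0 \<le> metric M x u u" using rnorm_sq[of x u] by (metis zero_le_power2)
  then show ?thesis by (simp add: rnorm_def)
qed

lemma rnorm_eq_0: "rnorm M x u = 0 \<longleftrightarrow> u = 0"
  by (simp add: rnorm_def metric_self_eq_0)

text \<open>Cauchy-Schwarz: \<open>u\<close> minus its projection on \<open>v\<close> has
  nonnegative squared length.\<close>

lemma metric_le_rnorm: "metric M x u v \<le> rnorm M x u * rnorm M x v"
proof (cases "v = 0")
  case False
  let ?t = "metric M x u v / metric M x v v"
  have vv: "metric M x v v > 0" by (rule metric_pos[OF False])
  have "0 \<le> metric M x (u - ?t *\<^sub>R v) (u - ?t *\<^sub>R v)" by (metis rnorm_sq zero_le_power2)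
  also have "\<dots> = metric M x u u - (metric M x u v)\<^sup>2 / metric M x v v"
    using vv
    by (simp add: metric_diff_self bilinear_lmul[OF bilinear_metric] bilinear_rmul[OF bilinear_metric]
      power2_eq_square field_simps)
  finally have "(metric M x u v)\<^sup>2 \<le> (rnorm M x u * rnorm M x v)\<^sup>2"
    using vv by (simp add: power_mult_distrib rnorm_sq field_simps)
  then show ?thesis
    by (rule power2_le_imp_le) (simp add: rnorm_nonneg)
qed (simp add: bilinear_rzero[OF bilinear_metric] rnorm_nonneg)

lemma rnorm_triangle: "rnorm M x (u + v) \<le> rnorm M x u + rnorm M x v"
proof (rule power2_le_imp_le)
  show "(rnorm M x (u + v))\<^sup>2 \<le> (rnorm M x u + rnorm M x v)\<^sup>2"
    using metric_le_rnorm[of x u v]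
    by (simp add: rnorm_sq power2_sum bilinear_ladd[OF bilinear_metric] bilinear_radd[OF bilinear_metric]
      metric_sym[of x v u])
qed (simp add: rnorm_nonneg)

lemma rnorm_scaleR: "rnorm M x (r *\<^sub>R u) = \<bar>r\<bar> * rnorm M x u"
  by (simp add: rnorm_def bilinear_lmul[OF bilinear_metric] bilinear_rmul[OF bilinear_metric]
      real_sqrt_mult mult.assoc[symmetric])

lemma metric_self_has_derivative:
  "((\<lambda>s. metric M x s s) has_derivative (\<lambda>z. 2 * metric M x s z)) (at s)"
proof -
  have bb: "bounded_bilinear (metric M x)" using bilinear_metric by (simp add: bilinear_conv_bounded_bilinear)
  show ?thesis
    using bounded_bilinear.FDERIV[OF bb has_derivative_ident[of "at s"] has_derivative_ident[of "at s"]]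
    by (simp add: metric_sym[of x _ s])
qed

lemma rnorm_cube_has_derivative:
  "((\<lambda>s. rnorm M x s ^ 3) has_derivative (\<lambda>z. 3 * rnorm M x s * metric M x s z)) (at s)"
proof (cases "s = 0")
  case False
  have Q: "metric M x s s > 0" by (rule metric_pos[OF False])
  define n where "n = sqrt (metric M x s s)"
  have n: "n > 0" using Q by (simp add: n_def)
  have "((\<lambda>s. sqrt (metric M x s s)) has_derivative (\<lambda>z. (2 * metric M x s z) * (inverse n / 2))) (at s)"
    using DERIV_compose_FDERIV[OF DERIV_real_sqrt[OF Q] metric_self_has_derivative] by (simp add: n_def)
  from has_derivative_power[OF this, of 3]
  have "((\<lambda>s. rnorm M x s ^ 3) has_derivative
    (\<lambda>z. 3 * ((2 * metric M x s z) * (inverse n / 2)) * n\<^sup>2)) (at s)"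
    by (simp add: rnorm_def n_def)
  also have "(\<lambda>z. 3 * ((2 * metric M x s z) * (inverse n / 2)) * n\<^sup>2) = (\<lambda>z. 3 * rnorm M x s * metric M x s z)"
    using n by (simp add: rnorm_def n_def[symmetric] power2_eq_square fun_eq_iff field_simps)
  finally show ?thesis .
next
  case True
  define b where "b = (\<Sum>i\<in>Basis. \<Sum>j\<in>Basis. norm (metric M x i j))"
  have b: "0 \<le> b" by (auto simp: b_def intro!: sum_nonneg)
  have le: "rnorm M x u \<le> sqrt b * norm u" for u
  proof (rule power2_le_imp_le)
    have "(sqrt b * norm u)\<^sup>2 = b * (norm u)\<^sup>2" using b by (simp add: power_mult_distrib)
    then show "(rnorm M x u)\<^sup>2 \<le> (sqrt b * norm u)\<^sup>2"
      using bilinear_norm_le_sum[OF bilinear_metric, of x u u, folded b_def]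
      by (simp add: rnorm_sq power2_eq_square[of "norm u"])
  qed (use b in simp)
  have "((\<lambda>u. rnorm M x u ^ 3) has_derivative (\<lambda>z. 0)) (at 0)"
  \<comment> \<open>A one-element index set, since a single majorant suffices; on the unit ball a
    cube is at most a square.\<close>
  proof (rule has_derivative_zero_of_bound[of "{()}" "\<lambda>_ u. u \<bullet> u"])
    show "((\<lambda>u::'e. u \<bullet> u) has_derivative (\<lambda>h. 0)) (at 0)"
      by (auto intro!: derivative_eq_intros)
    have "\<forall>\<^sub>F u in at 0. norm (u::'e) < 1"
      by (intro order_tendstoD(2)[OF tendsto_norm_zero[OF tendsto_ident_at]]) simp
    then show "\<forall>\<^sub>F u in at 0. norm (rnorm M x u ^ 3) \<le> sqrt b ^ 3 * (\<Sum>i\<in>{()}. \<bar>u \<bullet> u\<bar>)"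
    proof eventually_elim
      case (elim u)
      have "norm (rnorm M x u ^ 3) = rnorm M x u ^ 3" using rnorm_nonneg by simp
      also have "\<dots> \<le> (sqrt b * norm u) ^ 3" by (intro power_mono le rnorm_nonneg)
      also have "\<dots> = sqrt b ^ 3 * ((norm u)\<^sup>2 * norm u)" by (simp add: power_mult_distrib power3_eq_cube power2_eq_square)
      also have "\<dots> \<le> sqrt b ^ 3 * ((norm u)\<^sup>2 * 1)" using b elim by (intro mult_left_mono) auto
      finally show ?case by (simp add: power2_norm_eq_inner)
    qed
  qed (simp_all add: rnorm_def bilinear_lzero[OF bilinear_metric])
  then show ?thesis using True by (simp add: bilinear_lzero[OF bilinear_metric])
qed

end

text \<open>Two potentials: \<open>F\<close> pays \<open>d\<close> for every success, and
  \<open>ln \<sigma>\<close> loses at most \<open>\<bar>ln \<gamma>1\<bar>\<close> in a success and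
  gains at least \<open>ln \<gamma>2\<close> in a failure. As it ends at or below
  \<open>ln \<sigma>max\<close>, failures are bounded by a multiple of the successes plus a
  constant.\<close>

lemma iteration_count:
  fixes F \<sigma> :: "nat \<Rightarrow> real" and succ :: "nat \<Rightarrow> bool"
  assumes succ: "\<And>k. \<lbrakk>k < N; succ k\<rbrakk> \<Longrightarrow> F k - F (Suc k) \<ge> d \<and> \<sigma> (Suc k) \<ge> \<gamma>1 * \<sigma> k"
    and fail: "\<And>k. \<lbrakk>k < N; \<not> succ k\<rbrakk> \<Longrightarrow> F (Suc k) = F k \<and> \<sigma> (Suc k) \<ge> \<gamma>2 * \<sigma> k"
    and low: "\<And>k. F k \<ge> flow" and \<sigma>0: "\<sigma> 0 > 0" and \<sigma>N: "\<sigma> N \<le> \<sigma>max"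
    and \<gamma>: "0 < \<gamma>1" "\<gamma>1 < 1" "1 < \<gamma>2"
  defines "S \<equiv> card {k. k < N \<and> succ k}"
  shows "real S * d \<le> F 0 - flow"
    and "real N \<le> (1 + \<bar>ln \<gamma>1\<bar> / ln \<gamma>2) * real S + 1 / ln \<gamma>2 * ln (\<sigma>max / \<sigma> 0)"
proof -
  define c where "c n = card {k. k < n \<and> succ k}" for n
  have cS: "c (Suc n) = (if succ n then Suc (c n) else c n)" for n
  proof -
    have "{k. k < Suc n \<and> succ k} = (if succ n then insert n {k. k < n \<and> succ k} else {k. k < n \<and> succ k})"
      by (auto simp: less_Suc_eq)
    then show ?thesis by (simp add: c_def)
  qed
  have ind: "real (c n) * d \<le> F 0 - F n \<and> 0 < \<sigma> n \<and>
     ln (\<sigma> n) \<ge> ln (\<sigma> 0) + real (c n) * ln \<gamma>1 + (real n - real (c n)) * ln \<gamma>2" if "n \<le> N" for n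
    using that
  proof (induction n)
    case 0
    then show ?case using \<sigma>0 by (simp add: c_def)
  next
    case (Suc n)
    then have IH: "real (c n) * d \<le> F 0 - F n" "0 < \<sigma> n"
      "ln (\<sigma> n) \<ge> ln (\<sigma> 0) + real (c n) * ln \<gamma>1 + (real n - real (c n)) * ln \<gamma>2" and n: "n < N" by auto
    have ln_le: "0 < \<sigma> (Suc n) \<and> ln (\<sigma> (Suc n)) \<ge> ln \<gamma> + ln (\<sigma> n)" if "\<sigma> (Suc n) \<ge> \<gamma> * \<sigma> n" "\<gamma> > 0" for \<gamma>
    proof -
      have "0 < \<gamma> * \<sigma> n" using that IH by simp
      then have "ln (\<gamma> * \<sigma> n) \<le> ln (\<sigma> (Suc n))" "0 < \<sigma> (Suc n)" using that by (auto intro: less_le_trans)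
      then show ?thesis using that IH by (simp add: ln_mult)
    qed
    show ?case
    proof (cases "succ n")
      case True
      from succ[OF n True] ln_le[of \<gamma>1] IH \<gamma> show ?thesis by (simp add: cS True algebra_simps)
    next
      case False
      from fail[OF n False] ln_le[of \<gamma>2] IH \<gamma> show ?thesis by (simp add: cS False algebra_simps)
    qed
  qed
  have S: "S = c N" by (simp add: S_def c_def)
  show "real S * d \<le> F 0 - flow" using ind[of N] low[of N] by (simp add: S)
  have l2: "ln \<gamma>2 > 0" using \<gamma> by simp
  have "ln (\<sigma> N) \<le> ln \<sigma>max" using ind[of N] \<sigma>N by (simp add: less_le_trans)
  then have "(real N - real S) * ln \<gamma>2 \<le> ln \<sigma>max - ln (\<sigma> 0) - real S * ln \<gamma>1" using ind[of N] by (simp add: S)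
  also have "\<dots> = ln (\<sigma>max / \<sigma> 0) + \<bar>ln \<gamma>1\<bar> * real S"
    using ind[of N] \<sigma>N \<sigma>0 \<gamma> by (simp add: ln_div less_le_trans)
  finally have "real N - real S \<le> (ln (\<sigma>max / \<sigma> 0) + \<bar>ln \<gamma>1\<bar> * real S) / ln \<gamma>2"
    using l2 by (simp add: field_simps)
  then show "real N \<le> (1 + \<bar>ln \<gamma>1\<bar> / ln \<gamma>2) * real S + 1 / ln \<gamma>2 * ln (\<sigma>max / \<sigma> 0)"
    by (simp add: algebra_simps add_divide_distrib)
qed

section \<open>Estimates along a run of the algorithm\<close>

locale arc = complete_riemannian M
  for M :: "('m::{t2_space,second_countable_topology}, 'e::euclidean_space) riem" +
  fixes f :: "'m \<Rightarrow> real"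
    and x :: "nat \<Rightarrow> 'm" and s :: "nat \<Rightarrow> 'e" and \<sigma> :: "nat \<Rightarrow> real"
    and \<theta> \<sigma>min \<eta>1 \<eta>2 \<gamma>1 \<gamma>2 \<gamma>3 flow L L' :: real
  assumes f: "Cn_function 2 M f"
    and \<theta>: "\<theta> > 0" and \<sigma>min: "\<sigma>min > 0"
    and \<eta>: "0 < \<eta>1" "\<eta>1 \<le> \<eta>2" "\<eta>2 < 1"
    and \<gamma>: "0 < \<gamma>1" "\<gamma>1 < 1" "1 < \<gamma>2" "\<gamma>2 < \<gamma>3"
    and run: "arc_run M f (Exp M) \<theta> \<sigma>min \<eta>1 \<eta>2 \<gamma>1 \<gamma>2 \<gamma>3 x s \<sigma>"
    and A1: "\<And>y. f y \<ge> flow"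
    and A2: "\<And>k. executed s k \<Longrightarrow>
      pullback f (Exp M) (x k) (s k) - taylor2 M f (Exp M) (x k) (s k)
        \<le> L / 6 * rnorm M (x k) (s k) ^ 3"
    and A3: "\<And>k. successful M f (Exp M) \<eta>1 x s \<sigma> k \<Longrightarrow>
      rnorm M (x k) (inv (transport M (x k) (s k)) (grad M f (Exp M (x k) (s k)))
                       - grad M f (x k) - Hess M f (x k) (s k))
        \<le> L' / 2 * (rnorm M (x k) (s k))\<^sup>2"
begin

abbreviation r :: "nat \<Rightarrow> real" where "r k \<equiv> rnorm M (x k) (s k)"
abbreviation m :: "nat \<Rightarrow> 'e \<Rightarrow> real" where "m k \<equiv> arc_model M f (Exp M) (x k) (\<sigma> k)"
abbreviation \<rho> :: "nat \<Rightarrow> real" where "\<rho> k \<equiv> arc_ratio M f (Exp M) (x k) (\<sigma> k) (s k)"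
abbreviation success :: "nat \<Rightarrow> bool" where "success \<equiv> successful M f (Exp M) \<eta>1 x s \<sigma>"
abbreviation gradnorm :: "nat \<Rightarrow> real" where "gradnorm k \<equiv> rnorm M (x k) (grad M f (x k))"
abbreviation \<sigma>max :: real where "\<sigma>max \<equiv> max (\<sigma> 0) (L * \<gamma>3 / (2 * (1 - \<eta>2)))"

lemma step:
  assumes "executed s k"
  shows "m k (s k) \<le> m k 0"
    and "rnorm M (x k) (tgrad M (x k) (m k) (s k)) \<le> \<theta> * (r k)\<^sup>2"
    and "s k \<noteq> 0 \<Longrightarrow> x (Suc k) = (if \<rho> k \<ge> \<eta>1 then Exp M (x k) (s k) else x k)"
    and "s k \<noteq> 0 \<Longrightarrow> \<sigma> (Suc k) \<in> (if \<rho> k \<ge> \<eta>2 then {max \<sigma>min (\<gamma>1 * \<sigma> k) .. \<sigma> k}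
                            else if \<rho> k \<ge> \<eta>1 then {\<sigma> k .. \<gamma>2 * \<sigma> k}
                            else {\<gamma>2 * \<sigma> k .. \<gamma>3 * \<sigma> k})"
  using run assms unfolding arc_run_def Let_def by metis+

lemma taylor2_Exp:
  "taylor2 M f (Exp M) y u = f y + metric M y u (grad M f y) + 1/2 * metric M y u (Hess M f y u)"
  by (simp add: taylor2_def tgrad_pullback_Exp[OF f] tHess_pullback_Exp[OF f]) (simp add: pullback_def Exp_0)

lemma model_0: "m k 0 = f (x k)"
  by (simp add: arc_model_def taylor2_Exp bilinear_lzero[OF bilinear_metric] rnorm_def)

text \<open>By symmetry of the Hessian the two halves of the derivative of the quadratic term agree;
  the cubic term contributes a radial gradient.\<close>

lemma tgrad_model: "tgrad M (x k) (m k) u = grad M f (x k) + Hess M f (x k) u + (\<sigma> k * rnorm M (x k) u) *\<^sub>R u"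
proof (rule tgrad_eqI)
  let ?g = "metric M (x k)" and ?H = "Hess M f (x k)"
  have bb: "bounded_bilinear ?g" using bilinear_metric by (simp add: bilinear_conv_bounded_bilinear)
  have bH: "bounded_linear ?H" using linear_Hess[OF f] by (simp add: linear_conv_bounded_linear)
  have d1: "((\<lambda>u. ?g u (grad M f (x k))) has_derivative (\<lambda>z. ?g z (grad M f (x k)))) (at u)"
    by (rule bounded_linear.has_derivative[OF bounded_bilinear.bounded_linear_left[OF bb] has_derivative_ident])
  have d2: "((\<lambda>u. ?g u (?H u)) has_derivative (\<lambda>z. ?g u (?H z) + ?g z (?H u))) (at u)"
    by (rule bounded_bilinear.FDERIV[OF bb has_derivative_ident bounded_linear_imp_has_derivative[OF bH]])
  have "(m k has_derivative (\<lambda>z. 0 + ?g z (grad M f (x k)) + 1/2 * (?g u (?H z) + ?g z (?H u))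
     + \<sigma> k / 3 * (3 * rnorm M (x k) u * ?g u z))) (at u)"
    unfolding arc_model_def[abs_def] taylor2_Exp
    by (intro has_derivative_add has_derivative_mult_right has_derivative_const d1 d2 rnorm_cube_has_derivative)
  also have "(\<lambda>z. 0 + ?g z (grad M f (x k)) + 1/2 * (?g u (?H z) + ?g z (?H u))
     + \<sigma> k / 3 * (3 * rnorm M (x k) u * ?g u z)) =
     (\<lambda>z. ?g (grad M f (x k) + ?H u + (\<sigma> k * rnorm M (x k) u) *\<^sub>R u) z)"
    using metric_Hess_sym[OF f, of "x k" u]
    by (simp add: fun_eq_iff bilinear_ladd[OF bilinear_metric] bilinear_lmul[OF bilinear_metric]
      metric_sym[of _ _ "grad M f (x k)"] metric_sym[of _ _ "?H u"])
  finally show "(m k has_derivative ?g (grad M f (x k) + ?H u + (\<sigma> k * rnorm M (x k) u) *\<^sub>R u)) (at u)" .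
qed

text \<open>At a zero step the model gradient is the gradient of \<open>f\<close>, and the tolerance
  \<open>\<theta> * (r k)\<^sup>2\<close> is zero. So the algorithm terminates only at critical
  points.\<close>

lemma gradnorm_eq_0:
  assumes "executed s k" "s k = 0"
  shows "gradnorm k = 0"
proof -
  have r0: "r k = 0" using assms by (simp add: rnorm_eq_0)
  have "tgrad M (x k) (m k) (s k) = grad M f (x k)"
    unfolding tgrad_model using assms(2) linear_0[OF linear_Hess[OF f]] by simp
  then have "gradnorm k \<le> 0" using step(2)[OF assms(1)] r0 by simp
  then show ?thesis using rnorm_nonneg[of "x k" "grad M f (x k)"] by simp
qed

lemma executed_Suc: "executed s (Suc k) \<longleftrightarrow> executed s k \<and> s k \<noteq> 0"
  by (auto simp: executed_def less_Suc_eq)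

lemma \<sigma>_ge: "executed s k \<Longrightarrow> \<sigma> k \<ge> \<sigma>min"
proof (induction k)
  case 0
  then show ?case using run by (simp add: arc_run_def)
next
  case (Suc k)
  then have k: "executed s k" "s k \<noteq> 0" "\<sigma> k \<ge> \<sigma>min" by (auto simp: executed_Suc)
  have "\<gamma>2 * \<sigma> k \<ge> 1 * \<sigma> k" using k(3) \<gamma> \<sigma>min by (intro mult_right_mono) auto
  then show ?case using step(4)[OF k(1,2)] k(3) by (auto split: if_splits)
qed

lemma r_pos: "s k \<noteq> 0 \<Longrightarrow> r k > 0"
  using rnorm_nonneg[of "x k" "s k"] rnorm_eq_0[of "x k" "s k"] by linarith

text \<open>The extra cubic term in the ratio cancels that of the model, so the denominator is the
  decrease predicted by the Taylor polynomial alone. Since the model value does not increase, that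
  extra term is also a lower bound.\<close>

lemma denominator:
  assumes "executed s k"
  shows "m k 0 - m k (s k) + \<sigma> k / 3 * r k ^ 3 \<ge> \<sigma> k / 3 * r k ^ 3"
    and "m k 0 - m k (s k) + \<sigma> k / 3 * r k ^ 3 = f (x k) - taylor2 M f (Exp M) (x k) (s k)"
  using step(1)[OF assms] by (simp_all add: model_0) (simp add: arc_model_def)

text \<open>\<open>1 - \<rho> k\<close> times the denominator is the Taylor error, at most
  \<open>L / 6 * r k ^ 3\<close> by (A2), while the denominator is at least
  \<open>\<sigma> k / 3 * r k ^ 3\<close>. A ratio below \<open>\<eta>2\<close> thus leaves
  \<open>(1 - \<eta>2) * \<sigma> k / 3 \<le> L / 6\<close>.\<close>

lemma \<sigma>_bound_of_low_ratio:
  assumes k: "executed s k" "s k \<noteq> 0" and low: "\<rho> k < \<eta>2"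
  shows "\<sigma> k \<le> L / (2 * (1 - \<eta>2))"
proof -
  define D where "D = f (x k) - taylor2 M f (Exp M) (x k) (s k)"
  have \<sigma>: "\<sigma> k > 0" using \<sigma>_ge[OF k(1)] \<sigma>min by simp
  have r3: "r k ^ 3 > 0" using r_pos[OF k(2)] by simp
  have D: "\<sigma> k / 3 * r k ^ 3 \<le> D" using denominator[OF k(1)] by (simp add: D_def)
  have Dpos: "D > 0" by (rule less_le_trans[OF _ D]) (use \<sigma> r3 in simp)
  have \<rho>: "\<rho> k = (f (x k) - f (Exp M (x k) (s k))) / D"
    unfolding arc_ratio_def denominator(2)[OF k(1)] D_def ..
  have "(1 - \<eta>2) * \<sigma> k / 3 * r k ^ 3 = (1 - \<eta>2) * (\<sigma> k / 3 * r k ^ 3)" by simp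
  also have "\<dots> \<le> (1 - \<eta>2) * D" using \<eta> D by (intro mult_left_mono) auto
  also have "\<dots> \<le> (1 - \<rho> k) * D" using low Dpos by (intro mult_right_mono) auto
  also have "(1 - \<rho> k) * D = D - (f (x k) - f (Exp M (x k) (s k)))"
  proof -
    have "\<rho> k * D = f (x k) - f (Exp M (x k) (s k))" using Dpos by (simp add: \<rho>)
    then show ?thesis by (simp only: left_diff_distrib mult_1)
  qed
  also have "\<dots> = pullback f (Exp M) (x k) (s k) - taylor2 M f (Exp M) (x k) (s k)"
    by (simp add: D_def pullback_def)
  also have "\<dots> \<le> L / 6 * r k ^ 3" by (rule A2[OF k(1)])
  finally have "(1 - \<eta>2) * \<sigma> k / 3 \<le> L / 6" by (rule mult_right_le_imp_le[OF _ r3])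
  then show ?thesis using \<eta> by (simp add: field_simps)
qed

text \<open>\<open>\<sigma>\<close> can increase only after a ratio below \<open>\<eta>2\<close>,
  when it was at most \<open>L / (2 * (1 - \<eta>2))\<close>, and then by a factor of at most
  \<open>\<gamma>3\<close>.\<close>

lemma \<sigma>_le_max: "executed s k \<Longrightarrow> \<sigma> k \<le> \<sigma>max"
proof (induction k)
  case (Suc k)
  then have k: "executed s k" "s k \<noteq> 0" "\<sigma> k \<le> \<sigma>max" by (auto simp: executed_Suc)
  show ?case
  proof (cases "\<rho> k \<ge> \<eta>2")
    case True
    then show ?thesis using step(4)[OF k(1,2)] k(3) by (auto split: if_splits)
  next
    case False
    have \<sigma>: "\<sigma> k > 0" using \<sigma>_ge[OF k(1)] \<sigma>min by simp
    have "\<sigma> (Suc k) \<le> \<gamma>3 * \<sigma> k"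
    proof -
      have "\<gamma>2 * \<sigma> k \<le> \<gamma>3 * \<sigma> k" using \<gamma> \<sigma> by (intro mult_right_mono) auto
      then show ?thesis using step(4)[OF k(1,2)] False by (auto split: if_splits)
    qed
    also have "\<dots> \<le> \<gamma>3 * (L / (2 * (1 - \<eta>2)))"
      using \<sigma>_bound_of_low_ratio[OF k(1,2)] False \<gamma> by (intro mult_left_mono) auto
    finally show ?thesis by (simp add: mult.commute max.coboundedI2)
  qed
qed simp

lemma success_facts:
  assumes "success k"
  shows "executed s k" "s k \<noteq> 0" "\<rho> k \<ge> \<eta>1" "x (Suc k) = Exp M (x k) (s k)"
  using assms step(3)[of k] by (auto simp: successful_def)

text \<open>The ratio compares the actual decrease with a denominator of at least
  \<open>\<sigma>min / 3\<close> times the cube of the step length.\<close>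

lemma success_decrease:
  assumes k: "success k"
  shows "f (x k) - f (x (Suc k)) \<ge> \<eta>1 * \<sigma>min / 3 * r k ^ 3"
proof -
  note sf = success_facts[OF k]
  define D where "D = m k 0 - m k (s k) + \<sigma> k / 3 * r k ^ 3"
  have r3: "r k ^ 3 > 0" using r_pos[OF sf(2)] by simp
  have "\<sigma>min / 3 * r k ^ 3 \<le> \<sigma> k / 3 * r k ^ 3" using r3 \<sigma>_ge[OF sf(1)] by (intro mult_right_mono) auto
  also have "\<dots> \<le> D" unfolding D_def by (rule denominator(1)[OF sf(1)])
  finally have D: "\<sigma>min / 3 * r k ^ 3 \<le> D" .
  have Dpos: "D > 0" by (rule less_le_trans[OF _ D]) (use \<sigma>min r3 in simp)
  have "\<eta>1 * (\<sigma>min / 3 * r k ^ 3) \<le> \<eta>1 * D" using D \<eta> by (intro mult_left_mono) auto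
  also have "\<dots> \<le> f (x k) - f (x (Suc k))"
    using sf(3) Dpos unfolding arc_ratio_def D_def[symmetric] sf(4) by (simp add: pos_le_divide_eq)
  finally show ?thesis by simp
qed

lemma success_gradnorm:
  assumes k: "success k"
  shows "gradnorm (Suc k) \<le> (L' / 2 + \<theta> + \<sigma>max) * (r k)\<^sup>2"
proof -
  note sf = success_facts[OF k]
  let ?g = "grad M f (x k)" and ?H = "Hess M f (x k) (s k)"
  let ?p = "inv (transport M (x k) (s k)) (grad M f (x (Suc k)))"
  let ?t = "tgrad M (x k) (m k) (s k)"
  have \<sigma>: "\<sigma> k > 0" using \<sigma>_ge[OF sf(1)] \<sigma>min by simp
  have "gradnorm (Suc k) = rnorm M (x k) ?p"
    by (simp add: rnorm_inv_transport sf(4))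
  \<comment> \<open>The three parts are the remainder bounded by (A3), the model gradient bounded by
    the solver tolerance, and minus the gradient of the cubic regularizer, of norm
    \<open>\<sigma> k * (r k)\<^sup>2\<close>.\<close>
  also have "?p = (?p - ?g - ?H) + ?t + (- (\<sigma> k * r k)) *\<^sub>R s k"
    by (simp add: tgrad_model)
  also have "rnorm M (x k) \<dots> \<le> rnorm M (x k) (?p - ?g - ?H) + rnorm M (x k) ?t + rnorm M (x k) ((- (\<sigma> k * r k)) *\<^sub>R s k)"
    by (intro order_trans[OF rnorm_triangle] add_mono rnorm_triangle order_refl)
  also have "rnorm M (x k) ((- (\<sigma> k * r k)) *\<^sub>R s k) = \<sigma> k * r k * r k"
    using \<sigma> rnorm_nonneg[of "x k" "s k"] unfolding rnorm_scaleR by (simp add: abs_mult)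
  also have "rnorm M (x k) (?p - ?g - ?H) + rnorm M (x k) ?t + \<sigma> k * r k * r k
     \<le> L' / 2 * (r k)\<^sup>2 + \<theta> * (r k)\<^sup>2 + \<sigma> k * r k * r k"
    using A3[OF k] step(2)[OF sf(1)] unfolding sf(4) by (intro add_mono order_refl)
  also have "\<dots> = (L' / 2 + \<theta> + \<sigma> k) * (r k)\<^sup>2" by (simp add: power2_eq_square algebra_simps)
  also have "\<dots> \<le> (L' / 2 + \<theta> + \<sigma>max) * (r k)\<^sup>2"
    using \<sigma>_le_max[OF sf(1)] by (intro mult_right_mono add_left_mono) auto
  finally show ?thesis .
qed

lemma failure:
  assumes "executed s k" "s k \<noteq> 0" "\<not> success k"
  shows "x (Suc k) = x k" "\<sigma> (Suc k) \<ge> \<gamma>2 * \<sigma> k"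
  using assms step(3,4)[OF assms(1,2)] \<eta> by (auto simp: successful_def split: if_splits)

lemma success_\<sigma>:
  assumes "success k"
  shows "\<sigma> (Suc k) \<ge> \<gamma>1 * \<sigma> k"
proof -
  note sf = success_facts[OF assms]
  have "\<gamma>1 * \<sigma> k \<le> 1 * \<sigma> k" using \<gamma> \<sigma>_ge[OF sf(1)] \<sigma>min by (intro mult_right_mono) auto
  then show ?thesis using step(4)[OF sf(1,2)] sf(3) by (auto split: if_splits)
qed

lemma f_decreasing: "executed s k \<Longrightarrow> f (x k) \<le> f (x 0)"
proof (induction k)
  case (Suc k)
  then have k: "executed s k" "s k \<noteq> 0" "f (x k) \<le> f (x 0)" by (auto simp: executed_Suc)
  show ?case
  proof (cases "success k")
    case True
    have "0 \<le> \<eta>1 * \<sigma>min / 3 * r k ^ 3" using \<eta> \<sigma>min rnorm_nonneg by simp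
    then show ?thesis using success_decrease[OF True] k(3) by simp
  next
    case False
    then show ?thesis using failure(1)[OF k(1,2)] k(3) by simp
  qed
qed simp

section \<open>From single iterations to the complexity bound\<close>

definition K1 :: "real \<Rightarrow> real" where
  "K1 \<epsilon> = 3 * (f (x 0) - flow) / (\<eta>1 * \<sigma>min) * (L' / 2 + \<theta> + \<sigma>max) powr (3/2) * (1 / \<epsilon> powr (3/2))"

text \<open>\<open>powr\<close> is nonnegative for every real base; the remaining signs come from
  (A1) and the positive parameters.\<close>

lemma K1_nonneg: "0 \<le> K1 \<epsilon>"
  using A1[of "x 0"] \<eta> \<sigma>min by (auto simp: K1_def intro!: mult_nonneg_nonneg divide_nonneg_pos)

text \<open>Large gradients at the \<open>N + 1\<close> indices up to \<open>N\<close> concern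
  \<open>N\<close> iterations: a success at \<open>k < N\<close> leaves a large gradient at
  \<open>Suc k\<close>, which forces a long step.\<close>

lemma count:
  assumes \<epsilon>: "\<epsilon> > 0" and large: "\<And>k. k \<le> N \<Longrightarrow> executed s k \<and> gradnorm k > \<epsilon>"
  shows "real N \<le> (1 + \<bar>ln \<gamma>1\<bar> / ln \<gamma>2) * K1 \<epsilon> + 1 / ln \<gamma>2 * ln (\<sigma>max / \<sigma> 0)"
proof -
  define C where "C = L' / 2 + \<theta> + \<sigma>max"
  \<comment> \<open>The decrease in a success with
    \<open>(r k)\<^sup>2 \<ge> \<epsilon> / C\<close>; the power \<open>3/2\<close> turns this into
    a bound on the cube.\<close>
  define d where "d = \<eta>1 * \<sigma>min / 3 * (\<epsilon> / C) powr (3/2)"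
  define S where "S = card {k. k < N \<and> success k}"
  have run_N: "executed s k" "s k \<noteq> 0" if "k < N" for k
    using large[of "Suc k"] that by (auto simp: executed_Suc)
  \<comment> \<open>Positivity of \<open>C\<close> comes together with the step bound, from a
    gradient that is positive and at most \<open>C * (r k)\<^sup>2\<close>.\<close>
  have Cr: "C > 0 \<and> \<epsilon> / C \<le> (r k)\<^sup>2" if k: "k < N" "success k" for k
  proof -
    have *: "\<epsilon> < C * (r k)\<^sup>2"
      using large[of "Suc k"] success_gradnorm[OF k(2)] k(1) by (simp add: C_def)
    have "0 < (r k)\<^sup>2" using r_pos[OF run_N(2)[OF k(1)]] by simp
    moreover have "0 < C * (r k)\<^sup>2" using * \<epsilon> by simp
    ultimately have "C > 0" by (simp add: zero_less_mult_iff)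
    then show ?thesis using * by (simp add: field_simps)
  qed
  have decrease: "f (x k) - f (x (Suc k)) \<ge> d" if k: "k < N" "success k" for k
  proof -
    have rp: "r k > 0" by (rule r_pos[OF run_N(2)[OF k(1)]])
    have "(\<epsilon> / C) powr (3/2) \<le> ((r k)\<^sup>2) powr (3/2)"
      using Cr[OF k] \<epsilon> by (intro powr_mono2) auto
    also have "(r k)\<^sup>2 = r k powr 2" using rp by simp
    also have "(r k powr 2) powr (3/2) = r k ^ 3" unfolding powr_powr using rp by simp
    finally have "d \<le> \<eta>1 * \<sigma>min / 3 * r k ^ 3"
      unfolding d_def using \<eta> \<sigma>min by (intro mult_left_mono) auto
    then show ?thesis using success_decrease[OF k(2)] by simp
  qed
  have \<sigma>0: "\<sigma> 0 > 0" using run \<sigma>min by (simp add: arc_run_def)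
  have bounds: "real S * d \<le> f (x 0) - flow"
    "real N \<le> (1 + \<bar>ln \<gamma>1\<bar> / ln \<gamma>2) * real S + 1 / ln \<gamma>2 * ln (\<sigma>max / \<sigma> 0)"
    unfolding S_def
    using iteration_count[where N=N and succ=success and F="\<lambda>k. f (x k)" and d=d and \<sigma>=\<sigma>
        and ?\<gamma>1.0=\<gamma>1 and ?\<gamma>2.0=\<gamma>2 and flow=flow and \<sigma>max=\<sigma>max]
      decrease success_\<sigma> failure run_N A1 \<sigma>0 \<sigma>_le_max large \<gamma> by auto
  have "real S \<le> K1 \<epsilon>"
  proof (cases "S = 0")
    case False
    then obtain k where "k < N" "success k" unfolding S_def by (metis (mono_tags, lifting) card.empty empty_Collect_eq)
    then have C: "C > 0" using Cr by blast
    have "K1 \<epsilon> = 3 * (f (x 0) - flow) / (\<eta>1 * \<sigma>min) * C powr (3/2) * (1 / \<epsilon> powr (3/2))"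
      unfolding K1_def C_def ..
    moreover have "d = \<eta>1 * \<sigma>min / 3 * (\<epsilon> powr (3/2) / C powr (3/2))"
      unfolding d_def using C \<epsilon> by (simp add: powr_divide)
    moreover have "C powr (3/2) > 0" "\<epsilon> powr (3/2) > 0" using C \<epsilon> by simp_all
    ultimately have "d * K1 \<epsilon> = f (x 0) - flow" using \<eta> \<sigma>min by simp
    moreover have "d > 0" using \<eta> \<sigma>min \<epsilon> C by (simp add: d_def)
    ultimately show ?thesis using bounds(1) by (metis mult.commute mult_le_cancel_left_pos)
  qed (simp add: K1_nonneg)
  then have "(1 + \<bar>ln \<gamma>1\<bar> / ln \<gamma>2) * real S \<le> (1 + \<bar>ln \<gamma>1\<bar> / ln \<gamma>2) * K1 \<epsilon>"
    using \<gamma> by (intro mult_left_mono) auto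
  then show ?thesis using bounds(2) by linarith
qed

text \<open>\<open>k\<close> is the first index that is not executed or has a small gradient. The
  first alternative is impossible, because the step does not vanish where the gradient exceeds
  \<open>\<epsilon>\<close>.\<close>

theorem complexity:
  assumes \<epsilon>: "\<epsilon> > 0"
  shows "\<exists>k. executed s k \<and> f (x k) \<le> f (x 0) \<and> gradnorm k \<le> \<epsilon> \<and>
     real k \<le> (1 + \<bar>ln \<gamma>1\<bar> / ln \<gamma>2) * K1 \<epsilon> + 1 / ln \<gamma>2 * ln (\<sigma>max / \<sigma> 0) + 1"
proof -
  let ?B = "(1 + \<bar>ln \<gamma>1\<bar> / ln \<gamma>2) * K1 \<epsilon> + 1 / ln \<gamma>2 * ln (\<sigma>max / \<sigma> 0)"
  define stop where "stop k \<longleftrightarrow> \<not> (executed s k \<and> gradnorm k > \<epsilon>)" for k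
  \<comment> \<open>If no index stopped, \<open>count\<close> would apply to every \<open>N\<close>,
    also to one beyond the bound.\<close>
  obtain N :: nat where "real N > ?B" using reals_Archimedean2 by blast
  then have "\<exists>k. stop k" using count[OF \<epsilon>, of N] unfolding stop_def by fastforce
  define k where "k = (LEAST k. stop k)"
  have k: "stop k" using LeastI_ex[OF \<open>\<exists>k. stop k\<close>] by (simp add: k_def)
  have before: "executed s j \<and> gradnorm j > \<epsilon>" if "j < k" for j
    using not_less_Least[of j stop] that by (auto simp: k_def stop_def)
  have ex: "executed s k"
  proof (cases k)
    case (Suc j)
    then have j: "executed s j" "gradnorm j > \<epsilon>" using before by auto
    then have "s j \<noteq> 0" using gradnorm_eq_0 \<epsilon> by force
    then show ?thesis using j Suc by (simp add: executed_Suc)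
  qed (simp add: executed_def)
  moreover have "real k \<le> ?B + 1"
  proof (cases k)
    \<comment> \<open>There is no earlier iteration to count here, so the bound has to be
      nonnegative by itself; this uses \<open>\<sigma>max \<ge> \<sigma> 0\<close>.\<close>
    case 0
    have \<sigma>0: "\<sigma> 0 > 0" using run \<sigma>min by (simp add: arc_run_def)
    have "0 \<le> ln (\<sigma>max / \<sigma> 0)" using \<sigma>0 by (intro ln_ge_zero) simp
    moreover have "0 \<le> 1 + \<bar>ln \<gamma>1\<bar> / ln \<gamma>2" "0 \<le> 1 / ln \<gamma>2" using \<gamma> by auto
    ultimately have "0 \<le> ?B" using K1_nonneg
      by (intro add_nonneg_nonneg[OF mult_nonneg_nonneg mult_nonneg_nonneg])
    then show ?thesis using 0 by simp
  next
    case (Suc j)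
    \<comment> \<open>The indices up to \<open>j = k - 1\<close> have large gradients, so
      \<open>count\<close> bounds \<open>j\<close> and not \<open>k\<close>; the difference is the
      \<open>+ 1\<close> of the statement.\<close>
    have "real j \<le> ?B" using before Suc by (intro count[OF \<epsilon>]) auto
    then show ?thesis using Suc by simp
  qed
  moreover have "gradnorm k \<le> \<epsilon>" using k ex by (simp add: stop_def)
  ultimately show ?thesis using f_decreasing by blast
qed

end

theorem corollary2:
  fixes M :: "('m::{t2_space,second_countable_topology}, 'e::euclidean_space) riem"
    and f :: "'m \<Rightarrow> real"
    and x :: "nat \<Rightarrow> 'm" and s :: "nat \<Rightarrow> 'e" and \<sigma> :: "nat \<Rightarrow> real"
    and \<theta> \<sigma>min \<eta>1 \<eta>2 \<gamma>1 \<gamma>2 \<gamma>3 flow L L' :: real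
  assumes "complete_riemannian_manifold M"
    and "Cn_function 2 M f"
    and "\<theta> > 0" and "\<sigma>min > 0"
    and "0 < \<eta>1" and "\<eta>1 \<le> \<eta>2" and "\<eta>2 < 1"
    and "0 < \<gamma>1" and "\<gamma>1 < 1" and "1 < \<gamma>2" and "\<gamma>2 < \<gamma>3"
    and "arc_run M f (Exp M) \<theta> \<sigma>min \<eta>1 \<eta>2 \<gamma>1 \<gamma>2 \<gamma>3 x s \<sigma>"
    and A1: "\<And>y. f y \<ge> flow"
    and A2: "\<And>k. executed s k \<Longrightarrow>
      pullback f (Exp M) (x k) (s k) - taylor2 M f (Exp M) (x k) (s k)
        \<le> L / 6 * rnorm M (x k) (s k) ^ 3"
    and A3: "\<And>k. successful M f (Exp M) \<eta>1 x s \<sigma> k \<Longrightarrow>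
      rnorm M (x k) (inv (transport M (x k) (s k)) (grad M f (Exp M (x k) (s k)))
                       - grad M f (x k) - Hess M f (x k) (s k))
        \<le> L' / 2 * (rnorm M (x k) (s k))\<^sup>2"
  shows "let \<sigma>max = max (\<sigma> 0) (L * \<gamma>3 / (2 * (1 - \<eta>2)));
             K1 = (\<lambda>\<epsilon>. 3 * (f (x 0) - flow) / (\<eta>1 * \<sigma>min)
                     * (L' / 2 + \<theta> + \<sigma>max) powr (3/2) * (1 / \<epsilon> powr (3/2)))
         in \<forall>\<epsilon>>0. \<exists>k. executed s k \<and> f (x k) \<le> f (x 0) \<and> rnorm M (x k) (grad M f (x k)) \<le> \<epsilon> \<and>
              real k \<le> (1 + \<bar>ln \<gamma>1\<bar> / ln \<gamma>2) * K1 \<epsilon> + 1 / ln \<gamma>2 * ln (\<sigma>max / \<sigma> 0) + 1"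
proof -
  interpret arc M f x s \<sigma> \<theta> \<sigma>min \<eta>1 \<eta>2 \<gamma>1 \<gamma>2 \<gamma>3 flow L L'
  proof
    show "riemannian_manifold M" "\<exists>\<gamma>. geodesic M \<gamma> \<and> \<gamma> 0 = y \<and> velocity M \<gamma> 0 = v" for y v
      using assms(1) by (auto simp: complete_riemannian_manifold_def)
  qed (fact assms)+
  show ?thesis using complexity by (simp add: Let_def K1_def)
qed

end
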